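(* For every $K>1$ there exists a constant $c(K)>0$, depending only on $K$, such that the following holds for all positive integers $m,n,p$, every non-zero matrix $X\in\mathbb{R}^{m\times p}$ with rank $q$, every $A\in\mathbb{R}^{p\times n}$ and every $\sigma>0$. Let $Y=XA+\sigma E$, where $E$ is an $m\times n$ random matrix with i.i.d. standard Gaussian entries. Let $\mathrm{pen}_{\sigma^2}:\{0,1,\ldots,\min(n,q)\}\to\mathbb{R}$ satisfy $$\mathrm{pen}_{\sigma^2}(r)\ \ge\ K\,\mathcal{S}_{q\times n}(r)^2\qquad\text{for all } r\le \min(n,q),$$ and let $\hat r$ be a minimizer over $r\in\{0,1,\ldots,\min(n,q)\}$ of $$\mathrm{Crit}_{\sigma^2}(r)=\|Y-X\widehat A_r\|^2+\mathrm{pen}_{\sigma^2}(r)\,\sigma^2 .$$ Then the estimator $\widehat A=\widehat A_{\hat r}$ satisfies $$\mathbb{E}\big[\|X\widehat A-XA\|^2\big]\ \le\ c(K)\,\min_{r}\Big\{\mathbb{E}\big[\|XA-X\widehat A_r\|^2\big]+\mathrm{pen}_{\sigma^2}(r)\,\sigma^2+\sigma^2\Big\},$$ where the minimum is over $r\in\{0,1,\ldots,\min(n,q)\}$.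
   Context: $\|\cdot\|$ denotes the Hilbert–Schmidt (Frobenius) norm. $\sigma_1(M)\ge\sigma_2(M)\ge\cdots$ are the singular values of a matrix $M$, and $\|M\|_{(2,r)}=\big(\sum_{k=1}^r\sigma_k(M)^2\big)^{1/2}$ is its Ky-Fan $(2,r)$-norm (equal to $0$ for $r=0$). For a $q\times n$ random matrix $G_{q\times n}$ with i.i.d. standard Gaussian entries, $\mathcal{S}_{q\times n}(r)=\mathbb{E}\big[\|G_{q\times n}\|_{(2,r)}\big]$. The matrix $X$ is deterministic. For each $r$, $\widehat A_r$ denotes a minimizer of $B\mapsto\|Y-XB\|$ over the matrices $B\in\mathbb{R}^{p\times n}$ of rank at most $r$ (so $\widehat A_r$ depends on $Y$). *)

theory Defs
  imports
    "HOL-Probability.Probability"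
    "HOL-Computational_Algebra.Computational_Algebra"
    "Jordan_Normal_Form.Char_Poly"
    "Jordan_Normal_Form.DL_Rank"
begin

definition mat_rank :: "real mat \<Rightarrow> nat" where
  "mat_rank M = vec_space.rank (dim_row M) M"

definition hs_norm :: "real mat \<Rightarrow> real" where
  "hs_norm M = sqrt (\<Sum>i<dim_row M. \<Sum>j<dim_col M. (M $$ (i, j))\<^sup>2)"

(* Square roots of the eigenvalues of M^T M, with algebraic multiplicity, in decreasing order.
   M^T M is symmetric, so its characteristic polynomial splits over the reals and the list has
   length dim_col M; it may end with zeros beyond position min (dim_row M) (dim_col M). *)
definition singular_values :: "real mat \<Rightarrow> real list" where
  "singular_values M =
     rev (sorted_list_of_multiset (image_mset sqrt (proots (char_poly (transpose_mat M * M)))))"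

(* Indexed from 1, as sigma_1 \<ge> sigma_2 \<ge> ..., and extended by 0 beyond the last singular value. *)
definition singular_value :: "nat \<Rightarrow> real mat \<Rightarrow> real" where
  "singular_value k M =
     (if 1 \<le> k \<and> k \<le> length (singular_values M) then singular_values M ! (k - 1) else 0)"

definition ky_fan2 :: "nat \<Rightarrow> real mat \<Rightarrow> real" where
  "ky_fan2 r M = sqrt (\<Sum>k = 1..r. (singular_value k M)\<^sup>2)"

(* The law of an a \<times> b family of i.i.d. standard Gaussian variables. The random matrix itself
   is random_mat a b g for g drawn from this law. *)
definition gaussian_entries :: "nat \<Rightarrow> nat \<Rightarrow> (nat \<times> nat \<Rightarrow> real) measure" where
  "gaussian_entries a b = PiM ({..<a} \<times> {..<b}) (\<lambda>_. density lborel std_normal_density)"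

definition random_mat :: "nat \<Rightarrow> nat \<Rightarrow> (nat \<times> nat \<Rightarrow> real) \<Rightarrow> real mat" where
  "random_mat a b g = Matrix.mat a b g"

definition gaussian_ky_fan2 :: "nat \<Rightarrow> nat \<Rightarrow> nat \<Rightarrow> real" where
  "gaussian_ky_fan2 q n r = (LINT g | gaussian_entries q n. ky_fan2 r (random_mat q n g))"

definition is_rank_restricted_estimator :: "real mat \<Rightarrow> nat \<Rightarrow> real mat \<Rightarrow> real mat \<Rightarrow> bool" where
  "is_rank_restricted_estimator X r Y B \<longleftrightarrow>
     is_arg_min (\<lambda>B. hs_norm (Y - X * B))
       (\<lambda>B. B \<in> carrier_mat (dim_col X) (dim_col Y) \<and> mat_rank B \<le> r) B"

definition crit ::
  "real mat \<Rightarrow> real \<Rightarrow> (nat \<Rightarrow> real) \<Rightarrow> (nat \<Rightarrow> real mat \<Rightarrow> real mat) \<Rightarrow> real mat \<Rightarrow> nat \<Rightarrow> real" where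
  "crit X \<sigma> pen Ahat Y r = (hs_norm (Y - X * Ahat r Y))\<^sup>2 + pen r * \<sigma>\<^sup>2"

(* The integral in [0, \<infinity>] is used so that no measurability has to be imposed on the selection
   of the minimizers: X * Ahat r Y is almost surely unique for r \<le> min n (rank X), hence almost
   everywhere equal to a measurable function of the noise, and nn_integral respects such
   equalities also for non-measurable integrands. *)
definition expect_noise :: "nat \<Rightarrow> nat \<Rightarrow> (real mat \<Rightarrow> real) \<Rightarrow> ennreal" where
  "expect_noise m n f = (\<integral>\<^sup>+ g. ennreal (f (random_mat m n g)) \<partial>gaussian_entries m n)"

end

theory Submission
  imports Defs "Jordan_Normal_Form.Schur_Decomposition" "HOL-Combinatorics.Permutations"
begin

text \<open>Let \<open>B\<close> be the best rank \<open>r\<close> approximation of the noiseless signal \<open>X A\<close>. Minimality of the criterion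
  reduces the loss to a noise term \<open>2 \<sigma> \<langle>E, D\<rangle>\<close> with \<open>D = X (Ahat - B)\<close> of rank at most \<open>rhat + r\<close> and
  columns in the range of \<open>X\<close>. If the columns of \<open>Q\<close> are an orthonormal basis of that range, Ky Fan's
  maximum principle bounds \<open>\<langle>E, D\<rangle>\<close> by \<open>\<parallel>D\<parallel>\<close> times the Ky Fan norm of order \<open>rhat + r\<close> of \<open>Q\<^sup>T E\<close>, whose
  square is at most the sum of those of orders \<open>rhat\<close> and \<open>r\<close>. By rotational invariance these norms are
  distributed as those of a \<open>q \<times> n\<close> Gaussian matrix. They are 1-Lipschitz functions of the entries, so
  they concentrate around their means \<open>S r\<close> independently of the dimension, and \<open>S r\<^sup>2\<close> grows at least
  linearly in \<open>r\<close>; hence the expected excesses over \<open>K (S r)\<^sup>2\<close> are summable in \<open>r\<close>, with a sum depending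
  on \<open>K\<close> only. The concentration inequality is derived from Maurey's property tau.\<close>

section \<open>Gaussian measures and rotations\<close>

text \<open>The comparison matrix \<open>B\<close> is deterministic for a reason: the loss is then
  bounded by a constant plus a measurable function of the noise, so a non-measurable selection of
  minimizers does no harm, and the oracle risk still dominates because \<open>X * Ahat r Y\<close>
  competes with \<open>X * B\<close> for every realization of the noise. The obstacle is that
  \<open>rhat\<close> depends on the noise, so the penalty must beat the Ky Fan norms of all orders
  at once. The positive parts of the excesses are therefore added up over all ranks, and the proof
  hinges on bounding the expected sum independently of the dimensions. The slack in
  \<open>K > 1\<close> is split into two factors: \<open>1 + t\<close> is spent on Young's
  inequality for the noise term, and \<open>(1 + \<theta>)\<^sup>2\<close> on deviations of the Ky
  Fan norms above their means. Property tau fits because it asks for a Lipschitz bound and no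
  derivatives; Ky Fan norms obtain such a bound from their variational characterization, which also
  settles their measurability.\<close>

abbreviation std_gauss :: "real measure" where
  "std_gauss \<equiv> density lborel (\<lambda>x. ennreal (std_normal_density x))"

lemma prob_space_std_gauss: "prob_space std_gauss"
  by (rule prob_space_normal_density) simp

lemma nn_integral_std_gauss:
  assumes "f \<in> borel_measurable borel"
  shows "(\<integral>\<^sup>+x. f x \<partial>std_gauss) = (\<integral>\<^sup>+x. ennreal (std_normal_density x) * f x \<partial>lborel)"
  using assms by (subst nn_integral_density) auto

lemma nn_integral_shear_fst:
  fixes H :: "real \<Rightarrow> real \<Rightarrow> ennreal"
  assumes [measurable]: "(\<lambda>(y, z). H y z) \<in> borel_measurable (borel \<Otimes>\<^sub>M borel)"
  shows "(\<integral>\<^sup>+z. \<integral>\<^sup>+y. H (y + t * z) z \<partial>lborel \<partial>lborel) = (\<integral>\<^sup>+z. \<integral>\<^sup>+y. H y z \<partial>lborel \<partial>lborel)"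
proof (rule nn_integral_cong)
  fix z :: real
  have "(\<integral>\<^sup>+y. H y z \<partial>lborel) = (\<integral>\<^sup>+y. H (t * z + 1 * y) z \<partial>lborel)"
    using nn_integral_real_affine[of "\<lambda>y. H y z" 1 "t * z"] by simp
  then show "(\<integral>\<^sup>+y. H (y + t * z) z \<partial>lborel) = (\<integral>\<^sup>+y. H y z \<partial>lborel)"
    by (simp add: add.commute)
qed

lemma nn_integral_swap_lborel:
  fixes H :: "real \<Rightarrow> real \<Rightarrow> ennreal"
  assumes [measurable]: "(\<lambda>(y, z). H y z) \<in> borel_measurable (borel \<Otimes>\<^sub>M borel)"
  shows "(\<integral>\<^sup>+z. \<integral>\<^sup>+y. H y z \<partial>lborel \<partial>lborel) = (\<integral>\<^sup>+y. \<integral>\<^sup>+z. H y z \<partial>lborel \<partial>lborel)"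
  by (rule lborel_pair.Fubini') simp

lemma nn_integral_shear_snd:
  fixes H :: "real \<Rightarrow> real \<Rightarrow> ennreal"
  assumes [measurable]: "(\<lambda>(y, z). H y z) \<in> borel_measurable (borel \<Otimes>\<^sub>M borel)"
  shows "(\<integral>\<^sup>+z. \<integral>\<^sup>+y. H y (z + t * y) \<partial>lborel \<partial>lborel) = (\<integral>\<^sup>+z. \<integral>\<^sup>+y. H y z \<partial>lborel \<partial>lborel)"
proof -
  have "(\<integral>\<^sup>+z. \<integral>\<^sup>+y. H y (z + t * y) \<partial>lborel \<partial>lborel) = (\<integral>\<^sup>+y. \<integral>\<^sup>+z. H y (z + t * y) \<partial>lborel \<partial>lborel)"
    by (rule nn_integral_swap_lborel) measurable
  also have "\<dots> = (\<integral>\<^sup>+y. \<integral>\<^sup>+z. H y z \<partial>lborel \<partial>lborel)"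
    by (rule nn_integral_shear_fst[of "\<lambda>z y. H y z"]) measurable
  also have "\<dots> = (\<integral>\<^sup>+z. \<integral>\<^sup>+y. H y z \<partial>lborel \<partial>lborel)"
    by (rule nn_integral_swap_lborel[symmetric]) measurable
  finally show ?thesis .
qed

text \<open>A plane rotation is a product of three shears, and shears preserve Lebesgue measure by
  translation invariance on the line.\<close>

lemma nn_integral_rotation:
  fixes H :: "real \<Rightarrow> real \<Rightarrow> ennreal"
  assumes H[measurable]: "(\<lambda>(y, z). H y z) \<in> borel_measurable (borel \<Otimes>\<^sub>M borel)"
    and "c\<^sup>2 + s\<^sup>2 = 1" "s \<noteq> 0"
  shows "(\<integral>\<^sup>+z. \<integral>\<^sup>+y. H (c * y + s * z) (c * z - s * y) \<partial>lborel \<partial>lborel)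
       = (\<integral>\<^sup>+z. \<integral>\<^sup>+y. H y z \<partial>lborel \<partial>lborel)"
proof -
  \<comment> \<open>\<open>t\<close> is the tangent of half the rotation angle. The three shears
    have parameters \<open>t\<close>, \<open>- s\<close> and \<open>t\<close>; the division by
    \<open>s\<close> is the reason for assuming \<open>s \<noteq> 0\<close>.\<close>
  define t where "t = (1 - c) / s"
  have ts: "t * s = 1 - c" using assms by (simp add: t_def)
  have tt: "2 * t - s * t\<^sup>2 = s"
  proof -
    have "(2 * t - s * t\<^sup>2) * s = 2 * (t * s) - (t * s)\<^sup>2" by (simp add: power2_eq_square algebra_simps)
    also have "\<dots> = 1 - c\<^sup>2" unfolding ts by (simp add: power2_eq_square algebra_simps)
    also have "\<dots> = s * s" using assms(2) by (simp add: power2_eq_square)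
    finally show ?thesis using assms(3) by simp
  qed
  have eq1: "c * y + s * z = (y + t * z) + t * (z + (- s) * (y + t * z))" for y z
  proof -
    have "(y + t * z) + t * (z + (- s) * (y + t * z)) = y * (1 - t * s) + z * (2 * t - s * t\<^sup>2)"
      by (simp add: power2_eq_square algebra_simps)
    then show ?thesis unfolding ts tt by (simp add: algebra_simps)
  qed
  have eq2: "c * z - s * y = z + (- s) * (y + t * z)" for y z
  proof -
    have "z + (- s) * (y + t * z) = z * (1 - t * s) - s * y" by (simp add: algebra_simps)
    then show ?thesis unfolding ts by (simp add: algebra_simps)
  qed
  define H1 where "H1 = (\<lambda>y z. H (y + t * z) z)"
  define H2 where "H2 = (\<lambda>y z. H1 y (z + (- s) * y))"
  have [measurable]: "(\<lambda>(y, z). H1 y z) \<in> borel_measurable (borel \<Otimes>\<^sub>M borel)"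
    unfolding H1_def by measurable
  have [measurable]: "(\<lambda>(y, z). H2 y z) \<in> borel_measurable (borel \<Otimes>\<^sub>M borel)"
    unfolding H2_def by measurable
  have "(\<integral>\<^sup>+z. \<integral>\<^sup>+y. H (c * y + s * z) (c * z - s * y) \<partial>lborel \<partial>lborel)
      = (\<integral>\<^sup>+z. \<integral>\<^sup>+y. H2 (y + t * z) z \<partial>lborel \<partial>lborel)"
    unfolding H2_def H1_def by (simp only: eq1 eq2)
  also have "\<dots> = (\<integral>\<^sup>+z. \<integral>\<^sup>+y. H2 y z \<partial>lborel \<partial>lborel)" by (rule nn_integral_shear_fst) measurable
  also have "\<dots> = (\<integral>\<^sup>+z. \<integral>\<^sup>+y. H1 y z \<partial>lborel \<partial>lborel)"
    unfolding H2_def by (rule nn_integral_shear_snd) measurable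
  also have "\<dots> = (\<integral>\<^sup>+z. \<integral>\<^sup>+y. H y z \<partial>lborel \<partial>lborel)"
    unfolding H1_def by (rule nn_integral_shear_fst) measurable
  finally show ?thesis .
qed

lemma std_normal_density_mult_rotation:
  assumes "c\<^sup>2 + s\<^sup>2 = (1::real)"
  shows "std_normal_density (c * y + s * z) * std_normal_density (c * z - s * y)
    = std_normal_density y * std_normal_density z"
proof -
  have "(c * y + s * z)\<^sup>2 + (c * z - s * y)\<^sup>2 = (c\<^sup>2 + s\<^sup>2) * (y\<^sup>2 + z\<^sup>2)"
    by (simp add: power2_eq_square algebra_simps)
  then have eq: "(c * y + s * z)\<^sup>2 + (c * z - s * y)\<^sup>2 = y\<^sup>2 + z\<^sup>2" using assms by simp
  have g: "std_normal_density a * std_normal_density b = (1 / sqrt (2 * pi))\<^sup>2 * exp (- (a\<^sup>2 + b\<^sup>2) / 2)" for a b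
    by (simp add: std_normal_density_def power2_eq_square exp_add[symmetric] add_divide_distrib)
  show ?thesis unfolding g eq ..
qed

lemma nn_integral_std_gauss_rotation:
  fixes H :: "real \<Rightarrow> real \<Rightarrow> ennreal"
  assumes [measurable]: "(\<lambda>(y, z). H y z) \<in> borel_measurable (borel \<Otimes>\<^sub>M borel)"
    and cs: "c\<^sup>2 + s\<^sup>2 = 1" "s \<noteq> 0"
  shows "(\<integral>\<^sup>+z. \<integral>\<^sup>+y. H (c * y + s * z) (c * z - s * y) \<partial>std_gauss \<partial>std_gauss)
       = (\<integral>\<^sup>+z. \<integral>\<^sup>+y. H y z \<partial>std_gauss \<partial>std_gauss)"
proof -
  have *: "(\<integral>\<^sup>+z. \<integral>\<^sup>+y. F y z \<partial>std_gauss \<partial>std_gauss)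
      = (\<integral>\<^sup>+z. \<integral>\<^sup>+y. ennreal (std_normal_density y * std_normal_density z) * F y z \<partial>lborel \<partial>lborel)"
    if [measurable]: "(\<lambda>(y, z). F y z) \<in> borel_measurable (borel \<Otimes>\<^sub>M borel)" for F :: "real \<Rightarrow> real \<Rightarrow> ennreal"
  proof -
    have "(\<integral>\<^sup>+z. \<integral>\<^sup>+y. F y z \<partial>std_gauss \<partial>std_gauss)
      = (\<integral>\<^sup>+z. ennreal (std_normal_density z) * (\<integral>\<^sup>+y. F y z \<partial>std_gauss) \<partial>lborel)"
      by (subst nn_integral_std_gauss) (auto simp: prob_space_std_gauss prob_space_imp_sigma_finite
          intro!: sigma_finite_measure.borel_measurable_nn_integral)
    also have "\<dots> = (\<integral>\<^sup>+z. ennreal (std_normal_density z) * (\<integral>\<^sup>+y. ennreal (std_normal_density y) * F y z \<partial>lborel) \<partial>lborel)"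
      by (subst nn_integral_std_gauss) auto
    also have "\<dots> = (\<integral>\<^sup>+z. \<integral>\<^sup>+y. ennreal (std_normal_density y * std_normal_density z) * F y z \<partial>lborel \<partial>lborel)"
      by (subst nn_integral_cmult[symmetric]) (auto simp: ennreal_mult mult_ac)
    finally show ?thesis .
  qed
  have "(\<integral>\<^sup>+z. \<integral>\<^sup>+y. H (c * y + s * z) (c * z - s * y) \<partial>std_gauss \<partial>std_gauss)
     = (\<integral>\<^sup>+z. \<integral>\<^sup>+y. ennreal (std_normal_density (c * y + s * z) * std_normal_density (c * z - s * y)) *
          H (c * y + s * z) (c * z - s * y) \<partial>lborel \<partial>lborel)"
    unfolding std_normal_density_mult_rotation[OF cs(1)] by (rule *) measurable
  also have "\<dots> = (\<integral>\<^sup>+z. \<integral>\<^sup>+y. ennreal (std_normal_density y * std_normal_density z) * H y z \<partial>lborel \<partial>lborel)"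
    by (rule nn_integral_rotation[OF _ cs]) measurable
  also have "\<dots> = (\<integral>\<^sup>+z. \<integral>\<^sup>+y. H y z \<partial>std_gauss \<partial>std_gauss)" by (rule *[symmetric]) measurable
  finally show ?thesis .
qed

text \<open>Maurey's property tau on the line is proved like the one-dimensional
  Prekopa-Leindler inequality: the superlevel sets of \<open>U\<close> and \<open>V\<close> have diameters adding up to at
  most twice the length of the corresponding superlevel interval of the Gaussian density.\<close>

lemma emeasure_lborel_le_diameter:
  fixes A B :: "real set"
  assumes A: "A \<in> sets borel" "A \<noteq> {}" and B: "B \<in> sets borel" "B \<noteq> {}" and "0 \<le> \<rho>"
    and AB: "\<And>x y. x \<in> A \<Longrightarrow> y \<in> B \<Longrightarrow> \<bar>x + y\<bar> \<le> 2 * \<rho>"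
  shows "emeasure lborel A + emeasure lborel B \<le> ennreal (4 * \<rho>)"
proof -
  obtain x0 where x0: "x0 \<in> A" using A by blast
  obtain y0 where y0: "y0 \<in> B" using B by blast
  have bA: "bdd_above A" "bdd_below A"
    using AB[OF _ y0] by (auto intro!: bdd_aboveI[of _ "2 * \<rho> - y0"] bdd_belowI[of _ "- 2 * \<rho> - y0"] simp: abs_le_iff) 
      (smt (verit))+
  have "y \<le> 2 * \<rho> - Sup A" if "y \<in> B" for y
  proof -
    have "Sup A \<le> 2 * \<rho> - y" using A(2) by (rule cSup_least) (use AB[OF _ that] in \<open>auto simp: abs_le_iff\<close>, smt)
    then show ?thesis by simp
  qed
  moreover have "- 2 * \<rho> - Inf A \<le> y" if "y \<in> B" for y
  proof -
    have "- 2 * \<rho> - y \<le> Inf A" using A(2) by (rule cInf_greatest) (use AB[OF _ that] in \<open>auto simp: abs_le_iff\<close>, smt)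
    then show ?thesis by simp
  qed
  \<comment> \<open>The length of this interval and that of \<open>{Inf A .. Sup A}\<close> add up
    to exactly \<open>4 * \<rho>\<close>.\<close>
  ultimately have "B \<subseteq> {- 2 * \<rho> - Inf A .. 2 * \<rho> - Sup A}" by auto
  then have eB: "emeasure lborel B \<le> emeasure lborel {- 2 * \<rho> - Inf A .. 2 * \<rho> - Sup A}"
    by (intro emeasure_mono) auto
  have "A \<subseteq> {Inf A .. Sup A}" using bA by (auto intro: cInf_lower cSup_upper)
  then have eA: "emeasure lborel A \<le> emeasure lborel {Inf A .. Sup A}" by (intro emeasure_mono) auto
  have i1: "Inf A \<le> Sup A" using bA x0 by (meson cInf_lower cSup_upper order_trans)
  have i2: "- 2 * \<rho> - Inf A \<le> 2 * \<rho> - Sup A" using \<open>B \<subseteq> _\<close> y0 by auto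
  have "emeasure lborel A + emeasure lborel B \<le> ennreal (Sup A - Inf A) + ennreal (2 * \<rho> - Sup A - (- 2 * \<rho> - Inf A))"
    using eA eB i1 i2 by (intro add_mono) auto
  also have "\<dots> = ennreal (4 * \<rho>)"
    using i1 i2 by (subst ennreal_plus[symmetric]) auto
  finally show ?thesis .
qed

lemma nn_integral_layer_cake:
  fixes f :: "real \<Rightarrow> real"
  assumes [measurable]: "f \<in> borel_measurable borel" and f0: "\<And>x. 0 \<le> f x"
  shows "(\<integral>\<^sup>+x. ennreal (f x) \<partial>lborel) = (\<integral>\<^sup>+t\<in>{0<..}. emeasure lborel {x. t < f x} \<partial>lborel)"
proof -
  have "(\<integral>\<^sup>+x. ennreal (f x) \<partial>lborel) = (\<integral>\<^sup>+x. \<integral>\<^sup>+t. indicator {0<..<f x} t \<partial>lborel \<partial>lborel)"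
    using f0 by (intro nn_integral_cong) simp
  also have "\<dots> = (\<integral>\<^sup>+x. \<integral>\<^sup>+t. (if 0 < t \<and> t < f x then 1 else 0) \<partial>lborel \<partial>lborel)"
    by (intro nn_integral_cong) (auto simp: indicator_def)
  also have "\<dots> = (\<integral>\<^sup>+t. \<integral>\<^sup>+x. (if 0 < t \<and> t < f x then 1 else 0) \<partial>lborel \<partial>lborel)"
    by (rule nn_integral_swap_lborel) measurable
  also have "\<dots> = (\<integral>\<^sup>+t\<in>{0<..}. emeasure lborel {x. t < f x} \<partial>lborel)"
  proof (rule nn_integral_cong)
    fix t :: real
    have "(\<integral>\<^sup>+x. (if 0 < t \<and> t < f x then 1 else 0) \<partial>lborel) = (\<integral>\<^sup>+x. indicator {0<..} t * indicator {x. t < f x} x \<partial>lborel)"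
      by (intro nn_integral_cong) (auto simp: indicator_def)
    also have "\<dots> = indicator {0<..} t * emeasure lborel {x. t < f x}"
      by (subst nn_integral_cmult) auto
    finally show "(\<integral>\<^sup>+x. (if 0 < t \<and> t < f x then 1 else 0) \<partial>lborel) = emeasure lborel {x. t < f x} * indicator {0<..} t"
      by (simp add: mult.commute)
  qed
  finally show ?thesis .
qed

lemma std_normal_density_le_iff: "std_normal_density x \<le> std_normal_density y \<longleftrightarrow> \<bar>y\<bar> \<le> \<bar>x\<bar>"
  by (simp add: std_normal_density_def abs_le_square_iff divide_right_mono field_simps)

text \<open>With both suprema equal to 1, the superlevel sets of \<open>U\<close> and
  \<open>V\<close> are nonempty for the same levels \<open>t < 1\<close>, so they can be compared
  level by level. If \<open>U x\<close> and \<open>V y\<close> exceed \<open>t\<close>, their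
  product exceeds \<open>t\<^sup>2\<close>, hence the scaled density exceeds \<open>t\<close> at the
  midpoint and, by symmetry and unimodality, on the whole interval around 0 up to the midpoint. The
  bound is on a sum; the arithmetic-geometric mean inequality later turns it into a bound on a
  product.\<close>

lemma prekopa_leindler_gaussian_normalized:
  fixes U V :: "real \<Rightarrow> real"
  assumes [measurable]: "U \<in> borel_measurable borel" "V \<in> borel_measurable borel"
    and U: "\<And>x. 0 \<le> U x" "\<And>x. U x \<le> 1" "\<And>t. t < 1 \<Longrightarrow> \<exists>x. t < U x"
    and V: "\<And>x. 0 \<le> V x" "\<And>x. V x \<le> 1" "\<And>t. t < 1 \<Longrightarrow> \<exists>x. t < V x"
    and "0 < \<kappa>" and UV: "\<And>x y. U x * V y \<le> (\<kappa> * std_normal_density ((x + y) / 2))\<^sup>2"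
  shows "(\<integral>\<^sup>+x. ennreal (U x) \<partial>lborel) + (\<integral>\<^sup>+x. ennreal (V x) \<partial>lborel) \<le> ennreal (2 * \<kappa>)"
proof -
  define H where "H = (\<lambda>x. \<kappa> * std_normal_density x)"
  have [measurable]: "H \<in> borel_measurable borel" unfolding H_def by measurable
  have H0: "0 \<le> H x" for x using \<open>0 < \<kappa>\<close> by (simp add: H_def)
  have level: "emeasure lborel {x. t < U x} + emeasure lborel {x. t < V x} \<le> 2 * emeasure lborel {x. t < H x}"
    if t: "0 < t" for t
  proof (cases "t < 1")
    case False
    then have "{x. t < U x} = {}" "{x. t < V x} = {}" using U(2) V(2) by (auto simp: not_less intro: order_trans)
    then show ?thesis by simp
  next
    case True
    show ?thesis
    proof (cases "emeasure lborel {x. t < H x} = \<infinity>")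
      case True then show ?thesis by (simp add: ennreal_mult_top)
    next
      case False
      define \<rho> where "\<rho> = enn2real (emeasure lborel {x. t < H x}) / 2"
      have m: "emeasure lborel {x. t < H x} = ennreal (2 * \<rho>)"
        unfolding \<rho>_def using False by (simp add: less_top)
      have \<rho>0: "0 \<le> \<rho>" by (simp add: \<rho>_def)
      have "\<bar>x + y\<bar> \<le> 2 * \<rho>" if xy: "t < U x" "t < V y" for x y
      proof -
        define z where "z = \<bar>(x + y) / 2\<bar>"
        have "t\<^sup>2 < U x * V y" using xy t by (simp add: power2_eq_square mult_strict_mono)
        also have "\<dots> \<le> (H ((x + y) / 2))\<^sup>2" using UV by (simp add: H_def)
        finally have tH: "t < H ((x + y) / 2)" using H0 by (rule power2_less_imp_less)
        have "t < H w" if "\<bar>w\<bar> \<le> z" for w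
        proof -
          have "std_normal_density ((x + y) / 2) \<le> std_normal_density w"
            using that unfolding std_normal_density_le_iff z_def .
          then have "H ((x + y) / 2) \<le> H w" using \<open>0 < \<kappa>\<close> by (simp add: H_def)
          then show ?thesis using tH by simp
        qed
        then have "{- z .. z} \<subseteq> {x. t < H x}" by auto
        then have "emeasure lborel {- z .. z} \<le> ennreal (2 * \<rho>)"
          unfolding m[symmetric] by (intro emeasure_mono) auto
        then have "2 * z \<le> 2 * \<rho>" using \<rho>0 by (simp add: z_def)
        then show ?thesis by (simp add: z_def)
      qed
      then have "emeasure lborel {x. t < U x} + emeasure lborel {x. t < V x} \<le> ennreal (4 * \<rho>)"
        using U(3)[OF \<open>t < 1\<close>] V(3)[OF \<open>t < 1\<close>] \<rho>0
        by (intro emeasure_lborel_le_diameter) auto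
      also have "\<dots> = 2 * emeasure lborel {x. t < H x}"
        unfolding m using \<rho>0 by (simp add: ennreal_mult'' flip: ennreal_numeral) (simp add: ennreal_mult[symmetric])
      finally show ?thesis .
    qed
  qed
  have "(\<integral>\<^sup>+x. ennreal (U x) \<partial>lborel) + (\<integral>\<^sup>+x. ennreal (V x) \<partial>lborel)
     = (\<integral>\<^sup>+t. (emeasure lborel {x. t < U x} + emeasure lborel {x. t < V x}) * indicator {0<..} t \<partial>lborel)"
    unfolding nn_integral_layer_cake[OF assms(1) U(1)] nn_integral_layer_cake[OF assms(2) V(1)]
    by (subst nn_integral_add[symmetric]) (auto simp: distrib_right)
  also have "\<dots> \<le> (\<integral>\<^sup>+t. 2 * (emeasure lborel {x. t < H x} * indicator {0<..} t) \<partial>lborel)"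
    using level by (intro nn_integral_mono) (auto simp: indicator_def)
  also have "\<dots> = 2 * (\<integral>\<^sup>+x. ennreal (H x) \<partial>lborel)"
    unfolding nn_integral_layer_cake[OF \<open>H \<in> borel_measurable borel\<close> H0] by (subst nn_integral_cmult) auto
  also have "(\<integral>\<^sup>+x. ennreal (H x) \<partial>lborel) = ennreal \<kappa> * (\<integral>\<^sup>+x. ennreal (std_normal_density x) \<partial>lborel)"
    unfolding H_def using \<open>0 < \<kappa>\<close> by (subst nn_integral_cmult[symmetric]) (auto simp: ennreal_mult)
  also have "(\<integral>\<^sup>+x. ennreal (std_normal_density x) \<partial>lborel) = 1"
    using nn_integral_std_gauss[of "\<lambda>_. 1"] prob_space.emeasure_space_1[OF prob_space_std_gauss] by simp
  finally show ?thesis using \<open>0 < \<kappa>\<close> by (simp add: ennreal_mult)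
qed

text \<open>The parallelogram law in the exponent is the origin of the constant 1/4 in property tau:
  with this cost, the product of the two densities becomes exactly the squared density at the
  midpoint.\<close>

lemma std_normal_density_parallelogram:
  "std_normal_density x * std_normal_density y * exp ((x - y)\<^sup>2 / 4) = (std_normal_density ((x + y) / 2))\<^sup>2"
proof -
  have "- x\<^sup>2 / 2 + - y\<^sup>2 / 2 + (x - y)\<^sup>2 / 4 = - ((x + y) / 2)\<^sup>2 / 2 + - ((x + y) / 2)\<^sup>2 / 2"
    by (simp add: power2_eq_square field_simps)
  then have "exp (- x\<^sup>2 / 2) * exp (- y\<^sup>2 / 2) * exp ((x - y)\<^sup>2 / 4) = (exp (- ((x + y) / 2)\<^sup>2 / 2))\<^sup>2"
    unfolding power2_eq_square[of "exp _"] exp_add[symmetric] by simp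
  then show ?thesis by (simp add: std_normal_density_def power_mult_distrib power_divide divide_simps power2_eq_square mult_ac)
qed

text \<open>Multiplying \<open>u\<close> and \<open>v\<close> by the density turns the hypothesis
  into a midpoint inequality for \<open>U\<close> and \<open>V\<close>. After division by the
  suprema \<open>a\<close> and \<open>b\<close>, the normalized lemma gives
  \<open>p + q \<le> 2 / sqrt (a * b)\<close>, hence \<open>p * q \<le> 1 / (a * b)\<close>, and the
  two Gaussian integrals are \<open>a * p\<close> and \<open>b * q\<close>.\<close>

lemma gaussian_property_tau_line:
  fixes u v :: "real \<Rightarrow> ennreal"
  assumes [measurable]: "u \<in> borel_measurable borel" "v \<in> borel_measurable borel"
    and uv: "\<And>x y. u x * v y \<le> ennreal (exp ((x - y)\<^sup>2 / 4))"
  shows "(\<integral>\<^sup>+x. u x \<partial>std_gauss) * (\<integral>\<^sup>+x. v x \<partial>std_gauss) \<le> 1"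
proof (cases "(\<forall>x. u x = 0) \<or> (\<forall>x. v x = 0)")
  case True
  then show ?thesis by auto
next
  case False
  then obtain x0 y0 where x0: "u x0 \<noteq> 0" and y0: "v y0 \<noteq> 0" by blast
  \<comment> \<open>A single point where one function is nonzero forces the other to be finite
    everywhere, so both can be treated as real-valued.\<close>
  have uf: "u x < \<infinity>" for x using uv[of x y0] y0 by (auto simp: ennreal_top_mult less_top[symmetric] top_unique)
  have vf: "v x < \<infinity>" for x using uv[of x0 x] x0 by (auto simp: ennreal_mult_top less_top[symmetric] top_unique)
  define U where "U = (\<lambda>x. std_normal_density x * enn2real (u x))"
  define V where "V = (\<lambda>x. std_normal_density x * enn2real (v x))"
  have mU[measurable]: "U \<in> borel_measurable borel" unfolding U_def by measurable
  have mV[measurable]: "V \<in> borel_measurable borel" unfolding V_def by measurable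
  have U0: "0 \<le> U x" and V0: "0 \<le> V x" for x by (auto simp: U_def V_def)
  have Upos: "0 < U x0" using x0 uf[of x0] unfolding U_def
    by (intro mult_pos_pos normal_density_pos) (auto simp: enn2real_positive_iff zero_less_iff_neq_zero)
  have Vpos: "0 < V y0" using y0 vf[of y0] unfolding V_def
    by (intro mult_pos_pos normal_density_pos) (auto simp: enn2real_positive_iff zero_less_iff_neq_zero)
  have UV: "U x * V y \<le> (std_normal_density ((x + y) / 2))\<^sup>2" for x y
  proof -
    have "enn2real (u x) * enn2real (v y) = enn2real (u x * v y)" by (simp add: enn2real_mult)
    also have "\<dots> \<le> exp ((x - y)\<^sup>2 / 4)" using enn2real_mono[OF uv] by simp
    finally have "std_normal_density x * std_normal_density y * (enn2real (u x) * enn2real (v y))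
      \<le> std_normal_density x * std_normal_density y * exp ((x - y)\<^sup>2 / 4)"
      by (intro mult_left_mono) auto
    then show ?thesis unfolding std_normal_density_parallelogram by (simp add: U_def V_def mult_ac)
  qed
  \<comment> \<open>The density is largest at 0. Together with one point where the other function is
    positive, this makes the suprema used for the normalization finite.\<close>
  have UV0: "U x * V y \<le> (std_normal_density 0)\<^sup>2" for x y
    using UV[of x y] by (rule order_trans) (intro power_mono, auto simp: std_normal_density_le_iff)
  have bU: "bdd_above (range U)"
    using UV0[of _ y0] Vpos by (intro bdd_aboveI[of _ "(std_normal_density 0)\<^sup>2 / V y0"]) (auto simp: field_simps)
  have bV: "bdd_above (range V)"
    using UV0[of x0] Upos by (intro bdd_aboveI[of _ "(std_normal_density 0)\<^sup>2 / U x0"]) (auto simp: field_simps)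
  define a where "a = Sup (range U)"
  define b where "b = Sup (range V)"
  have Ua: "U x \<le> a" and Vb: "V x \<le> b" for x using bU bV by (auto simp: a_def b_def intro: cSup_upper)
  have a: "0 < a" and b: "0 < b" using Upos Vpos Ua[of x0] Vb[of y0] by linarith+
  have exa: "\<exists>x. t < U x / a" if "t < 1" for t
  proof -
    have "t * a < a" using that a by simp
    then obtain x where "t * a < U x" unfolding a_def using less_cSup_iff[of "range U"] bU by auto
    then show ?thesis using a by (auto simp: field_simps)
  qed
  have exb: "\<exists>x. t < V x / b" if "t < 1" for t
  proof -
    have "t * b < b" using that b by simp
    then obtain x where "t * b < V x" unfolding b_def using less_cSup_iff[of "range V"] bV by auto
    then show ?thesis using b by (auto simp: field_simps)
  qed
  have "(\<integral>\<^sup>+x. ennreal (U x / a) \<partial>lborel) + (\<integral>\<^sup>+x. ennreal (V x / b) \<partial>lborel) \<le> ennreal (2 * (1 / sqrt (a * b)))"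
  proof (rule prekopa_leindler_gaussian_normalized)
    fix x y
    have "(1 / sqrt (a * b) * std_normal_density ((x + y) / 2))\<^sup>2 = (std_normal_density ((x + y) / 2))\<^sup>2 / (a * b)"
      using a b by (simp add: power_mult_distrib power_divide)
    then show "U x / a * (V y / b) \<le> (1 / sqrt (a * b) * std_normal_density ((x + y) / 2))\<^sup>2"
      using UV[of x y] a b by (simp add: divide_right_mono)
  qed (use a b U0 V0 Ua Vb exa exb in auto)
  moreover define P where "P = (\<integral>\<^sup>+x. ennreal (U x / a) \<partial>lborel)"
  moreover define Q where "Q = (\<integral>\<^sup>+x. ennreal (V x / b) \<partial>lborel)"
  ultimately have PQ: "P + Q \<le> ennreal (2 * (1 / sqrt (a * b)))" by simp
  have fin: "P < \<infinity>" "Q < \<infinity>" using PQ by (auto simp: less_top[symmetric] top_unique)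
  obtain p q where pq: "P = ennreal p" "0 \<le> p" "Q = ennreal q" "0 \<le> q"
    using fin by (cases P; cases Q) auto
  have le: "p + q \<le> 2 * (1 / sqrt (a * b))"
    using PQ pq a b by (simp add: ennreal_plus[symmetric] del: ennreal_plus)
  have "4 * (p * q) \<le> (p + q)\<^sup>2" using zero_le_power2[of "p - q"] by (simp add: power2_eq_square algebra_simps)
  also have "\<dots> \<le> (2 * (1 / sqrt (a * b)))\<^sup>2" using le pq by (intro power_mono) auto
  also have "\<dots> = 4 / (a * b)" using a b by (simp add: power_divide)
  finally have "p * q * (a * b) \<le> 1" using a b by (simp add: field_simps)
  then have fine: "(a * p) * (b * q) \<le> 1" by (simp add: mult_ac)
  have IU: "(\<integral>\<^sup>+x. u x \<partial>std_gauss) = ennreal (a * p)"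
  proof -
    have "(\<integral>\<^sup>+x. u x \<partial>std_gauss) = (\<integral>\<^sup>+x. ennreal a * ennreal (U x / a) \<partial>lborel)"
      using a uf by (auto simp: nn_integral_std_gauss U_def ennreal_mult[symmetric] ennreal_mult' intro!: nn_integral_cong)
    also have "\<dots> = ennreal a * P" unfolding P_def by (rule nn_integral_cmult) simp
    finally show ?thesis using pq a by (simp add: ennreal_mult)
  qed
  have IV: "(\<integral>\<^sup>+x. v x \<partial>std_gauss) = ennreal (b * q)"
  proof -
    have "(\<integral>\<^sup>+x. v x \<partial>std_gauss) = (\<integral>\<^sup>+x. ennreal b * ennreal (V x / b) \<partial>lborel)"
      using b vf by (auto simp: nn_integral_std_gauss V_def ennreal_mult[symmetric] ennreal_mult' intro!: nn_integral_cong)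
    also have "\<dots> = ennreal b * Q" unfolding Q_def by (rule nn_integral_cmult) simp
    finally show ?thesis using pq b by (simp add: ennreal_mult)
  qed
  show ?thesis unfolding IU IV using fine pq a b by (simp add: ennreal_mult[symmetric] flip: ennreal_1)
qed

section \<open>Product Gaussian measures: tensorization and plane rotations\<close>

abbreviation gauss_PiM :: "'i set \<Rightarrow> ('i \<Rightarrow> real) measure" where
  "gauss_PiM I \<equiv> PiM I (\<lambda>_. std_gauss)"

interpretation std_gauss: prob_space std_gauss
  by (rule prob_space_std_gauss)

interpretation std_gauss_product: product_prob_space "\<lambda>_. std_gauss" I for I
  by unfold_locales

lemma sets_gauss_PiM [measurable_cong]: "sets (gauss_PiM I) = sets (PiM I (\<lambda>_. borel))"
  by (intro sets_PiM_cong) auto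

lemma prob_space_gauss_PiM: "prob_space (gauss_PiM I)"
  by (rule prob_space_PiM) (rule prob_space_std_gauss)

text \<open>The two-function form of the property tensorizes by Fubini: fixing one coordinate of
  both functions leaves the same inequality in the other coordinates, up to a constant factor.\<close>

lemma gaussian_property_tau:
  fixes u v :: "('i \<Rightarrow> real) \<Rightarrow> ennreal"
  assumes "finite I"
    and "u \<in> borel_measurable (gauss_PiM I)" "v \<in> borel_measurable (gauss_PiM I)"
    and "\<And>x y. x \<in> extensional I \<Longrightarrow> y \<in> extensional I \<Longrightarrow>
      u x * v y \<le> ennreal (exp ((\<Sum>i\<in>I. (x i - y i)\<^sup>2) / 4))"
  shows "(\<integral>\<^sup>+x. u x \<partial>gauss_PiM I) * (\<integral>\<^sup>+x. v x \<partial>gauss_PiM I) \<le> 1"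
  using assms
proof (induction I arbitrary: u v rule: finite_induct)
  case empty
  then show ?case by (simp add: std_gauss_product.nn_integral_empty)
next
  case (insert i I)
  note [measurable] = insert.prems(1,2)
  define u1 where "u1 = (\<lambda>t. \<integral>\<^sup>+x. u (x(i := t)) \<partial>gauss_PiM I)"
  define v1 where "v1 = (\<lambda>t. \<integral>\<^sup>+x. v (x(i := t)) \<partial>gauss_PiM I)"
  have sf: "sigma_finite_measure (gauss_PiM I)"
    by (rule prob_space_imp_sigma_finite) (rule prob_space_gauss_PiM)
  have mu: "(\<lambda>(t, x). u (x(i := t))) \<in> borel_measurable (borel \<Otimes>\<^sub>M gauss_PiM I)"
    by measurable
  have mv: "(\<lambda>(t, x). v (x(i := t))) \<in> borel_measurable (borel \<Otimes>\<^sub>M gauss_PiM I)"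
    by measurable
  have mu1[measurable]: "u1 \<in> borel_measurable borel" unfolding u1_def
    using sigma_finite_measure.borel_measurable_nn_integral[OF sf mu] by simp
  have mv1[measurable]: "v1 \<in> borel_measurable borel" unfolding v1_def
    using sigma_finite_measure.borel_measurable_nn_integral[OF sf mv] by simp
  have mu': "(\<lambda>x. u (x(i := t))) \<in> borel_measurable (gauss_PiM I)" for t by measurable
  have mv': "(\<lambda>x. v (x(i := t))) \<in> borel_measurable (gauss_PiM I)" for t by measurable
  have "u1 t * v1 s \<le> ennreal (exp ((t - s)\<^sup>2 / 4))" for t s
  proof -
    define k where "k = exp (- (t - s)\<^sup>2 / 4)"
    have "(\<integral>\<^sup>+x. ennreal k * u (x(i := t)) \<partial>gauss_PiM I) * (\<integral>\<^sup>+x. v (x(i := s)) \<partial>gauss_PiM I) \<le> 1"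
    proof (rule insert.IH[of "\<lambda>x. ennreal k * u (x(i := t))" "\<lambda>x. v (x(i := s))"])
      fix x y :: "'i \<Rightarrow> real" assume xy: "x \<in> extensional I" "y \<in> extensional I"
      then have "u (x(i := t)) * v (y(i := s))
          \<le> ennreal (exp ((\<Sum>j\<in>insert i I. ((x(i := t)) j - (y(i := s)) j)\<^sup>2) / 4))"
        by (intro insert.prems(3)[of "x(i := t)" "y(i := s)"]) (auto simp: extensional_def)
      moreover have "(\<Sum>j\<in>insert i I. ((x(i := t)) j - (y(i := s)) j)\<^sup>2) = (t - s)\<^sup>2 + (\<Sum>j\<in>I. (x j - y j)\<^sup>2)"
        using insert.hyps by (simp add: sum.insert_if) (auto intro!: sum.cong)
      ultimately have "u (x(i := t)) * v (y(i := s)) \<le> ennreal (exp (((t - s)\<^sup>2 + (\<Sum>j\<in>I. (x j - y j)\<^sup>2)) / 4))"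
        by (simp only:)
      then have "ennreal k * (u (x(i := t)) * v (y(i := s)))
          \<le> ennreal k * ennreal (exp (((t - s)\<^sup>2 + (\<Sum>j\<in>I. (x j - y j)\<^sup>2)) / 4))"
        by (rule mult_left_mono) simp
      also have "\<dots> = ennreal (exp ((\<Sum>j\<in>I. (x j - y j)\<^sup>2) / 4))"
        by (simp add: k_def ennreal_mult[symmetric] exp_add[symmetric] add_divide_distrib)
      finally show "ennreal k * u (x(i := t)) * v (y(i := s)) \<le> ennreal (exp ((\<Sum>i\<in>I. (x i - y i)\<^sup>2) / 4))"
        by (simp add: mult.assoc)
    qed (intro borel_measurable_times_ennreal mu' mv' borel_measurable_const)+
    then have "ennreal k * u1 t * v1 s \<le> 1"
      unfolding u1_def v1_def by (subst (asm) nn_integral_cmult) (rule mu')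
    then have "ennreal (exp ((t - s)\<^sup>2 / 4)) * (ennreal k * u1 t * v1 s) \<le> ennreal (exp ((t - s)\<^sup>2 / 4)) * 1"
      by (intro mult_left_mono) auto
    moreover have "ennreal (exp ((t - s)\<^sup>2 / 4)) * ennreal k = 1"
      by (simp add: k_def ennreal_mult[symmetric] exp_add[symmetric])
    ultimately show ?thesis by (simp add: mult.assoc[symmetric])
  qed
  then have "(\<integral>\<^sup>+t. u1 t \<partial>std_gauss) * (\<integral>\<^sup>+t. v1 t \<partial>std_gauss) \<le> 1"
    by (intro gaussian_property_tau_line) auto
  then show ?case
    unfolding u1_def v1_def using insert.hyps
    by (subst (1 2) std_gauss_product.product_nn_integral_insert_rev) auto
qed

text \<open>By Fubini the two rotated coordinates are integrated innermost, so the planar statement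
  applies for each value of the others. One plane rotation at a time is enough: the orthogonal
  matrices needed later are built as products of such rotations.\<close>

lemma nn_integral_gauss_PiM_rotation:
  fixes F :: "('i \<Rightarrow> real) \<Rightarrow> ennreal"
  assumes "finite I" "a \<in> I" "b \<in> I" "a \<noteq> b" and cs: "c\<^sup>2 + s\<^sup>2 = 1" "s \<noteq> 0"
    and F[measurable]: "F \<in> borel_measurable (gauss_PiM I)"
  shows "(\<integral>\<^sup>+x. F (x(a := c * x a + s * x b, b := c * x b - s * x a)) \<partial>gauss_PiM I) = (\<integral>\<^sup>+x. F x \<partial>gauss_PiM I)"
proof -
  define J where "J = I - {a, b}"
  have I: "I = insert a (insert b J)" and J: "finite J" "a \<notin> insert b J" "b \<notin> J"
    using assms by (auto simp: J_def)
  have F'[measurable]: "F \<in> borel_measurable (gauss_PiM (insert a (insert b J)))" using F I by simp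
  have split: "(\<integral>\<^sup>+x. f x \<partial>gauss_PiM I) = (\<integral>\<^sup>+x. \<integral>\<^sup>+z. \<integral>\<^sup>+y. f (x(b := z, a := y)) \<partial>std_gauss \<partial>std_gauss \<partial>gauss_PiM J)"
    if f[measurable]: "f \<in> borel_measurable (gauss_PiM (insert a (insert b J)))" for f :: "('i \<Rightarrow> real) \<Rightarrow> ennreal"
  proof -
    have m: "(\<lambda>(x, y). f (x(a := y))) \<in> borel_measurable (gauss_PiM (insert b J) \<Otimes>\<^sub>M std_gauss)"
      by measurable
    show ?thesis unfolding I using J
      by (simp add: std_gauss_product.product_nn_integral_insert f
          std_gauss.borel_measurable_nn_integral[OF m])
  qed
  define R where "R = (\<lambda>x::'i \<Rightarrow> real. x(a := c * x a + s * x b, b := c * x b - s * x a))"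
  have mR[measurable]: "R \<in> measurable (gauss_PiM (insert a (insert b J))) (gauss_PiM (insert a (insert b J)))"
    unfolding R_def by (intro measurable_fun_upd[of _ "insert a (insert b J)"]) (auto simp: insert_absorb)
  have "(\<integral>\<^sup>+x. F (R x) \<partial>gauss_PiM I) = (\<integral>\<^sup>+x. \<integral>\<^sup>+z. \<integral>\<^sup>+y. F (R (x(b := z, a := y))) \<partial>std_gauss \<partial>std_gauss \<partial>gauss_PiM J)"
    by (rule split) measurable
  also have "\<dots> = (\<integral>\<^sup>+x. \<integral>\<^sup>+z. \<integral>\<^sup>+y. F (x(b := z, a := y)) \<partial>std_gauss \<partial>std_gauss \<partial>gauss_PiM J)"
  proof (rule nn_integral_cong)
    fix x assume x: "x \<in> space (gauss_PiM J)"
    have R: "R (x(b := z, a := y)) = x(b := c * z - s * y, a := c * y + s * z)" for y z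
      using \<open>a \<noteq> b\<close> by (auto simp: R_def fun_eq_iff)
    have [measurable]: "(\<lambda>(y, z). x(b := z, a := y)) \<in> measurable (borel \<Otimes>\<^sub>M borel) (gauss_PiM (insert a (insert b J)))"
    proof -
      have "(\<lambda>p. x(b := snd p)) \<in> measurable (borel \<Otimes>\<^sub>M borel) (PiM (insert b J) (\<lambda>_. std_gauss))"
        using x by (intro measurable_fun_upd[where J=J]) auto
      then have "(\<lambda>p. x(b := snd p, a := fst p)) \<in> measurable (borel \<Otimes>\<^sub>M borel) (gauss_PiM (insert a (insert b J)))"
        by (rule measurable_fun_upd[where J="insert b J", rotated]) auto
      then show ?thesis by (simp add: case_prod_beta')
    qed
    show "(\<integral>\<^sup>+z. \<integral>\<^sup>+y. F (R (x(b := z, a := y))) \<partial>std_gauss \<partial>std_gauss) = (\<integral>\<^sup>+z. \<integral>\<^sup>+y. F (x(b := z, a := y)) \<partial>std_gauss \<partial>std_gauss)"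
      unfolding R by (rule nn_integral_std_gauss_rotation[OF _ cs]) measurable
  qed
  also have "\<dots> = (\<integral>\<^sup>+x. F x \<partial>gauss_PiM I)" by (rule split[symmetric]) measurable
  finally show ?thesis unfolding R_def .
qed

section \<open>Concentration of Lipschitz functions\<close>

text \<open>As a function of \<open>l\<close>, the expression \<open>l * s - l\<^sup>2\<close> peaks
  at \<open>s / 2\<close> with value \<open>s\<^sup>2 / 4\<close>. This converts a Lipschitz bound
  into the cost of property tau at the price of a factor \<open>exp (l\<^sup>2)\<close>.\<close>

lemma mult_minus_square_le:
  fixes l d :: real assumes "0 \<le> l" "0 \<le> d2" "d \<le> sqrt d2"
  shows "l * d - l\<^sup>2 \<le> d2 / 4"
proof -
  have "l * d \<le> l * sqrt d2" using assms by (intro mult_left_mono) auto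
  moreover have "0 \<le> (l - sqrt d2 / 2)\<^sup>2" by simp
  ultimately show ?thesis using assms by (simp add: power2_eq_square algebra_simps)
qed

locale gaussian_lipschitz =
  fixes I :: "'i set" and N :: "('i \<Rightarrow> real) \<Rightarrow> real"
  assumes finite_I: "finite I"
    and measurable_N [measurable]: "N \<in> borel_measurable (gauss_PiM I)"
    and lipschitz_N: "x \<in> extensional I \<Longrightarrow> y \<in> extensional I \<Longrightarrow> N x - N y \<le> sqrt (\<Sum>i\<in>I. (x i - y i)\<^sup>2)"
begin

definition mean :: real where "mean = (\<integral>x. N x \<partial>gauss_PiM I)"

text \<open>Property tau is applied to \<open>exp (l * N x - l\<^sup>2)\<close> and
  \<open>exp (- (l * N y))\<close>. A constant added to \<open>N\<close> would cancel in the
  product, so no mean has to exist beforehand; integrability is a consequence of this bound.\<close>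

lemma nn_integral_exp_mult:
  assumes "0 \<le> l"
  shows "(\<integral>\<^sup>+x. ennreal (exp (l * N x)) \<partial>gauss_PiM I) * (\<integral>\<^sup>+x. ennreal (exp (- (l * N x))) \<partial>gauss_PiM I)
    \<le> ennreal (exp (l\<^sup>2))"
proof -
  have "(\<integral>\<^sup>+x. ennreal (exp (- l\<^sup>2)) * ennreal (exp (l * N x)) \<partial>gauss_PiM I) * (\<integral>\<^sup>+x. ennreal (exp (- (l * N x))) \<partial>gauss_PiM I) \<le> 1"
  proof (rule gaussian_property_tau[OF finite_I])
    fix x y :: "'i \<Rightarrow> real" assume xy: "x \<in> extensional I" "y \<in> extensional I"
    have "l * (N x - N y) - l\<^sup>2 \<le> (\<Sum>i\<in>I. (x i - y i)\<^sup>2) / 4"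
      using lipschitz_N[OF xy] assms by (intro mult_minus_square_le) (auto intro: sum_nonneg)
    then have "exp (- l\<^sup>2) * exp (l * N x) * exp (- (l * N y)) \<le> exp ((\<Sum>i\<in>I. (x i - y i)\<^sup>2) / 4)"
      by (simp add: exp_add[symmetric] algebra_simps)
    then show "ennreal (exp (- l\<^sup>2)) * ennreal (exp (l * N x)) * ennreal (exp (- (l * N y))) \<le> ennreal (exp ((\<Sum>i\<in>I. (x i - y i)\<^sup>2) / 4))"
      by (simp add: ennreal_mult[symmetric])
  qed measurable
  then have "ennreal (exp (- l\<^sup>2)) * ((\<integral>\<^sup>+x. ennreal (exp (l * N x)) \<partial>gauss_PiM I) * (\<integral>\<^sup>+x. ennreal (exp (- (l * N x))) \<partial>gauss_PiM I)) \<le> 1"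
    by (simp add: nn_integral_cmult mult.assoc)
  then have "ennreal (exp (l\<^sup>2)) * (ennreal (exp (- l\<^sup>2)) * ((\<integral>\<^sup>+x. ennreal (exp (l * N x)) \<partial>gauss_PiM I) * (\<integral>\<^sup>+x. ennreal (exp (- (l * N x))) \<partial>gauss_PiM I)))
     \<le> ennreal (exp (l\<^sup>2)) * 1" by (intro mult_left_mono) auto
  then show ?thesis by (simp add: mult.assoc[symmetric] ennreal_mult[symmetric] exp_add[symmetric])
qed

lemma nn_integral_exp_pos: "0 < (\<integral>\<^sup>+x. ennreal (exp (f x)) \<partial>gauss_PiM I)"
  if [measurable]: "f \<in> borel_measurable (gauss_PiM I)"
proof (rule ccontr)
  assume "\<not> ?thesis"
  then have "AE x in gauss_PiM I. ennreal (exp (f x)) = 0"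
    by (subst nn_integral_0_iff_AE[symmetric]) auto
  then show False by simp
qed

text \<open>Both factors of the product bounded above are positive, so neither can be
  infinite.\<close>

lemma integrable_exp:
  assumes "0 \<le> l"
  shows "integrable (gauss_PiM I) (\<lambda>x. exp (l * N x))" "integrable (gauss_PiM I) (\<lambda>x. exp (- (l * N x)))"
proof -
  have A: "0 < (\<integral>\<^sup>+x. ennreal (exp (l * N x)) \<partial>gauss_PiM I)" and B: "0 < (\<integral>\<^sup>+x. ennreal (exp (- (l * N x))) \<partial>gauss_PiM I)"
    by (rule nn_integral_exp_pos, measurable)+
  have "(\<integral>\<^sup>+x. ennreal (exp (l * N x)) \<partial>gauss_PiM I) < \<infinity>"
    using nn_integral_exp_mult[OF assms] B by (auto simp: ennreal_top_mult less_top[symmetric] top_unique split: if_splits)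
  then show "integrable (gauss_PiM I) (\<lambda>x. exp (l * N x))" by (intro integrableI_bounded) auto
  have "(\<integral>\<^sup>+x. ennreal (exp (- (l * N x))) \<partial>gauss_PiM I) < \<infinity>"
    using nn_integral_exp_mult[OF assms] A by (auto simp: ennreal_mult_top less_top[symmetric] top_unique split: if_splits)
  then show "integrable (gauss_PiM I) (\<lambda>x. exp (- (l * N x)))" by (intro integrableI_bounded) auto
qed

lemma integrable_N: "integrable (gauss_PiM I) N"
proof (rule Bochner_Integration.integrable_bound)
  show "integrable (gauss_PiM I) (\<lambda>x. exp (1 * N x) + exp (- (1 * N x)))"
    by (intro Bochner_Integration.integrable_add integrable_exp) auto
  have "\<bar>t\<bar> \<le> exp t + exp (- t)" for t :: real
    using exp_ge_add_one_self[of t] exp_ge_add_one_self[of "- t"] exp_gt_zero[of t] exp_gt_zero[of "- t"] by linarith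
  then show "AE x in gauss_PiM I. norm (N x) \<le> norm (exp (1 * N x) + exp (- (1 * N x)))"
    by (auto simp: abs_of_pos add_pos_pos)
qed measurable

text \<open>Jensen's inequality bounds the second factor of \<open>nn_integral_exp_mult\<close> from
  below by \<open>exp (- (l * mean))\<close>, so that factor can be traded for the
  centering.\<close>

lemma nn_integral_exp_centered:
  assumes "0 \<le> l"
  shows "(\<integral>\<^sup>+x. ennreal (exp (l * (N x - mean))) \<partial>gauss_PiM I) \<le> ennreal (exp (l\<^sup>2))"
proof -
  \<comment> \<open>This is the tangent line of the exponential function at
    \<open>- (l * mean)\<close>; integrating it proves Jensen's inequality.\<close>
  have "exp (- (l * mean)) * (1 - l * (N x - mean)) \<le> exp (- (l * N x))" for x
  proof -
    have "1 - l * (N x - mean) \<le> exp (- (l * (N x - mean)))"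
      using exp_ge_add_one_self[of "- (l * (N x - mean))"] by simp
    then have "exp (- (l * mean)) * (1 - l * (N x - mean)) \<le> exp (- (l * mean)) * exp (- (l * (N x - mean)))"
      by (intro mult_left_mono) auto
    also have "\<dots> = exp (- (l * N x))" by (simp add: exp_add[symmetric] algebra_simps)
    finally show ?thesis .
  qed
  then have "(\<integral>x. exp (- (l * mean)) * (1 - l * (N x - mean)) \<partial>gauss_PiM I) \<le> (\<integral>x. exp (- (l * N x)) \<partial>gauss_PiM I)"
    using integrable_N integrable_exp[OF assms] by (intro integral_mono) auto
  then have "exp (- (l * mean)) \<le> (\<integral>x. exp (- (l * N x)) \<partial>gauss_PiM I)"
    using integrable_N by (simp add: prob_space.prob_space[OF prob_space_gauss_PiM] mean_def)
  then have J: "ennreal (exp (- (l * mean))) \<le> (\<integral>\<^sup>+x. ennreal (exp (- (l * N x))) \<partial>gauss_PiM I)"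
    using integrable_exp[OF assms] by (subst nn_integral_eq_integral) auto
  have "(\<integral>\<^sup>+x. ennreal (exp (l * (N x - mean))) \<partial>gauss_PiM I)
     = (\<integral>\<^sup>+x. ennreal (exp (l * N x)) * ennreal (exp (- (l * mean))) \<partial>gauss_PiM I)"
    by (intro nn_integral_cong) (simp add: ennreal_mult[symmetric] exp_add[symmetric] algebra_simps)
  also have "\<dots> = (\<integral>\<^sup>+x. ennreal (exp (l * N x)) \<partial>gauss_PiM I) * ennreal (exp (- (l * mean)))"
    by (rule nn_integral_multc) measurable
  also have "\<dots> \<le> (\<integral>\<^sup>+x. ennreal (exp (l * N x)) \<partial>gauss_PiM I) * (\<integral>\<^sup>+x. ennreal (exp (- (l * N x))) \<partial>gauss_PiM I)"
    using J by (intro mult_left_mono) auto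
  also have "\<dots> \<le> ennreal (exp (l\<^sup>2))" by (rule nn_integral_exp_mult[OF assms])
  finally show ?thesis .
qed

text \<open>The integrand vanishes unless \<open>N - mean > \<theta> mean\<close>, where \<open>N \<le> (1 + 1 / \<theta>) (N - mean)\<close>; the
  exponential Markov inequality is then applied with parameter \<open>1 + \<theta> mean / 4\<close>.\<close>

lemma nn_integral_excess:
  assumes N0: "\<And>x. 0 \<le> N x" and "0 < a" "0 < \<theta>" and K: "a * (1 + \<theta>)\<^sup>2 \<le> K"
  shows "(\<integral>\<^sup>+x. ennreal (a * (N x)\<^sup>2 - K * mean\<^sup>2) \<partial>gauss_PiM I)
    \<le> ennreal (2 * a * (1 + 1 / \<theta>)\<^sup>2 * exp 2 * exp (- \<theta>\<^sup>2 * mean\<^sup>2 / 8))"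
proof -
  define C where "C = 2 * a * (1 + 1 / \<theta>)\<^sup>2"
  define T where "T = \<theta> * mean"
  \<comment> \<open>In the parameter \<open>1 + l\<close> the summand 1 pays for
    \<open>z\<^sup>2 \<le> 2 * exp z\<close>. With \<open>l = T / 4\<close> the final exponent
    \<open>- (l * T) + (1 + l)\<^sup>2\<close> falls short of \<open>2 - T\<^sup>2 / 8\<close> by
    exactly the square of \<open>T / 4 - 1\<close>.\<close>
  define l where "l = T / 4"
  have C0: "0 \<le> C" using assms by (simp add: C_def)
  have m0: "0 \<le> mean" unfolding mean_def using N0 by (intro integral_nonneg_AE) auto
  then have T0: "0 \<le> T" using assms by (simp add: T_def)
  have pt: "a * (N x)\<^sup>2 - K * mean\<^sup>2 \<le> (C * exp (- (l * T))) * exp ((1 + l) * (N x - mean))" for x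
  proof (cases "N x - mean \<le> T")
    case True
    then have "N x \<le> (1 + \<theta>) * mean" by (simp add: T_def algebra_simps)
    then have "(N x)\<^sup>2 \<le> ((1 + \<theta>) * mean)\<^sup>2" using N0 by (intro power_mono) auto
    then have "a * (N x)\<^sup>2 \<le> (a * (1 + \<theta>)\<^sup>2) * mean\<^sup>2"
      using assms by (simp add: power_mult_distrib mult.assoc)
    also have "\<dots> \<le> K * mean\<^sup>2" using K by (intro mult_right_mono) auto
    finally have "a * (N x)\<^sup>2 - K * mean\<^sup>2 \<le> 0" by simp
    also have "0 \<le> (C * exp (- (l * T))) * exp ((1 + l) * (N x - mean))" using C0 by simp
    finally show ?thesis .
  next
    case False
    define z where "z = N x - mean"
    have z: "T < z" "0 < z" using False T0 by (auto simp: z_def)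
    have "mean \<le> z / \<theta>" using z assms by (simp add: T_def field_simps)
    then have "N x \<le> (1 + 1 / \<theta>) * z" using assms by (simp add: z_def field_simps)
    then have "(N x)\<^sup>2 \<le> ((1 + 1 / \<theta>) * z)\<^sup>2" using N0 by (intro power_mono) auto
    then have *: "a * (N x)\<^sup>2 \<le> a * (1 + 1 / \<theta>)\<^sup>2 * z\<^sup>2"
      using assms by (simp add: power_mult_distrib mult.assoc)
    have "1 + z + z\<^sup>2 / 2 \<le> exp z" using exp_lower_Taylor_quadratic[of z] z by simp
    then have "z\<^sup>2 \<le> 2 * exp z" using z by simp
    also have "exp z \<le> exp (z + l * (z - T))" using z T0 by (simp add: l_def)
    finally have "z\<^sup>2 \<le> 2 * exp (z + l * (z - T))" by simp
    then have "a * (1 + 1 / \<theta>)\<^sup>2 * z\<^sup>2 \<le> a * (1 + 1 / \<theta>)\<^sup>2 * (2 * exp (z + l * (z - T)))"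
      using assms by (intro mult_left_mono) auto
    also have "\<dots> = (C * exp (- (l * T))) * exp ((1 + l) * z)"
      by (simp add: C_def mult.assoc exp_add[symmetric] algebra_simps)
    finally have "a * (N x)\<^sup>2 \<le> (C * exp (- (l * T))) * exp ((1 + l) * z)" using * by simp
    moreover have "0 \<le> K * mean\<^sup>2"
      using order_trans[OF _ K, of 0] assms by simp
    ultimately show ?thesis by (simp add: z_def)
  qed
  have "(\<integral>\<^sup>+x. ennreal (a * (N x)\<^sup>2 - K * mean\<^sup>2) \<partial>gauss_PiM I)
    \<le> (\<integral>\<^sup>+x. ennreal (C * exp (- (l * T))) * ennreal (exp ((1 + l) * (N x - mean))) \<partial>gauss_PiM I)"
    using pt C0 by (intro nn_integral_mono) (simp add: ennreal_mult[symmetric] ennreal_leI)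
  also have "\<dots> = ennreal (C * exp (- (l * T))) * (\<integral>\<^sup>+x. ennreal (exp ((1 + l) * (N x - mean))) \<partial>gauss_PiM I)"
    by (rule nn_integral_cmult) measurable
  also have "\<dots> \<le> ennreal (C * exp (- (l * T))) * ennreal (exp ((1 + l)\<^sup>2))"
    using T0 by (intro mult_left_mono nn_integral_exp_centered) (auto simp: l_def)
  also have "\<dots> = ennreal (C * (exp (- (l * T)) * exp ((1 + l)\<^sup>2)))"
    using C0 by (simp add: ennreal_mult[symmetric] mult.assoc)
  also have "\<dots> \<le> ennreal (C * (exp 2 * exp (- T\<^sup>2 / 8)))"
  proof -
    have "exp (- (l * T)) * exp ((1 + l)\<^sup>2) \<le> exp 2 * exp (- T\<^sup>2 / 8)"
    proof -
      have "0 \<le> (T / 4 - 1)\<^sup>2" by simp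
      then have "- (l * T) + (1 + l)\<^sup>2 \<le> 2 + - T\<^sup>2 / 8"
        by (simp add: l_def power2_eq_square field_simps)
      then show ?thesis by (simp add: exp_add[symmetric])
    qed
    then show ?thesis using C0 by (intro ennreal_leI mult_left_mono) auto
  qed
  finally show ?thesis by (simp add: C_def T_def power_mult_distrib mult.assoc)
qed

end

section \<open>Absolute first moments of Gaussian coordinates\<close>

lemma integrable_abs_std_gauss: "integrable std_gauss (\<lambda>x. \<bar>x\<bar>)"
  and integral_abs_std_gauss: "(\<integral>x. \<bar>x\<bar> \<partial>std_gauss) = sqrt (2 / pi)"
proof -
  have "has_bochner_integral lborel (\<lambda>x. std_normal_density x * \<bar>x\<bar>) (sqrt (2 / pi))"
    using std_normal_moment_abs_odd[of 0] by simp
  then show "integrable std_gauss (\<lambda>x. \<bar>x\<bar>)" "(\<integral>x. \<bar>x\<bar> \<partial>std_gauss) = sqrt (2 / pi)"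
    by (auto simp: integrable_density integral_density has_bochner_integral_iff)
qed

lemma integrable_gauss_PiM_component:
  assumes "i \<in> I" and f: "integrable std_gauss f"
  shows "integrable (gauss_PiM I) (\<lambda>x. f (x i) :: real)"
    and "(\<integral>x. f (x i) \<partial>gauss_PiM I) = (\<integral>x. f x \<partial>std_gauss)"
proof -
  have d: "distr (gauss_PiM I) std_gauss (\<lambda>x. x i) = std_gauss"
    using assms prob_space_std_gauss by (intro distr_PiM_component) auto
  have m: "(\<lambda>x. x i) \<in> measurable (gauss_PiM I) std_gauss" using assms by measurable
  have mf: "f \<in> borel_measurable std_gauss" using f by (rule borel_measurable_integrable)
  show "integrable (gauss_PiM I) (\<lambda>x. f (x i))"
    using integrable_distr_eq[OF m, of f] mf f unfolding d by simp
  show "(\<integral>x. f (x i) \<partial>gauss_PiM I) = (\<integral>x. f x \<partial>std_gauss)"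
    using integral_distr[OF m mf] unfolding d by simp
qed

section \<open>Frobenius inner product and orthonormal columns\<close>

definition hs_inner :: "real mat \<Rightarrow> real mat \<Rightarrow> real" where
  "hs_inner M N = (\<Sum>i<dim_row M. \<Sum>j<dim_col M. M $$ (i, j) * N $$ (i, j))"

lemma mult_mat_entry:
  assumes "M \<in> carrier_mat m k" "N \<in> carrier_mat k n" "i < m" "j < n"
  shows "(M * N) $$ (i, j) = (\<Sum>l<k. M $$ (i, l) * N $$ (l, j))"
  using assms by (auto simp: scalar_prod_def atLeast0LessThan intro!: sum.cong)

lemma hs_norm_nonneg [simp]: "0 \<le> hs_norm M"
  by (simp add: hs_norm_def sum_nonneg)

lemma hs_norm_square: "(hs_norm M)\<^sup>2 = hs_inner M M"
  by (simp add: hs_norm_def hs_inner_def sum_nonneg power2_eq_square)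

lemma hs_inner_self_nonneg [simp]: "0 \<le> hs_inner M M"
  by (simp add: hs_norm_square[symmetric])

lemma hs_inner_commute:
  "M \<in> carrier_mat m n \<Longrightarrow> N \<in> carrier_mat m n \<Longrightarrow> hs_inner M N = hs_inner N M"
  by (simp add: hs_inner_def mult.commute)

lemma hs_inner_add:
  assumes "A \<in> carrier_mat m n" "B \<in> carrier_mat m n" "C \<in> carrier_mat m n"
  shows "hs_inner (A + B) C = hs_inner A C + hs_inner B C"
    and "hs_inner C (A + B) = hs_inner C A + hs_inner C B"
  using assms by (simp_all add: hs_inner_def sum.distrib distrib_left distrib_right)

lemma hs_inner_diff:
  assumes "A \<in> carrier_mat m n" "B \<in> carrier_mat m n" "C \<in> carrier_mat m n"
  shows "hs_inner (A - B) C = hs_inner A C - hs_inner B C"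
    and "hs_inner C (A - B) = hs_inner C A - hs_inner C B"
  using assms by (simp_all add: hs_inner_def sum_subtractf left_diff_distrib right_diff_distrib)

lemma hs_inner_smult:
  assumes "A \<in> carrier_mat m n" "C \<in> carrier_mat m n"
  shows "hs_inner (k \<cdot>\<^sub>m A) C = k * hs_inner A C"
    and "hs_inner C (k \<cdot>\<^sub>m A) = k * hs_inner C A"
  using assms by (simp_all add: hs_inner_def sum_distrib_left mult_ac)

lemma hs_inner_mult_left:
  assumes "A \<in> carrier_mat m k" "B \<in> carrier_mat k n" "C \<in> carrier_mat m n"
  shows "hs_inner (A * B) C = hs_inner B (transpose_mat A * C)"
proof -
  have "hs_inner (A * B) C = (\<Sum>i<m. \<Sum>j<n. \<Sum>l<k. A $$ (i, l) * B $$ (l, j) * C $$ (i, j))"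
    using assms by (simp add: hs_inner_def mult_mat_entry[OF assms(1,2)] sum_distrib_right del: index_mult_mat(1))
  also have "\<dots> = (\<Sum>i<m. \<Sum>l<k. \<Sum>j<n. A $$ (i, l) * B $$ (l, j) * C $$ (i, j))"
    by (intro sum.cong refl sum.swap)
  also have "\<dots> = (\<Sum>l<k. \<Sum>i<m. \<Sum>j<n. A $$ (i, l) * B $$ (l, j) * C $$ (i, j))"
    by (rule sum.swap)
  also have "\<dots> = (\<Sum>l<k. \<Sum>j<n. \<Sum>i<m. A $$ (i, l) * B $$ (l, j) * C $$ (i, j))"
    by (intro sum.cong refl sum.swap)
  also have "\<dots> = hs_inner B (transpose_mat A * C)"
    using assms by (auto simp: hs_inner_def mult_mat_entry[of "transpose_mat A" k m C n] sum_distrib_left mult_ac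
        simp del: index_mult_mat intro!: sum.cong)
  finally show ?thesis .
qed

lemma hs_inner_transpose:
  assumes "A \<in> carrier_mat m n" "B \<in> carrier_mat m n"
  shows "hs_inner (transpose_mat A) (transpose_mat B) = hs_inner A B"
  using assms by (auto simp: hs_inner_def intro: sum.swap)

lemma hs_inner_mult_right:
  assumes "B \<in> carrier_mat m k" "A \<in> carrier_mat k n" "C \<in> carrier_mat m n"
  shows "hs_inner (B * A) C = hs_inner B (C * transpose_mat A)"
proof -
  have "hs_inner (B * A) C = hs_inner (transpose_mat A * transpose_mat B) (transpose_mat C)"
    using assms hs_inner_transpose[of "B * A" m n C] transpose_mult[OF assms(1,2)] by simp
  also have "\<dots> = hs_inner (transpose_mat B) (A * transpose_mat C)"
    using assms by (subst hs_inner_mult_left[of _ n k _ m]) auto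
  also have "A * transpose_mat C = transpose_mat (C * transpose_mat A)"
    using assms by (subst transpose_mult[of _ m n _ k]) auto
  also have "hs_inner (transpose_mat B) (transpose_mat (C * transpose_mat A)) = hs_inner B (C * transpose_mat A)"
    using assms by (intro hs_inner_transpose[of _ m k]) auto
  finally show ?thesis .
qed

lemma hs_inner_le:
  assumes "A \<in> carrier_mat m n" "B \<in> carrier_mat m n"
  shows "hs_inner A B \<le> hs_norm A * hs_norm B"
proof -
  have *: "hs_inner M N = (\<Sum>p\<in>{..<m} \<times> {..<n}. M $$ p * N $$ p)" if "M \<in> carrier_mat m n" for M N
    using that by (simp add: hs_inner_def sum.cartesian_product)
  have "(hs_inner A B)\<^sup>2 \<le> hs_inner A A * hs_inner B B"
    using Cauchy_Schwarz_ineq_sum[of "\<lambda>p. A $$ p" "\<lambda>p. B $$ p" "{..<m} \<times> {..<n}"]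
    using assms by (simp add: * power2_eq_square)
  then have "(hs_inner A B)\<^sup>2 \<le> (hs_norm A * hs_norm B)\<^sup>2"
    by (simp add: hs_norm_square power_mult_distrib)
  then show ?thesis by (rule power2_le_imp_le) simp
qed

lemma hs_norm_triangle:
  assumes "A \<in> carrier_mat m n" "B \<in> carrier_mat m n"
  shows "hs_norm (A + B) \<le> hs_norm A + hs_norm B"
proof (rule power2_le_imp_le)
  have "(hs_norm (A + B))\<^sup>2 = hs_inner A A + 2 * hs_inner A B + hs_inner B B"
    using assms by (simp add: hs_norm_square hs_inner_add[of _ m n] hs_inner_commute[of B m n A])
  also have "\<dots> \<le> hs_inner A A + 2 * (hs_norm A * hs_norm B) + hs_inner B B"
    using hs_inner_le[OF assms] by simp
  also have "\<dots> = (hs_norm A + hs_norm B)\<^sup>2"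
    by (simp add: power2_sum hs_norm_square)
  finally show "(hs_norm (A + B))\<^sup>2 \<le> (hs_norm A + hs_norm B)\<^sup>2" .
qed simp

lemma hs_norm_uminus_diff:
  assumes "A \<in> carrier_mat m n" "B \<in> carrier_mat m n"
  shows "hs_norm (A - B) = hs_norm (B - A)"
  using assms by (auto simp: hs_norm_def power2_commute intro!: arg_cong[of _ _ sqrt] sum.cong)

section \<open>Orthonormal columns and orthogonal projections\<close>

definition orthonormal_cols :: "real mat \<Rightarrow> bool" where
  "orthonormal_cols Q \<longleftrightarrow> transpose_mat Q * Q = 1\<^sub>m (dim_col Q)"

text \<open>\<open>R\<close> projects the rows of \<open>N\<close> orthogonally onto the column
  space of \<open>Q\<close>. By Pythagoras the difference of the two squared norms is the squared
  norm of \<open>N - R\<close>.\<close>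

lemma hs_norm_mult_orthonormal_le:
  assumes "N \<in> carrier_mat m n" "Q \<in> carrier_mat n k" "orthonormal_cols Q"
  shows "hs_norm (N * Q) \<le> hs_norm N"
proof (rule power2_le_imp_le)
  define R where "R = N * Q * transpose_mat Q"
  have R: "R \<in> carrier_mat m n" using assms by (simp add: R_def)
  have NQ: "N * Q \<in> carrier_mat m k" using assms by simp
  have "hs_inner R R = hs_inner (N * Q) (R * transpose_mat (transpose_mat Q))"
    unfolding R_def using assms by (intro hs_inner_mult_right) auto
  also have "R * transpose_mat (transpose_mat Q) = N * Q * (transpose_mat Q * Q)"
    unfolding R_def transpose_transpose using assms NQ by (intro assoc_mult_mat[of "N * Q" m k _ n Q k]) auto
  also have "\<dots> = N * Q" using assms NQ by (simp add: orthonormal_cols_def)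
  finally have RR: "hs_inner R R = hs_inner (N * Q) (N * Q)" .
  have "hs_inner R N = hs_inner (N * Q) (N * transpose_mat (transpose_mat Q))"
    unfolding R_def using assms by (intro hs_inner_mult_right) auto
  then have RN: "hs_inner R N = hs_inner (N * Q) (N * Q)" by simp
  have "0 \<le> hs_inner (N - R) (N - R)" by simp
  also have "\<dots> = hs_inner N N - 2 * hs_inner R N + hs_inner R R"
    using hs_inner_diff(1)[OF assms(1) R minus_carrier_mat[OF R, of N]] hs_inner_diff(2)[OF assms(1) R assms(1)]
      hs_inner_diff(2)[OF assms(1) R R] hs_inner_commute[OF assms(1) R] by simp
  finally show "(hs_norm (N * Q))\<^sup>2 \<le> (hs_norm N)\<^sup>2"
    unfolding hs_norm_square RR RN by simp
qed simp

text \<open>The orthogonality predicate \<open>corthogonal\<close> is phrased for complex inner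
  products; over the reals the conjugation disappears.\<close>

lemma conjugate_real_vec [simp]: "conjugate (v :: real Matrix.vec) = v"
  by (intro eq_vecI) auto

lemma scalar_prod_self_pos:
  fixes v :: "real Matrix.vec"
  assumes "v \<in> carrier_vec n" "v \<noteq> 0\<^sub>v n"
  shows "0 < scalar_prod v v"
  using conjugate_square_greater_0_vec[OF assms(1)] assms(2) by simp

definition normalize_cols :: "nat \<Rightarrow> real Matrix.vec list \<Rightarrow> real mat" where
  "normalize_cols n us = mat_of_cols n (map (\<lambda>u. (1 / sqrt (scalar_prod u u)) \<cdot>\<^sub>v u) us)"

lemma normalize_cols_carrier [simp]: "normalize_cols n us \<in> carrier_mat n (length us)"
  using mat_of_cols_carrier(1)[of n "map _ us"] by (simp add: normalize_cols_def)

text \<open>If \<open>D\<close> is the diagonal matrix of the lengths and \<open>U\<close> has the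
  columns \<open>us\<close>, then \<open>U = Q * D\<close>. So the projection
  \<open>Q * Q\<^sup>T\<close> fixes \<open>U\<close>, since \<open>Q\<^sup>T * Q\<close> cancels in
  the middle.\<close>

lemma normalize_cols:
  assumes us: "set us \<subseteq> carrier_vec n" and orth: "corthogonal us"
  shows "orthonormal_cols (normalize_cols n us)"
    and "normalize_cols n us * (transpose_mat (normalize_cols n us) * mat_of_cols n us) = mat_of_cols n us"
proof -
  define Q where "Q = normalize_cols n us"
  define l where "l = length us"
  have Q: "Q \<in> carrier_mat n l" by (simp add: Q_def l_def)
  have ui: "us ! i \<in> carrier_vec n" if "i < l" for i using us that by (auto simp: l_def)
  have pos: "0 < scalar_prod (us ! i) (us ! i)" if "i < l" for i
  proof -
    have "scalar_prod (us ! i) (us ! i) \<noteq> 0" using corthogonalD[OF orth, of i i] that by (simp add: l_def)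
    then have "us ! i \<noteq> 0\<^sub>v n" using ui[OF that] by auto
    then show ?thesis using ui[OF that] by (intro scalar_prod_self_pos)
  qed
  have colQ: "col Q i = (1 / sqrt (scalar_prod (us ! i) (us ! i))) \<cdot>\<^sub>v (us ! i)" if "i < l" for i
    unfolding Q_def normalize_cols_def using that ui[OF that] by (subst col_mat_of_cols) (auto simp: l_def)
  have "scalar_prod (col Q i) (col Q j) = (if i = j then 1 else 0)" if "i < l" "j < l" for i j
  proof (cases "i = j")
    case True
    have "sqrt (scalar_prod (us ! i) (us ! i)) * sqrt (scalar_prod (us ! i) (us ! i)) = scalar_prod (us ! i) (us ! i)"
      using pos[OF that(1)] by (metis less_imp_le real_sqrt_mult_self abs_of_pos)
    then show ?thesis using True ui[OF that(1)] pos[OF that(1)]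
      by (simp add: colQ[OF that(1)] colQ[OF that(2)])
  next
    case False
    then have "scalar_prod (us ! i) (us ! j) = 0" using corthogonalD[OF orth, of i j] that by (simp add: l_def)
    then show ?thesis using False ui[OF that(1)] ui[OF that(2)] that by (simp add: colQ)
  qed
  then have Q1: "transpose_mat Q * Q = 1\<^sub>m l"
    using Q by (intro eq_matI) auto
  then show o: "orthonormal_cols (normalize_cols n us)"
    using Q by (simp add: Q_def orthonormal_cols_def)
  define D where "D = Matrix.mat l l (\<lambda>(i, j). if i = j then sqrt (scalar_prod (us ! i) (us ! i)) else 0)"
  have D: "D \<in> carrier_mat l l" by (simp add: D_def)
  have "mat_of_cols n us = Q * D"
  proof (rule eq_matI)
    fix i j assume ij: "i < dim_row (Q * D)" "j < dim_col (Q * D)"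
    then have ij': "i < n" "j < l" using Q D by auto
    have "(Q * D) $$ (i, j) = (\<Sum>k<l. Q $$ (i, k) * D $$ (k, j))"
      by (rule mult_mat_entry[OF Q D ij'])
    also have "\<dots> = (\<Sum>k<l. if k = j then Q $$ (i, j) * sqrt (scalar_prod (us ! j) (us ! j)) else 0)"
      using ij' by (intro sum.cong) (auto simp: D_def)
    also have "\<dots> = Q $$ (i, j) * sqrt (scalar_prod (us ! j) (us ! j))" using ij' by simp
    also have "Q $$ (i, j) = vec_index (col Q j) i" using ij' Q by simp
    also have "\<dots> * sqrt (scalar_prod (us ! j) (us ! j)) = vec_index (us ! j) i"
      unfolding colQ[OF ij'(2)] using pos[OF ij'(2)] ui[OF ij'(2)] ij' by simp
    finally show "mat_of_cols n us $$ (i, j) = (Q * D) $$ (i, j)"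
      using ij' by (simp add: mat_of_cols_index l_def)
  qed (use Q D in \<open>auto simp: l_def\<close>)
  moreover have "Q * (transpose_mat Q * (Q * D)) = Q * ((transpose_mat Q * Q) * D)"
    using Q D by (simp add: assoc_mult_mat[of _ l n _ l _ l])
  ultimately show "normalize_cols n us * (transpose_mat (normalize_cols n us) * mat_of_cols n us) = mat_of_cols n us"
    unfolding Q_def[symmetric] Q1 using D by simp
qed

lemma projection_span:
  fixes us :: "real Matrix.vec list"
  assumes us: "set us \<subseteq> carrier_vec n" and orth: "corthogonal us" and "distinct us"
    and v: "v \<in> module.span class_ring (module_vec TYPE(real) n) (set us)"
  defines "Q \<equiv> normalize_cols n us"
  shows "Q *\<^sub>v (transpose_mat Q *\<^sub>v v) = v"
proof -
  interpret vec_space "TYPE(real)" n .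
  define U where "U = mat_of_cols n us"
  have U: "U \<in> carrier_mat n (length us)" by (simp add: U_def)
  have Q: "Q \<in> carrier_mat n (length us)" by (simp add: Q_def)
  have cU: "cols U = us" unfolding U_def using us by simp
  obtain a where a: "v = lincomb a (set us)"
    using v finite_span[OF _ us] by auto
  then have "v = U *\<^sub>v (Matrix.vec (length us) (\<lambda>i. a (col U i)))"
    using mat_mult_eq_lincomb[OF U, of a] \<open>distinct us\<close> by (simp add: cU)
  then obtain w where w: "w \<in> carrier_vec (length us)" "v = U *\<^sub>v w"
    using vec_carrier by blast
  have "Q *\<^sub>v (transpose_mat Q *\<^sub>v v) = (Q * (transpose_mat Q * U)) *\<^sub>v w"
    using Q U w by (simp add: assoc_mult_mat_vec[of _ n "length us" _ "length us"] assoc_mult_mat_vec[of _ "length us" n _ "length us"])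
  also have "\<dots> = v" using normalize_cols(2)[OF us orth] w by (simp add: Q_def U_def)
  finally show ?thesis .
qed

text \<open>A maximal independent set of columns has as many elements as the rank and, by
  maximality, spans all columns; Gram-Schmidt and normalization make it the columns of
  \<open>Q\<close>. The last property says that \<open>Q * Q\<^sup>T\<close> fixes the column space.
  It serves to reduce the noise to \<open>q\<close> rows and to factor a matrix through a space
  whose dimension is its rank.\<close>

lemma orthonormal_basis_of_column_space:
  fixes M :: "real mat"
  assumes M: "M \<in> carrier_mat m p"
  obtains Q where "Q \<in> carrier_mat m (mat_rank M)" "orthonormal_cols Q" "Q * (transpose_mat Q * M) = M"
proof -
  interpret vec_space "TYPE(real)" m .
  interpret cof_vec_space m "TYPE(real)" .
  have C: "set (cols M) \<subseteq> carrier_vec m" using cols_dim[of M] M by auto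
  have "lin_indpt {}" by (rule finite_lin_indpt2) auto
  then obtain S where S: "finite S" "maximal S (\<lambda>T. T \<subseteq> set (cols M) \<and> lin_indpt T)"
    using maximal_exists_superset[of "set (cols M)" "\<lambda>T. T \<subseteq> set (cols M) \<and> lin_indpt T" "{}"] by auto
  have Ssub: "S \<subseteq> set (cols M)" "lin_indpt S" using S(2) by (auto simp: maximal_def)
  have SC: "S \<subseteq> carrier_vec m" using Ssub C by auto
  have rk: "mat_rank M = card S"
    unfolding mat_rank_def using rank_card_indpt[OF M S(2)] M by simp
  have span: "c \<in> span S" if c: "c \<in> set (cols M)" for c
  proof (rule ccontr)
    assume n: "c \<notin> span S"
    have cS: "c \<notin> S" using n SC span_mem by auto
    have "lin_indpt (S \<union> {c})"
      using lin_dep_iff_in_span[OF SC Ssub(2) _ cS] n c C by auto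
    then have "S \<union> {c} = S" using S(2) Ssub c unfolding maximal_def by blast
    then show False using cS by auto
  qed
  obtain ss where ss: "set ss = S" "distinct ss" using S(1) finite_distinct_list by blast
  define us where "us = gram_schmidt m ss"
  have gs: "span (set ss) = span (set us)" "corthogonal us" "set us \<subseteq> carrier_vec m" "length us = length ss" "distinct us"
    using gram_schmidt_result[OF _ ss(2) _ us_def] SC Ssub ss by auto
  define Q where "Q = normalize_cols m us"
  have len: "length us = mat_rank M" using gs(4) ss rk distinct_card by metis
  have Q: "Q \<in> carrier_mat m (mat_rank M)" using normalize_cols_carrier[of m us] len by (simp add: Q_def)
  moreover have "orthonormal_cols Q" unfolding Q_def by (rule normalize_cols(1)[OF gs(3,2)])
  moreover have "Q * (transpose_mat Q * M) = M"
  proof (rule mat_col_eqI)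
    fix j assume j: "j < dim_col M"
    have "col M j \<in> set (cols M)" using j by (metis cols_length cols_nth nth_mem)
    then have "Q *\<^sub>v (transpose_mat Q *\<^sub>v col M j) = col M j"
      unfolding Q_def using span[of "col M j"] gs(1) ss by (intro projection_span[OF gs(3,2,5)]) auto
    moreover have "col (Q * (transpose_mat Q * M)) j = Q *\<^sub>v col (transpose_mat Q * M) j"
      using Q M j by (intro col_mult2[of _ m "mat_rank M" _ p]) auto
    moreover have "col (transpose_mat Q * M) j = transpose_mat Q *\<^sub>v col M j"
      using Q M j by (intro col_mult2[of _ "mat_rank M" m _ p]) auto
    ultimately show "col (Q * (transpose_mat Q * M)) j = col M j" by (simp only:)
  qed (use Q M in auto)
  ultimately show thesis by (rule that)
qed

section \<open>Diagonalization of symmetric matrices\<close>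

text \<open>The characteristic polynomial has a complex root \<open>c\<close>. For its eigenvector
  the quadratic form \<open>h\<close> equals \<open>c\<close> times a positive number, and the
  symmetry of \<open>S\<close> makes \<open>h\<close> equal to its conjugate, so \<open>c\<close> is
  real.\<close>

lemma symmetric_real_eigenvalue:
  fixes S :: "real mat"
  assumes S: "S \<in> carrier_mat n n" and sym: "transpose_mat S = S" and n: "0 < n"
  shows "\<exists>e. eigenvalue S e"
proof -
  define T where "T = map_mat complex_of_real S"
  have T: "T \<in> carrier_mat n n" using S by (simp add: T_def)
  have "degree (char_poly T) = n" using degree_monic_char_poly[OF T] by simp
  then have "\<not> constant (poly (char_poly T))" using n by (simp add: constant_degree)
  then obtain c where "poly (char_poly T) c = 0" using fundamental_theorem_of_algebra by blast
  then have "eigenvalue T c" using eigenvalue_root_char_poly[OF T] by simp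
  then obtain v where v: "v \<in> carrier_vec n" "v \<noteq> 0\<^sub>v n" "T *\<^sub>v v = c \<cdot>\<^sub>v v"
    using T by (auto simp: eigenvalue_def eigenvector_def)
  define x where "x = vec_index v"
  have ev: "(\<Sum>j<n. complex_of_real (S $$ (i, j)) * x j) = c * x i" if i: "i < n" for i
  proof -
    have "vec_index (T *\<^sub>v v) i = c * x i" using v i by (simp add: x_def)
    moreover have "vec_index (T *\<^sub>v v) i = (\<Sum>j<n. complex_of_real (S $$ (i, j)) * x j)"
    proof -
      have "vec_index (T *\<^sub>v v) i = (\<Sum>j<n. T $$ (i, j) * x j)"
        using v(1) i T by (simp add: x_def scalar_prod_def atLeast0LessThan)
      then show ?thesis using i S by (simp add: T_def)
    qed
    ultimately show ?thesis by simp
  qed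
  have symS: "S $$ (i, j) = S $$ (j, i)" if "i < n" "j < n" for i j
    using arg_cong[OF sym, of "\<lambda>M. M $$ (i, j)"] that S by simp
  define h where "h = (\<Sum>i<n. \<Sum>j<n. cnj (x i) * (complex_of_real (S $$ (i, j)) * x j))"
  have h1: "h = c * complex_of_real (\<Sum>i<n. (cmod (x i))\<^sup>2)"
  proof -
    have "h = (\<Sum>i<n. cnj (x i) * (c * x i))"
      unfolding h_def by (simp add: ev sum_distrib_left[symmetric])
    also have "\<dots> = (\<Sum>i<n. c * complex_of_real ((cmod (x i))\<^sup>2))"
      by (intro sum.cong refl) (simp add: complex_norm_square mult_ac del: of_real_power)
    finally show ?thesis by (simp add: sum_distrib_left)
  qed
  have "cnj h = (\<Sum>i<n. \<Sum>j<n. x i * (complex_of_real (S $$ (i, j)) * cnj (x j)))"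
    by (simp add: h_def)
  also have "\<dots> = (\<Sum>j<n. \<Sum>i<n. x i * (complex_of_real (S $$ (i, j)) * cnj (x j)))" by (rule sum.swap)
  also have "\<dots> = h" unfolding h_def by (intro sum.cong refl) (auto simp: symS)
  finally have "cnj h = h" .
  moreover obtain i where "i < n" "x i \<noteq> 0"
    using v(1,2) by (metis x_def carrier_vecD eq_vecI index_zero_vec)
  then have pos: "0 < (\<Sum>i<n. (cmod (x i))\<^sup>2)"
    by (intro sum_pos2[of _ i]) auto
  ultimately have "cnj c = c" unfolding h1 by (simp add: of_real_eq_0_iff del: of_real_sum)
  then have "c \<in> \<real>" by (simp add: Reals_cnj_iff)
  then obtain e where e: "c = complex_of_real e" by (auto elim: Reals_cases)
  have "complex_of_real (poly (char_poly S) e) = poly (char_poly T) c"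
    unfolding T_def e of_real_hom.char_poly_hom[OF S] by simp
  then have "poly (char_poly S) e = 0" using \<open>poly (char_poly T) c = 0\<close> by simp
  then show ?thesis using eigenvalue_root_char_poly[OF S] by blast
qed

definition dmat :: "nat \<Rightarrow> (nat \<Rightarrow> real) \<Rightarrow> real mat" where
  "dmat n d = Matrix.mat n n (\<lambda>(i, j). if i = j then d i else 0)"

lemma dmat_carrier [simp]: "dmat n d \<in> carrier_mat n n"
  by (simp add: dmat_def)

lemma orthonormal_cols_square:
  assumes "P \<in> carrier_mat n n" "orthonormal_cols P"
  shows "P * transpose_mat P = 1\<^sub>m n"
  using assms mat_mult_left_right_inverse[of "transpose_mat P" n P] by (simp add: orthonormal_cols_def)

lemma orthonormal_cols_mult:
  assumes "P \<in> carrier_mat m k" "orthonormal_cols P" "Q \<in> carrier_mat k l" "orthonormal_cols Q"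
  shows "orthonormal_cols (P * Q)"
proof -
  have "transpose_mat P * (P * Q) = (transpose_mat P * P) * Q"
    using assms by (intro assoc_mult_mat[symmetric, of _ k m _ k _ l]) auto
  also have "\<dots> = Q" using assms by (simp add: orthonormal_cols_def)
  finally have PQ: "transpose_mat P * (P * Q) = Q" .
  have "transpose_mat (P * Q) * (P * Q) = transpose_mat Q * (transpose_mat P * (P * Q))"
    using assms by (simp add: transpose_mult[of P m k Q l] assoc_mult_mat[of _ l k _ m _ l])
  then show ?thesis using assms by (simp add: orthonormal_cols_def PQ)
qed

text \<open>The eigenvector is completed to a basis with itself in front. Gram-Schmidt leaves the
  head of the list unchanged, and normalization only rescales it.\<close>

lemma eigenvector_first_column:
  fixes S :: "real mat"
  assumes S: "S \<in> carrier_mat n n" and v: "v \<in> carrier_vec n" "v \<noteq> 0\<^sub>v n" "S *\<^sub>v v = e \<cdot>\<^sub>v v" and n: "0 < n"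
  obtains W where "W \<in> carrier_mat n n" "orthonormal_cols W" "S *\<^sub>v col W 0 = e \<cdot>\<^sub>v col W 0"
proof -
  interpret vec_space "TYPE(real)" n .
  interpret cof_vec_space n "TYPE(real)" .
  note b = basis_completion[OF v(1,2)]
  define us where "us = gram_schmidt n (basis_completion v)"
  note gs = gram_schmidt_result[OF b(2,4,5) us_def]
  obtain vs where vs: "basis_completion v = v # vs" by (simp add: basis_completion_def Let_def)
  have hd: "hd us = v" unfolding us_def vs using v(1) by simp
  have len: "length us = n" using gs(4) b(6) by simp
  have us0: "us ! 0 = v" using hd len n by (metis hd_conv_nth length_0_conv less_irrefl)
  define W where "W = normalize_cols n us"
  have "W \<in> carrier_mat n n" unfolding W_def using normalize_cols_carrier[of n us] len by simp
  moreover have "orthonormal_cols W" unfolding W_def by (rule normalize_cols(1)[OF gs(3,2)])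
  moreover have "col W 0 = (1 / sqrt (scalar_prod v v)) \<cdot>\<^sub>v v"
    unfolding W_def normalize_cols_def using n len us0 v by (subst col_mat_of_cols) auto
  then have "S *\<^sub>v col W 0 = e \<cdot>\<^sub>v col W 0"
    using v S by (simp add: mult_mat_vec[OF S v(1)] smult_smult_assoc mult.commute)
  ultimately show thesis by (rule that)
qed

text \<open>Deflation: conjugating by a matrix \<open>W\<close> whose first column is a unit
  eigenvector clears the rest of the first column, symmetry then clears the first row, and the
  induction hypothesis diagonalizes the remaining block.\<close>

theorem symmetric_real_diagonalization:
  fixes S :: "real mat"
  assumes "S \<in> carrier_mat n n" "transpose_mat S = S"
  shows "\<exists>P d. P \<in> carrier_mat n n \<and> orthonormal_cols P \<and> transpose_mat P * (S * P) = dmat n d"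
  using assms
proof (induction n arbitrary: S)
  case 0
  then show ?case
    by (intro exI[of _ "1\<^sub>m 0"] exI[of _ "\<lambda>_. 0"]) (auto simp: orthonormal_cols_def dmat_def intro!: eq_matI)
next
  case (Suc n)
  note S = Suc.prems(1) and sym = Suc.prems(2)
  let ?n = "Suc n"
  obtain e v where v: "v \<in> carrier_vec ?n" "v \<noteq> 0\<^sub>v ?n" "S *\<^sub>v v = e \<cdot>\<^sub>v v"
    using symmetric_real_eigenvalue[OF S sym] S by (auto simp: eigenvalue_def eigenvector_def)
  obtain W where W: "W \<in> carrier_mat ?n ?n" "orthonormal_cols W" "S *\<^sub>v col W 0 = e \<cdot>\<^sub>v col W 0"
    using eigenvector_first_column[OF S v] by auto
  define A where "A = transpose_mat W * (S * W)"
  have A: "A \<in> carrier_mat ?n ?n" using S W by (simp add: A_def)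
  have symA: "transpose_mat A = A"
    using S W sym unfolding A_def
    by (simp add: transpose_mult[of _ ?n ?n _ ?n] assoc_mult_mat[of _ ?n ?n _ ?n _ ?n])
  have A0: "A $$ (i, 0) = (if i = 0 then e else 0)" if i: "i < ?n" for i
  proof -
    have "A $$ (i, 0) = scalar_prod (Matrix.row (transpose_mat W) i) (col (S * W) 0)"
      unfolding A_def using S W i by simp
    also have "col (S * W) 0 = e \<cdot>\<^sub>v col W 0" using S W by (subst col_mult2[of _ ?n ?n _ ?n]) auto
    also have "scalar_prod (Matrix.row (transpose_mat W) i) (e \<cdot>\<^sub>v col W 0) = e * (transpose_mat W * W) $$ (i, 0)"
      using W(1) i by simp
    also have "transpose_mat W * W = 1\<^sub>m ?n" using W(1,2) by (simp add: orthonormal_cols_def)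
    finally show ?thesis using i by simp
  qed
  have symA': "A $$ (i, j) = A $$ (j, i)" if "i < ?n" "j < ?n" for i j
    using arg_cong[OF symA, of "\<lambda>M. M $$ (i, j)"] that A by simp
  define B where "B = Matrix.mat n n (\<lambda>(i, j). A $$ (Suc i, Suc j))"
  have B: "B \<in> carrier_mat n n" "transpose_mat B = B"
    unfolding B_def by (auto intro!: eq_matI symA')
  obtain P' d' where P': "P' \<in> carrier_mat n n" "orthonormal_cols P'" "transpose_mat P' * (B * P') = dmat n d'"
    using Suc.IH[OF B] by auto
  define E where "E = Matrix.mat 1 1 (\<lambda>_. e)"
  have E: "E \<in> carrier_mat 1 1" by (simp add: E_def)
  have AB: "A = four_block_mat E (0\<^sub>m 1 n) (0\<^sub>m n 1) B"
  proof (rule eq_matI)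
    fix i j assume ij: "i < dim_row (four_block_mat E (0\<^sub>m 1 n) (0\<^sub>m n 1) B)" "j < dim_col (four_block_mat E (0\<^sub>m 1 n) (0\<^sub>m n 1) B)"
    then have ij': "i < ?n" "j < ?n" using B E by auto
    have "A $$ (0, j) = (if j = 0 then e else 0)" using symA'[of 0 j] A0[of j] ij' by simp
    then show "A $$ (i, j) = four_block_mat E (0\<^sub>m 1 n) (0\<^sub>m n 1) B $$ (i, j)"
      using ij' B E A0[of i] by (cases i; cases j) (auto simp: E_def B_def)
  qed (use A B E in auto)
  define R where "R = four_block_mat (1\<^sub>m 1) (0\<^sub>m 1 n) (0\<^sub>m n 1) P'"
  have R: "R \<in> carrier_mat ?n ?n" using P' unfolding R_def by auto
  have Rt: "transpose_mat R = four_block_mat (1\<^sub>m 1) (0\<^sub>m 1 n) (0\<^sub>m n 1) (transpose_mat P')"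
    unfolding R_def using P' by (subst transpose_four_block_mat[of _ 1 1 _ n _ n]) auto
  have "transpose_mat R * R = four_block_mat (1\<^sub>m 1) (0\<^sub>m 1 n) (0\<^sub>m n 1) (1\<^sub>m n)"
    unfolding Rt unfolding R_def using P'
    by (subst mult_four_block_mat[of _ 1 1 _ n _ n _ _ 1 _ n]) (auto simp: orthonormal_cols_def)
  then have oR: "orthonormal_cols R" using R by (simp add: orthonormal_cols_def)
  have "A * R = four_block_mat E (0\<^sub>m 1 n) (0\<^sub>m n 1) (B * P')"
    unfolding AB R_def using P' B E
    by (subst mult_four_block_mat[of _ 1 1 _ n _ n _ _ 1 _ n]) auto
  then have "transpose_mat R * (A * R) = four_block_mat E (0\<^sub>m 1 n) (0\<^sub>m n 1) (dmat n d')"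
    unfolding Rt using P' B E
    by (simp add: mult_four_block_mat[of _ 1 1 _ n _ n _ _ 1 _ n])
  also have "\<dots> = dmat ?n (\<lambda>i. if i = 0 then e else d' (i - 1))"
    by (rule eq_matI) (auto simp: dmat_def E_def)
  finally have diag: "transpose_mat R * (A * R) = dmat ?n (\<lambda>i. if i = 0 then e else d' (i - 1))" .
  have "transpose_mat (W * R) * (S * (W * R)) = transpose_mat R * (A * R)"
    unfolding A_def using S W(1) R
    by (simp add: transpose_mult[of _ ?n ?n _ ?n] assoc_mult_mat[of _ ?n ?n _ ?n _ ?n])
  then show ?case using W R oR orthonormal_cols_mult[OF W(1,2) R oR] diag
    by (intro exI[of _ "W * R"] exI) auto
qed

section \<open>Ky Fan norms\<close>

lemma gram_diag_entry:
  assumes "S \<in> carrier_mat n n" "P \<in> carrier_mat n n" "i < n" "j < n"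
  shows "(transpose_mat P * (S * P)) $$ (i, j) = scalar_prod (col P i) (S *\<^sub>v col P j)"
proof -
  have "(transpose_mat P * (S * P)) $$ (i, j) = scalar_prod (Matrix.row (transpose_mat P) i) (col (S * P) j)"
    using assms by simp
  also have "col (S * P) j = S *\<^sub>v col P j" using assms by (intro col_mult2[of _ n n _ n]) auto
  finally show ?thesis using assms by simp
qed

lemma permute_diagonalization:
  assumes S: "S \<in> carrier_mat n n" and P0: "P0 \<in> carrier_mat n n" "orthonormal_cols P0" "transpose_mat P0 * (S * P0) = dmat n d"
    and p: "p permutes {..<n}"
  obtains P where "P \<in> carrier_mat n n" "orthonormal_cols P" "transpose_mat P * (S * P) = dmat n (d \<circ> p)"
proof -
  define P where "P = Matrix.mat n n (\<lambda>(i, j). P0 $$ (i, p j))"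
  have P: "P \<in> carrier_mat n n" by (simp add: P_def)
  have pn: "p j < n" if "j < n" for j using permutes_in_image[OF p, of j] that by simp
  have inj: "p i = p j \<longleftrightarrow> i = j" for i j using permutes_inj[OF p] by (auto dest: injD)
  have colP: "col P j = col P0 (p j)" if "j < n" for j
    using that pn[OF that] P0(1) by (intro eq_vecI) (auto simp: P_def)
  \<comment> \<open>\<open>S\<close> and \<open>d\<close> are generalized because the claim is used
    twice: for the given matrix, and for the identity matrix, where it yields the orthonormality of
    \<open>P\<close>.\<close>
  have "transpose_mat P * (S * P) = dmat n (d \<circ> p)" if S: "S \<in> carrier_mat n n" and D: "transpose_mat P0 * (S * P0) = dmat n d" for S d
  proof (rule eq_matI)
    fix i j assume "i < dim_row (dmat n (d \<circ> p))" "j < dim_col (dmat n (d \<circ> p))"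
    then have ij: "i < n" "j < n" by (auto simp: dmat_def)
    have "(transpose_mat P * (S * P)) $$ (i, j) = (transpose_mat P0 * (S * P0)) $$ (p i, p j)"
      using gram_diag_entry[OF S P ij] gram_diag_entry[OF S P0(1) pn[OF ij(1)] pn[OF ij(2)]] colP ij by simp
    then show "(transpose_mat P * (S * P)) $$ (i, j) = dmat n (d \<circ> p) $$ (i, j)"
      unfolding D using ij pn by (simp add: dmat_def inj)
  qed (use S P in \<open>auto simp: dmat_def\<close>)
  note * = this
  have one: "dmat n (\<lambda>_. 1) = 1\<^sub>m n" by (auto simp: dmat_def intro!: eq_matI)
  have "transpose_mat P * (1\<^sub>m n * P) = dmat n ((\<lambda>_. 1) \<circ> p)"
    using P0 by (intro *) (auto simp: one orthonormal_cols_def)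
  then have "orthonormal_cols P" using P by (simp add: orthonormal_cols_def one comp_def)
  then show thesis using P *[OF S P0(3)] that by blast
qed

text \<open>This bridges the definition of singular values, through the multiset of roots of a
  characteristic polynomial, and an orthogonal eigenbasis of the Gram matrix ordered by decreasing
  eigenvalue. The bound \<open>min k n\<close> reflects that there are \<open>n\<close> listed
  singular values, with zeros beyond.\<close>

lemma singular_values_diagonalization:
  assumes M: "M \<in> carrier_mat m n"
  obtains P d where "P \<in> carrier_mat n n" "orthonormal_cols P"
    "transpose_mat (M * P) * (M * P) = dmat n d"
    "\<And>i. i < n \<Longrightarrow> 0 \<le> d i" "\<And>i j. i \<le> j \<Longrightarrow> j < n \<Longrightarrow> d j \<le> d i"
    "\<And>k. (ky_fan2 k M)\<^sup>2 = (\<Sum>i<min k n. d i)"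
proof -
  define S where "S = transpose_mat M * M"
  have S: "S \<in> carrier_mat n n" using M by (simp add: S_def)
  have sym: "transpose_mat S = S" using M by (simp add: S_def transpose_mult[of _ n m _ n])
  obtain P0 d0 where P0: "P0 \<in> carrier_mat n n" "orthonormal_cols P0" "transpose_mat P0 * (S * P0) = dmat n d0"
    using symmetric_real_diagonalization[OF S sym] by blast
  have gram: "transpose_mat (M * P) * (M * P) = transpose_mat P * (S * P)" if "P \<in> carrier_mat n n" for P
    using M that unfolding S_def
    by (simp add: transpose_mult[of _ m n _ n] assoc_mult_mat[of _ n n _ m _ n] assoc_mult_mat[of _ n m _ n _ n])
  have nonneg: "0 \<le> d i" if P: "P \<in> carrier_mat n n" "transpose_mat P * (S * P) = dmat n d" and i: "i < n" for P d i
  proof -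
    have MP: "M * P \<in> carrier_mat m n" using M P by simp
    have "d i = (transpose_mat (M * P) * (M * P)) $$ (i, i)" using gram[OF P(1)] P(2) i by (simp add: dmat_def)
    also have "\<dots> = (\<Sum>l<m. (M * P) $$ (l, i) * (M * P) $$ (l, i))"
      using mult_mat_entry[of "transpose_mat (M * P)" n m "M * P" n i i] MP M P i by (simp del: index_mult_mat(1))
    also have "\<dots> \<ge> 0" by (intro sum_nonneg) auto
    finally show ?thesis .
  qed
  have char: "char_poly S = (\<Prod>a\<leftarrow>map d0 [0..<n]. [:- a, 1:])"
  proof -
    have PP: "P0 * transpose_mat P0 = 1\<^sub>m n" by (rule orthonormal_cols_square[OF P0(1,2)])
    have "P0 * dmat n d0 * transpose_mat P0 = S"
    proof -
      have "P0 * dmat n d0 * transpose_mat P0 = (P0 * transpose_mat P0) * S * (P0 * transpose_mat P0)"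
        unfolding P0(3)[symmetric] using P0(1) S by (simp add: assoc_mult_mat[of _ n n _ n _ n])
      then show ?thesis using S by (simp add: PP)
    qed
    then have "similar_mat_wit S (dmat n d0) P0 (transpose_mat P0)"
      using P0(1,2) S PP by (intro similar_mat_witI[of _ _ n]) (auto simp: orthonormal_cols_def)
    then have "char_poly S = char_poly (dmat n d0)"
      by (intro char_poly_similar) (auto simp: similar_mat_def)
    also have "\<dots> = (\<Prod>a\<leftarrow>diag_mat (dmat n d0). [:- a, 1:])"
      by (rule char_poly_upper_triangular[OF dmat_carrier]) (auto simp: dmat_def)
    also have "diag_mat (dmat n d0) = map d0 [0..<n]"
      by (auto simp: diag_mat_def dmat_def)
    finally show ?thesis .
  qed
  have "proots (char_poly S) = mset (map d0 [0..<n])"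
  proof -
    have "proots (\<Prod>a\<leftarrow>xs. [:- a, 1:]) = mset xs" for xs :: "real list"
    proof (induction xs)
      case (Cons x xs)
      have "(\<Prod>a\<leftarrow>xs. [:- a, 1:]) \<noteq> 0" by (induction xs) (auto simp del: mult_pCons_left)
      then show ?case using Cons.IH
        by (subst list.map, subst prod_list.Cons, subst proots_mult) auto
    qed simp
    then show ?thesis unfolding char .
  qed
  define L where "L = singular_values M"
  have "mset L = mset (map (\<lambda>i. sqrt (d0 i)) [0..<n])"
    unfolding L_def singular_values_def S_def[symmetric] \<open>proots (char_poly S) = _\<close> by (simp add: image_mset.compositionality comp_def)
  \<comment> \<open>The sorted list rearranges the square roots of the eigenvalues
    \<open>d0\<close>; the same permutation is then applied to the eigenvectors.\<close>
  then obtain p where p: "p permutes {..<length (map (\<lambda>i. sqrt (d0 i)) [0..<n])}"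
    "permute_list p (map (\<lambda>i. sqrt (d0 i)) [0..<n]) = L"
    using mset_eq_permutation by metis
  have pp: "p permutes {..<n}" using p(1) by simp
  have len: "length L = n" using p(2) by (metis length_permute_list length_map length_upt minus_nat.diff_0)
  have pn: "p i < n" if "i < n" for i using permutes_in_image[OF pp, of i] that by simp
  have Li: "L ! i = sqrt (d0 (p i))" if "i < n" for i
    using permute_list_nth[OF p(1), of i] that pn[OF that] p(2) by simp
  obtain P where P: "P \<in> carrier_mat n n" "orthonormal_cols P" "transpose_mat P * (S * P) = dmat n (d0 \<circ> p)"
    using permute_diagonalization[OF S P0 pp] .
  have d0: "0 \<le> (d0 \<circ> p) i" if "i < n" for i using nonneg[OF P(1) P(3) that] .
  have L2: "(L ! i)\<^sup>2 = (d0 \<circ> p) i" if "i < n" for i using Li[OF that] d0[OF that] by simp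
  have L0: "0 \<le> L ! i" if "i < n" for i using Li[OF that] d0[OF that] by simp
  have "sorted (rev L)" by (simp add: L_def singular_values_def)
  then have "L ! j \<le> L ! i" if "i \<le> j" "j < n" for i j using sorted_rev_nth_mono that len by blast
  then have dec: "(d0 \<circ> p) j \<le> (d0 \<circ> p) i" if "i \<le> j" "j < n" for i j
    using L2[of i] L2[of j] L0[of j] that power_mono[of "L ! j" "L ! i" 2] by auto
  have kf: "(ky_fan2 k M)\<^sup>2 = (\<Sum>i<min k n. (d0 \<circ> p) i)" for k
  proof -
    have "(ky_fan2 k M)\<^sup>2 = (\<Sum>k = 1..k. (singular_value k M)\<^sup>2)"
      by (simp add: ky_fan2_def sum_nonneg)
    also have "\<dots> = (\<Sum>i<k. (singular_value (Suc i) M)\<^sup>2)"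
      by (rule sum.reindex_bij_witness[of _ Suc "\<lambda>i. i - 1"]) auto
    also have "\<dots> = (\<Sum>i<k. if i < n then (d0 \<circ> p) i else 0)"
      by (intro sum.cong refl) (use L2 in \<open>auto simp: singular_value_def L_def[symmetric] len\<close>)
    also have "\<dots> = (\<Sum>i\<in>{i\<in>{..<k}. i < n}. (d0 \<circ> p) i)" by (rule sum.inter_filter[symmetric]) simp
    also have "{i\<in>{..<k}. i < n} = {..<min k n}" by auto
    finally show ?thesis .
  qed
  have "transpose_mat (M * P) * (M * P) = dmat n (d0 \<circ> p)" using gram[OF P(1)] P(3) by simp
  from that[OF P(1,2) this d0 dec kf] show thesis .
qed

lemma hs_norm_square_cols:
  assumes "A \<in> carrier_mat m k"
  shows "(hs_norm A)\<^sup>2 = (\<Sum>j<k. (transpose_mat A * A) $$ (j, j))"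
proof -
  have "(hs_norm A)\<^sup>2 = (\<Sum>j<k. \<Sum>i<m. A $$ (i, j) * A $$ (i, j))"
    unfolding hs_norm_square hs_inner_def using assms by simp (rule sum.swap)
  also have "\<dots> = (\<Sum>j<k. (transpose_mat A * A) $$ (j, j))"
    using assms by (intro sum.cong refl) (simp add: mult_mat_entry[of _ k m _ k] del: index_mult_mat(1))
  finally show ?thesis .
qed

text \<open>The row sums of squares are the diagonal entries of the projection \<open>R * R\<^sup>T\<close>.\<close>

lemma orthonormal_cols_row_sums:
  assumes R: "R \<in> carrier_mat n k" and o: "orthonormal_cols R"
  shows "\<And>i. i < n \<Longrightarrow> (\<Sum>j<k. (R $$ (i, j))\<^sup>2) \<le> 1" "(\<Sum>i<n. \<Sum>j<k. (R $$ (i, j))\<^sup>2) = real k"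
proof -
  have "(\<Sum>i<n. \<Sum>j<k. (R $$ (i, j))\<^sup>2) = (hs_norm R)\<^sup>2"
    unfolding hs_norm_square hs_inner_def using R by (simp add: power2_eq_square)
  also have "\<dots> = (\<Sum>j<k. (transpose_mat R * R) $$ (j, j))" by (rule hs_norm_square_cols[OF R])
  also have "transpose_mat R * R = 1\<^sub>m k" using o R by (simp add: orthonormal_cols_def)
  finally show "(\<Sum>i<n. \<Sum>j<k. (R $$ (i, j))\<^sup>2) = real k" by simp
next
  fix i assume i: "i < n"
  define G where "G = R * transpose_mat R"
  have G: "G \<in> carrier_mat n n" using R by (simp add: G_def)
  have "G * G = R * (transpose_mat R * (R * transpose_mat R))"
    unfolding G_def using R by (intro assoc_mult_mat[of _ n k _ n _ n]) auto
  also have "transpose_mat R * (R * transpose_mat R) = (transpose_mat R * R) * transpose_mat R"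
    using R by (intro assoc_mult_mat[symmetric, of _ k n _ k _ n]) auto
  also have "\<dots> = transpose_mat R" using o R by (simp add: orthonormal_cols_def)
  finally have GG: "G * G = G" by (simp add: G_def)
  have Gij: "G $$ (a, b) = (\<Sum>j<k. R $$ (a, j) * R $$ (b, j))" if "a < n" "b < n" for a b
    unfolding G_def using mult_mat_entry[of R n k "transpose_mat R" n a b] R that by (simp del: index_mult_mat(1))
  have "G $$ (i, i) = (\<Sum>l<n. G $$ (i, l) * G $$ (l, i))"
    using mult_mat_entry[OF G G i i] by (simp only: GG)
  also have "\<dots> = (\<Sum>l<n. (G $$ (i, l))\<^sup>2)"
    using Gij i by (intro sum.cong refl) (simp add: power2_eq_square mult.commute)
  \<comment> \<open>The diagonal entry of a symmetric idempotent matrix is the sum of the squares of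
    its row, which include its own square; this forces it to be at most 1.\<close>
  finally have "(G $$ (i, i))\<^sup>2 \<le> G $$ (i, i)"
    using member_le_sum[of i "{..<n}" "\<lambda>l. (G $$ (i, l))\<^sup>2"] i by simp
  then have "G $$ (i, i) \<le> 1"
    using mult_strict_left_mono[of 1 "G $$ (i, i)" "G $$ (i, i)"] by (fastforce simp: power2_eq_square)
  then show "(\<Sum>j<k. (R $$ (i, j))\<^sup>2) \<le> 1" using Gij[OF i i] by (simp add: power2_eq_square)
qed

text \<open>The weights are compared with the indicator of \<open>i < k\<close>. The deviation is
  nonpositive where \<open>d i \<ge> d k\<close> and nonnegative where \<open>d i \<le> d k\<close>,
  so replacing \<open>d i\<close> by \<open>d k\<close> can only increase the sum, and the
  deviations add up to zero.\<close>

lemma weighted_sum_le_initial_sum: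
  fixes d w :: "nat \<Rightarrow> real"
  assumes d0: "\<And>i. i < n \<Longrightarrow> 0 \<le> d i" and dec: "\<And>i j. i \<le> j \<Longrightarrow> j < n \<Longrightarrow> d j \<le> d i"
    and w: "\<And>i. i < n \<Longrightarrow> 0 \<le> w i" "\<And>i. i < n \<Longrightarrow> w i \<le> 1" "(\<Sum>i<n. w i) = real k"
  shows "(\<Sum>i<n. d i * w i) \<le> (\<Sum>i<min k n. d i)"
proof (cases "k < n")
  case False
  then show ?thesis using d0 w by (auto intro!: sum_mono mult_left_le)
next
  case True
  have "(\<Sum>i<n. d i * w i) - (\<Sum>i<k. d i) = (\<Sum>i<n. d i * w i) - (\<Sum>i<n. d i * (if i < k then 1 else 0))"
  proof -
    have "(\<Sum>i<n. d i * (if i < k then 1 else 0)) = (\<Sum>i<n. if i < k then d i else 0)" by (intro sum.cong) auto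
    also have "\<dots> = (\<Sum>i\<in>{i\<in>{..<n}. i < k}. d i)" by (rule sum.inter_filter[symmetric]) simp
    also have "{i\<in>{..<n}. i < k} = {..<k}" using True by auto
    finally show ?thesis by simp
  qed
  also have "\<dots> = (\<Sum>i<n. d i * (w i - (if i < k then 1 else 0)))"
    by (simp add: sum_subtractf right_diff_distrib)
  also have "\<dots> \<le> (\<Sum>i<n. d k * (w i - (if i < k then 1 else 0)))"
  proof (rule sum_mono)
    fix i assume "i \<in> {..<n}"
    then show "d i * (w i - (if i < k then 1 else 0)) \<le> d k * (w i - (if i < k then 1 else 0))"
      using dec[of i k] dec[of k i] w(1)[of i] w(2)[of i] True
      by (cases "i < k") (auto intro: mult_right_mono mult_right_mono_neg)
  qed
  also have "\<dots> = d k * ((\<Sum>i<n. w i) - (\<Sum>i<n. if i < k then 1 else 0))"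
    by (simp add: sum_distrib_left[symmetric] sum_subtractf)
  also have "(\<Sum>i<n. if i < k then 1 else 0) = (\<Sum>i\<in>{i\<in>{..<n}. i < k}. (1::real))" by (rule sum.inter_filter[symmetric]) simp
  also have "{i\<in>{..<n}. i < k} = {..<k}" using True by auto
  finally show ?thesis using w(3) True by simp
qed

lemma hs_norm_square_diagonal_gram:
  assumes N: "N \<in> carrier_mat m n" "transpose_mat N * N = dmat n d" and R: "R \<in> carrier_mat n k"
  shows "(hs_norm (N * R))\<^sup>2 = (\<Sum>i<n. d i * (\<Sum>j<k. (R $$ (i, j))\<^sup>2))"
proof -
  have "(hs_norm (N * R))\<^sup>2 = hs_inner R (transpose_mat N * (N * R))"
    unfolding hs_norm_square using N(1) R by (intro hs_inner_mult_left) auto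
  also have "transpose_mat N * (N * R) = (transpose_mat N * N) * R"
    using N(1) R by (intro assoc_mult_mat[symmetric, of _ n m _ n _ k]) auto
  also have "\<dots> = dmat n d * R" by (simp only: N(2))
  finally have *: "(hs_norm (N * R))\<^sup>2 = hs_inner R (dmat n d * R)" .
  have "(dmat n d * R) $$ (i, j) = d i * R $$ (i, j)" if "i < n" "j < k" for i j
  proof -
    have "(dmat n d * R) $$ (i, j) = (\<Sum>l<n. dmat n d $$ (i, l) * R $$ (l, j))"
      by (rule mult_mat_entry[OF dmat_carrier R that])
    also have "\<dots> = (\<Sum>l<n. if l = i then d i * R $$ (i, j) else 0)"
      using that by (intro sum.cong) (auto simp: dmat_def)
    finally show ?thesis using that by simp
  qed
  then show ?thesis unfolding * hs_inner_def using R
    by (simp add: sum_distrib_left power2_eq_square mult_ac del: index_mult_mat(1))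
qed

lemma ky_fan2_nonneg [simp]: "0 \<le> ky_fan2 k M"
  by (simp add: ky_fan2_def sum_nonneg)

lemma ky_fan2_0 [simp]: "ky_fan2 0 M = 0"
  by (simp add: ky_fan2_def)

lemma ky_fan2_mono: "k \<le> l \<Longrightarrow> ky_fan2 k M \<le> ky_fan2 l M"
  unfolding ky_fan2_def by (intro real_sqrt_le_mono sum_mono2) auto

lemma ky_fan2_gram_cong:
  assumes "transpose_mat M * M = transpose_mat N * N"
  shows "ky_fan2 k M = ky_fan2 k N"
proof -
  have *: "singular_values M = singular_values N" unfolding singular_values_def assms ..
  show ?thesis unfolding ky_fan2_def singular_value_def * ..
qed

text \<open>This is one half of Ky Fan's maximum principle; \<open>ky_fan2_attained\<close> below is the other.\<close>

lemma hs_norm_mult_le_ky_fan2: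
  assumes M: "M \<in> carrier_mat m n" and Q: "Q \<in> carrier_mat n k" "orthonormal_cols Q"
  shows "hs_norm (M * Q) \<le> ky_fan2 k M"
proof (rule power2_le_imp_le)
  obtain P d where P: "P \<in> carrier_mat n n" "orthonormal_cols P"
    and gram: "transpose_mat (M * P) * (M * P) = dmat n d"
    and d: "\<And>i. i < n \<Longrightarrow> 0 \<le> d i" "\<And>i j. i \<le> j \<Longrightarrow> j < n \<Longrightarrow> d j \<le> d i"
    and kf: "\<And>k. (ky_fan2 k M)\<^sup>2 = (\<Sum>i<min k n. d i)"
    using singular_values_diagonalization[OF M] by metis
  define R where "R = transpose_mat P * Q"
  have PP: "P * transpose_mat P = 1\<^sub>m n" by (rule orthonormal_cols_square[OF P])
  have R: "R \<in> carrier_mat n k" using P Q by (simp add: R_def)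
  have "orthonormal_cols (transpose_mat P)" using PP P(1) by (simp add: orthonormal_cols_def)
  then have oR: "orthonormal_cols R" unfolding R_def using P Q by (intro orthonormal_cols_mult) auto
  have "M * P * R = M * (P * R)" using M P R by (intro assoc_mult_mat) auto
  also have "P * R = (P * transpose_mat P) * Q"
    unfolding R_def using P Q by (intro assoc_mult_mat[symmetric, of _ n n _ n _ k]) auto
  also have "\<dots> = Q" using Q by (simp add: PP)
  finally have MQ: "M * P * R = M * Q" .
  have "(hs_norm (M * Q))\<^sup>2 = (\<Sum>i<n. d i * (\<Sum>j<k. (R $$ (i, j))\<^sup>2))"
    unfolding MQ[symmetric] using M P by (intro hs_norm_square_diagonal_gram[OF _ gram R]) auto
  also have "\<dots> \<le> (\<Sum>i<min k n. d i)"
    using orthonormal_cols_row_sums[OF R oR] d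
    by (intro weighted_sum_le_initial_sum) (auto intro: sum_nonneg)
  finally show "(hs_norm (M * Q))\<^sup>2 \<le> (ky_fan2 k M)\<^sup>2" by (simp add: kf)
qed simp

lemma initial_columns:
  fixes n k :: nat
  assumes "k \<le> n"
  defines "J \<equiv> Matrix.mat n k (\<lambda>(i, j). if i = j then 1 else 0 :: real)"
  shows "J \<in> carrier_mat n k" "orthonormal_cols J"
proof -
  show J: "J \<in> carrier_mat n k" by (simp add: J_def)
  have "transpose_mat J * J = 1\<^sub>m k"
  proof (rule eq_matI)
    fix i j assume "i < dim_row (1\<^sub>m k :: real mat)" "j < dim_col (1\<^sub>m k :: real mat)"
    then have ij: "i < k" "j < k" by auto
    have "(transpose_mat J * J) $$ (i, j) = (\<Sum>l<n. transpose_mat J $$ (i, l) * J $$ (l, j))"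
      using J by (intro mult_mat_entry[OF _ _ ij]) auto
    also have "\<dots> = (\<Sum>l<n. if l = i then (if i = j then 1 else 0) else 0)"
      using ij assms(1) by (intro sum.cong) (auto simp: J_def)
    finally show "(transpose_mat J * J) $$ (i, j) = 1\<^sub>m k $$ (i, j)"
      using ij assms(1) by simp
  qed (use J in auto)
  then show "orthonormal_cols J" using J by (simp add: orthonormal_cols_def)
qed

text \<open>The leading eigenvectors, selected by multiplying \<open>P\<close> with
  \<open>J\<close>, are maximizers. There are only \<open>n\<close> of them, hence
  \<open>min k n\<close> columns.\<close>

lemma ky_fan2_attained:
  assumes M: "M \<in> carrier_mat m n"
  obtains Q where "Q \<in> carrier_mat n (min k n)" "orthonormal_cols Q" "hs_norm (M * Q) = ky_fan2 k M"
proof -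
  obtain P d where P: "P \<in> carrier_mat n n" "orthonormal_cols P"
    and gram: "transpose_mat (M * P) * (M * P) = dmat n d"
    and kf: "\<And>k. (ky_fan2 k M)\<^sup>2 = (\<Sum>i<min k n. d i)"
    using singular_values_diagonalization[OF M] by metis
  define J where "J = Matrix.mat n (min k n) (\<lambda>(i, j). if i = j then 1 else 0 :: real)"
  have J: "J \<in> carrier_mat n (min k n)" "orthonormal_cols J"
    unfolding J_def by (rule initial_columns, simp)+
  have "(hs_norm (M * P * J))\<^sup>2 = (\<Sum>i<n. d i * (\<Sum>j<min k n. (J $$ (i, j))\<^sup>2))"
    using M P by (intro hs_norm_square_diagonal_gram[OF _ gram J(1)]) auto
  also have "\<dots> = (\<Sum>i<n. if i < min k n then d i else 0)"
  proof (intro sum.cong refl)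
    fix i assume i: "i \<in> {..<n}"
    have "(\<Sum>j<min k n. (J $$ (i, j))\<^sup>2) = (\<Sum>j<min k n. if j = i then 1 else 0)"
      using i by (intro sum.cong) (auto simp: J_def)
    then show "d i * (\<Sum>j<min k n. (J $$ (i, j))\<^sup>2) = (if i < min k n then d i else 0)"
      by (simp del: min_less_iff_conj)
  qed
  also have "\<dots> = (\<Sum>i\<in>{i\<in>{..<n}. i < min k n}. d i)" by (rule sum.inter_filter[symmetric]) simp
  also have "{i\<in>{..<n}. i < min k n} = {..<min k n}" by auto
  also have "(\<Sum>i<min k n. d i) = (ky_fan2 k M)\<^sup>2" by (simp add: kf)
  finally have "hs_norm (M * P * J) = ky_fan2 k M" by (simp add: power2_eq_iff_nonneg)
  moreover have "M * P * J = M * (P * J)" using M P J by (intro assoc_mult_mat) auto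
  ultimately show thesis using P J by (intro that[of "P * J"] orthonormal_cols_mult) auto
qed

text \<open>The maximizer for \<open>M\<close> is a competitor for \<open>N\<close>, and
  multiplication by it does not increase the Frobenius norm of \<open>M - N\<close>.\<close>

lemma ky_fan2_lipschitz:
  assumes M: "M \<in> carrier_mat m n" and N: "N \<in> carrier_mat m n"
  shows "ky_fan2 k M - ky_fan2 k N \<le> hs_norm (M - N)"
proof -
  obtain Q where Q: "Q \<in> carrier_mat n (min k n)" "orthonormal_cols Q" "hs_norm (M * Q) = ky_fan2 k M"
    using ky_fan2_attained[OF M] .
  have "M = N + (M - N)" using M N by (intro eq_matI) auto
  then have "M * Q = (N + (M - N)) * Q" by simp
  also have "\<dots> = N * Q + (M - N) * Q" using M N Q by (intro add_mult_distrib_mat) auto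
  finally have "M * Q = N * Q + (M - N) * Q" .
  then have "hs_norm (M * Q) \<le> hs_norm (N * Q) + hs_norm ((M - N) * Q)"
    using N Q hs_norm_triangle[of "N * Q" m "min k n" "(M - N) * Q"]
      mult_carrier_mat[OF minus_carrier_mat[OF N, of M] Q(1)] by simp
  also have "hs_norm (N * Q) \<le> ky_fan2 (min k n) N" by (rule hs_norm_mult_le_ky_fan2[OF N Q(1,2)])
  also have "\<dots> \<le> ky_fan2 k N" by (rule ky_fan2_mono) simp
  also have "hs_norm ((M - N) * Q) \<le> hs_norm (M - N)"
    using M N Q by (intro hs_norm_mult_orthonormal_le) auto
  finally show ?thesis using Q(3) by simp
qed

text \<open>The first \<open>k\<close> coordinate vectors are competitors in the maximum principle.
  Keeping only the diagonal is crude but enough for the linear growth of the squared Gaussian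
  mean.\<close>

lemma sum_diagonal_le_ky_fan2:
  assumes M: "M \<in> carrier_mat m n" and k: "k \<le> m" "k \<le> n"
  shows "sqrt (\<Sum>i<k. (M $$ (i, i))\<^sup>2) \<le> ky_fan2 k M"
proof -
  define J where "J = Matrix.mat n k (\<lambda>(i, j). if i = j then 1 else 0 :: real)"
  have J: "J \<in> carrier_mat n k" "orthonormal_cols J"
    unfolding J_def using k by (intro initial_columns; simp)+
  have MJ: "(M * J) $$ (i, j) = M $$ (i, j)" if "i < m" "j < k" for i j
  proof -
    have "(M * J) $$ (i, j) = (\<Sum>l<n. M $$ (i, l) * J $$ (l, j))"
      by (rule mult_mat_entry[OF M J(1) that])
    also have "\<dots> = (\<Sum>l<n. if l = j then M $$ (i, j) else 0)"
      using that k by (intro sum.cong) (auto simp: J_def)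
    finally show ?thesis using that k by simp
  qed
  have "(\<Sum>i<k. (M $$ (i, i))\<^sup>2) \<le> (\<Sum>i<k. \<Sum>j<k. (M $$ (i, j))\<^sup>2)"
    by (intro sum_mono) (auto intro: member_le_sum[of _ _ "\<lambda>j. (M $$ (_, j))\<^sup>2"])
  also have "\<dots> \<le> (\<Sum>i<m. \<Sum>j<k. (M $$ (i, j))\<^sup>2)"
    using k by (intro sum_mono2) (auto intro: sum_nonneg)
  also have "\<dots> = (hs_norm (M * J))\<^sup>2"
    unfolding hs_norm_square hs_inner_def using M J MJ by (simp add: power2_eq_square del: index_mult_mat(1))
  also have "\<dots> \<le> (ky_fan2 k M)\<^sup>2"
    by (intro power_mono hs_norm_mult_le_ky_fan2[OF M J]) simp
  finally show ?thesis by (simp add: real_le_lsqrt)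
qed

text \<open>The last \<open>l\<close> squared singular values on the left are dominated one by one
  by the first \<open>l\<close>. This separates the selected rank from the comparison rank, so that
  each is paid for by its own penalty.\<close>

lemma ky_fan2_add_square_le:
  assumes M: "M \<in> carrier_mat m n"
  shows "(ky_fan2 (k + l) M)\<^sup>2 \<le> (ky_fan2 k M)\<^sup>2 + (ky_fan2 l M)\<^sup>2"
proof -
  obtain d where d: "\<And>i. i < n \<Longrightarrow> 0 \<le> d i" "\<And>i j. i \<le> j \<Longrightarrow> j < n \<Longrightarrow> d j \<le> d i"
    and kf: "\<And>k. (ky_fan2 k M)\<^sup>2 = (\<Sum>i<min k n. d i)"
    using singular_values_diagonalization[OF M] by metis
  \<comment> \<open>Extending the eigenvalues by zero removes the minimum with \<open>n\<close> from
    the summation range.\<close>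
  define e where "e i = (if i < n then d i else 0)" for i
  have e: "e (k + i) \<le> e i" for i k using d by (auto simp: e_def)
  have kf': "(ky_fan2 k M)\<^sup>2 = (\<Sum>i<k. e i)" for k
  proof -
    have "(\<Sum>i<k. e i) = (\<Sum>i\<in>{i\<in>{..<k}. i < n}. d i)" unfolding e_def by (rule sum.inter_filter[symmetric]) simp
    also have "{i\<in>{..<k}. i < n} = {..<min k n}" by auto
    finally show ?thesis by (simp add: kf)
  qed
  have "(\<Sum>i<k + l. e i) = (\<Sum>i<k. e i) + (\<Sum>i<l. e (k + i))"
    by (induction l) (auto simp: add.assoc)
  also have "\<dots> \<le> (\<Sum>i<k. e i) + (\<Sum>i<l. e i)" by (intro add_left_mono sum_mono e)
  finally show ?thesis by (simp add: kf')
qed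

text \<open>The inner dimension \<open>s\<close> of the factorization expresses that the rank of
  \<open>D = U * V\<close> is at most \<open>s\<close>. With \<open>Q\<close> an orthonormal basis
  of the row space of \<open>V\<close>, one has \<open>D = D * Q * Q\<^sup>T\<close>, so the inner
  product equals that of \<open>D * Q\<close> and \<open>M * Q\<close>, to which Cauchy-Schwarz and
  the maximum principle apply.\<close>

lemma hs_inner_le_ky_fan2:
  assumes M: "M \<in> carrier_mat m n" and U: "U \<in> carrier_mat m s" and V: "V \<in> carrier_mat s n"
  shows "hs_inner M (U * V) \<le> ky_fan2 s M * hs_norm (U * V)"
proof -
  define r where "r = mat_rank (transpose_mat V)"
  obtain Q where Q: "Q \<in> carrier_mat n r" "orthonormal_cols Q" "Q * (transpose_mat Q * transpose_mat V) = transpose_mat V"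
    using orthonormal_basis_of_column_space[of "transpose_mat V" n s] V unfolding r_def by auto
  have "r \<le> s" unfolding r_def mat_rank_def using V vec_space.rank_le_nc[of "transpose_mat V" n s] by simp
  define D where "D = U * V"
  have D: "D \<in> carrier_mat m n" using U V by (simp add: D_def)
  have QV: "transpose_mat (Q * (transpose_mat Q * transpose_mat V)) = V" unfolding Q(3) by simp
  have "transpose_mat (Q * (transpose_mat Q * transpose_mat V)) = V * Q * transpose_mat Q"
    using Q(1) V by (simp add: transpose_mult[of _ n r _ s] transpose_mult[of _ r n _ s])
  then have VQ: "V * Q * transpose_mat Q = V" using QV by simp
  have "D * Q * transpose_mat Q = D * (Q * transpose_mat Q)"
    using D Q by (intro assoc_mult_mat[of _ m n _ r _ n]) auto
  also have "\<dots> = U * (V * (Q * transpose_mat Q))"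
    unfolding D_def using U V Q by (intro assoc_mult_mat[of _ m s _ n _ n]) auto
  also have "V * (Q * transpose_mat Q) = V * Q * transpose_mat Q"
    using V Q by (intro assoc_mult_mat[symmetric, of _ s n _ r _ n]) auto
  also have "\<dots> = V" by (rule VQ)
  finally have DQ: "D * Q * transpose_mat Q = D" by (simp add: D_def)
  have "hs_inner M D = hs_inner (D * Q * transpose_mat Q) M"
    unfolding DQ by (rule hs_inner_commute[OF M D])
  also have "\<dots> = hs_inner (D * Q) (M * transpose_mat (transpose_mat Q))"
    using M D Q by (intro hs_inner_mult_right) auto
  also have "\<dots> \<le> hs_norm (D * Q) * hs_norm (M * Q)"
    using M D Q hs_inner_le[of "D * Q" m r "M * Q"] by simp
  also have "\<dots> \<le> hs_norm D * ky_fan2 s M"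
    using hs_norm_mult_orthonormal_le[OF D Q(1,2)] hs_norm_mult_le_ky_fan2[OF M Q(1,2)] ky_fan2_mono[OF \<open>r \<le> s\<close>, of M]
    by (intro mult_mono) auto
  finally show ?thesis by (simp add: D_def mult.commute)
qed

section \<open>Rotational invariance of Gaussian matrices\<close>

lemma gaussian_entries_eq: "gaussian_entries m n = gauss_PiM ({..<m} \<times> {..<n})"
  by (simp add: gaussian_entries_def)

lemma random_mat_carrier [simp]: "random_mat m n g \<in> carrier_mat m n"
  by (simp add: random_mat_def)

lemma random_mat_dim [simp]: "dim_row (random_mat m n g) = m" "dim_col (random_mat m n g) = n"
  by (simp_all add: random_mat_def)

lemma random_mat_entry [simp]: "i < m \<Longrightarrow> j < n \<Longrightarrow> random_mat m n g $$ (i, j) = g (i, j)"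
  by (simp add: random_mat_def)

lemma hs_norm_random_mat_diff:
  "hs_norm (random_mat m n x - random_mat m n y) = sqrt (\<Sum>p\<in>{..<m} \<times> {..<n}. (x p - y p)\<^sup>2)"
  by (simp add: hs_norm_def random_mat_def sum.cartesian_product case_prod_beta')

text \<open>Measurability of Ky Fan norms is not apparent from sorted roots of a polynomial, so it
  is derived from the Lipschitz bound: this gives continuity in the product topology, whose Borel
  sets are the product sigma-algebra for a countable index type.\<close>

lemma borel_measurable_PiM_lipschitz:
  fixes f :: "('i::countable \<Rightarrow> real) \<Rightarrow> real"
  assumes "finite I" and f: "\<And>x y. f x - f y \<le> sqrt (\<Sum>i\<in>I. (x i - y i)\<^sup>2)"
  shows "f \<in> borel_measurable (PiM I (\<lambda>_. borel))"
proof -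
  have lip: "\<bar>f x - f y\<bar> \<le> sqrt (\<Sum>i\<in>I. (x i - y i)\<^sup>2)" for x y
    using f[of x y] f[of y x] by (simp add: power2_commute abs_le_iff)
  have "continuous_on UNIV f"
    unfolding continuous_on_def
  proof
    fix a :: "'i \<Rightarrow> real"
    have "((\<lambda>x. x i) \<longlongrightarrow> a i) (at a)" for i
      using continuous_on_product_coordinates[of i] unfolding continuous_on_def by auto
    then have "((\<lambda>x. sqrt (\<Sum>i\<in>I. (x i - a i)\<^sup>2)) \<longlongrightarrow> sqrt (\<Sum>i\<in>I. (a i - a i)\<^sup>2)) (at a)"
      by (intro tendsto_intros)
    then have "((\<lambda>x. sqrt (\<Sum>i\<in>I. (x i - a i)\<^sup>2)) \<longlongrightarrow> 0) (at a)" by simp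
    then have "((\<lambda>x. f x - f a) \<longlongrightarrow> 0) (at a)"
      by (rule Lim_null_comparison[rotated]) (use lip in simp)
    then show "(f \<longlongrightarrow> f a) (at a within UNIV)" by (simp add: LIM_zero_cancel)
  qed
  then have "f \<in> borel_measurable borel" by (rule borel_measurable_continuous_onI)
  then have mf: "f \<in> borel_measurable (PiM UNIV (\<lambda>_. borel))"
    by (simp add: measurable_cong_sets[OF sets_PiM_equal_borel refl])
  \<comment> \<open>The transfer from all indices to \<open>I\<close> is by extension with zero. It
    does not change \<open>f\<close>, since the Lipschitz bound only counts coordinates in
    \<open>I\<close>.\<close>
  have "(\<lambda>(x :: 'i \<Rightarrow> real) i. if i \<in> I then x i else 0) \<in> measurable (PiM I (\<lambda>_. borel)) (PiM UNIV (\<lambda>_. borel))"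
  proof (rule measurable_PiM_single')
    fix i :: 'i
    show "(\<lambda>x. if i \<in> I then x i else 0) \<in> borel_measurable (PiM I (\<lambda>_. borel :: real measure))"
      by (cases "i \<in> I") auto
  qed auto
  then have "(\<lambda>x. f (\<lambda>i. if i \<in> I then x i else 0)) \<in> borel_measurable (PiM I (\<lambda>_. borel))"
    using mf by (rule measurable_compose)
  moreover have "f (\<lambda>i. if i \<in> I then x i else 0) = f x" for x
    using lip[of "\<lambda>i. if i \<in> I then x i else 0" x] by simp
  ultimately show ?thesis by simp
qed

lemma hs_norm_transpose:
  assumes "A \<in> carrier_mat m n" shows "hs_norm (transpose_mat A) = hs_norm A"
  using hs_inner_transpose[OF assms assms] by (simp add: hs_norm_square[symmetric] power2_eq_iff_nonneg)

lemma hs_norm_transpose_mult_le: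
  assumes "Q \<in> carrier_mat m k" "orthonormal_cols Q" "N \<in> carrier_mat m n"
  shows "hs_norm (transpose_mat Q * N) \<le> hs_norm N"
proof -
  have "transpose_mat Q * N = transpose_mat (transpose_mat N * Q)"
    using assms by (simp add: transpose_mult[of _ n m _ k])
  then have "hs_norm (transpose_mat Q * N) = hs_norm (transpose_mat N * Q)"
    using assms by (simp add: hs_norm_transpose[of "transpose_mat N * Q" n k])
  also have "\<dots> \<le> hs_norm (transpose_mat N)" using assms by (intro hs_norm_mult_orthonormal_le) auto
  finally show ?thesis using assms by (simp add: hs_norm_transpose)
qed

lemma ky_fan2_compression_lipschitz:
  assumes Q: "Q \<in> carrier_mat m k" "orthonormal_cols Q"
  shows "ky_fan2 r (transpose_mat Q * random_mat m n x) - ky_fan2 r (transpose_mat Q * random_mat m n y)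
    \<le> sqrt (\<Sum>p\<in>{..<m} \<times> {..<n}. (x p - y p)\<^sup>2)"
proof -
  have "ky_fan2 r (transpose_mat Q * random_mat m n x) - ky_fan2 r (transpose_mat Q * random_mat m n y)
    \<le> hs_norm (transpose_mat Q * random_mat m n x - transpose_mat Q * random_mat m n y)"
    using Q by (intro ky_fan2_lipschitz[of _ k n]) auto
  also have "transpose_mat Q * random_mat m n x - transpose_mat Q * random_mat m n y
     = transpose_mat Q * (random_mat m n x - random_mat m n y)"
    using Q by (intro mult_minus_distrib_mat[symmetric, of _ k m _ n]) auto
  also have "hs_norm \<dots> \<le> hs_norm (random_mat m n x - random_mat m n y)"
    using Q by (intro hs_norm_transpose_mult_le[OF Q, of _ n]) (auto intro: minus_carrier_mat)
  finally show ?thesis by (simp add: hs_norm_random_mat_diff)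
qed

lemma borel_measurable_ky_fan2_compression:
  assumes Q: "Q \<in> carrier_mat m k" "orthonormal_cols Q"
  shows "(\<lambda>g. ky_fan2 r (transpose_mat Q * random_mat m n g)) \<in> borel_measurable (gaussian_entries m n)"
  unfolding gaussian_entries_eq measurable_cong_sets[OF sets_gauss_PiM refl]
  by (rule borel_measurable_PiM_lipschitz) (auto intro: ky_fan2_compression_lipschitz[OF Q])

lemma ky_fan2_random_mat_lipschitz:
  "ky_fan2 r (random_mat q n x) - ky_fan2 r (random_mat q n y) \<le> sqrt (\<Sum>p\<in>{..<q} \<times> {..<n}. (x p - y p)\<^sup>2)"
  using ky_fan2_lipschitz[of "random_mat q n x" q n "random_mat q n y" r] by (simp add: hs_norm_random_mat_diff)

lemma borel_measurable_ky_fan2: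
  "(\<lambda>g. ky_fan2 r (random_mat q n g)) \<in> borel_measurable (gaussian_entries q n)"
  unfolding gaussian_entries_eq measurable_cong_sets[OF sets_gauss_PiM refl]
  by (rule borel_measurable_PiM_lipschitz) (auto intro: ky_fan2_random_mat_lipschitz)

text \<open>Invariance in law is tested by integrals of functions of the entries, so the type of
  matrices needs no sigma-algebra. Measurability of the rotated integrand belongs to the definition
  because closure under products uses it.\<close>

definition gauss_invariant :: "nat \<Rightarrow> nat \<Rightarrow> real mat \<Rightarrow> bool" where
  "gauss_invariant m n R \<longleftrightarrow> R \<in> carrier_mat m m \<and> orthonormal_cols R \<and>
    (\<forall>F::real mat \<Rightarrow> ennreal. (\<lambda>g. F (random_mat m n g)) \<in> borel_measurable (gaussian_entries m n) \<longrightarrow>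
      (\<lambda>g. F (R * random_mat m n g)) \<in> borel_measurable (gaussian_entries m n) \<and>
      (\<integral>\<^sup>+g. F (R * random_mat m n g) \<partial>gaussian_entries m n) = (\<integral>\<^sup>+g. F (random_mat m n g) \<partial>gaussian_entries m n))"

lemma gauss_invariantD:
  fixes F :: "real mat \<Rightarrow> ennreal"
  assumes "gauss_invariant m n R" "(\<lambda>g. F (random_mat m n g)) \<in> borel_measurable (gaussian_entries m n)"
  shows "(\<lambda>g. F (R * random_mat m n g)) \<in> borel_measurable (gaussian_entries m n)"
    and "(\<integral>\<^sup>+g. F (R * random_mat m n g) \<partial>gaussian_entries m n) = (\<integral>\<^sup>+g. F (random_mat m n g) \<partial>gaussian_entries m n)"
  using assms unfolding gauss_invariant_def by blast+

lemma gauss_invariant_one: "gauss_invariant m n (1\<^sub>m m)"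
  by (simp add: gauss_invariant_def orthonormal_cols_def left_mult_one_mat[OF random_mat_carrier])

lemma gauss_invariant_mult:
  assumes R: "gauss_invariant m n R" and S: "gauss_invariant m n S"
  shows "gauss_invariant m n (R * S)"
proof -
  have carr: "R \<in> carrier_mat m m" "S \<in> carrier_mat m m" "orthonormal_cols R" "orthonormal_cols S"
    using R S by (auto simp: gauss_invariant_def)
  have assoc: "R * S * random_mat m n g = R * (S * random_mat m n g)" for g
    using carr by (intro assoc_mult_mat[of _ m m _ m _ n]) auto
  show ?thesis
    unfolding gauss_invariant_def
  proof (intro conjI allI impI)
    fix F :: "real mat \<Rightarrow> ennreal"
    assume F: "(\<lambda>g. F (random_mat m n g)) \<in> borel_measurable (gaussian_entries m n)"
    have 1: "(\<lambda>g. F (R * random_mat m n g)) \<in> borel_measurable (gaussian_entries m n)"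
      "(\<integral>\<^sup>+g. F (R * random_mat m n g) \<partial>gaussian_entries m n) = (\<integral>\<^sup>+g. F (random_mat m n g) \<partial>gaussian_entries m n)"
      by (rule gauss_invariantD[OF R F])+
    have 2: "(\<lambda>g. F (R * (S * random_mat m n g))) \<in> borel_measurable (gaussian_entries m n)"
      "(\<integral>\<^sup>+g. F (R * (S * random_mat m n g)) \<partial>gaussian_entries m n) = (\<integral>\<^sup>+g. F (R * random_mat m n g) \<partial>gaussian_entries m n)"
      by (rule gauss_invariantD[OF S, of "\<lambda>M. F (R * M)", OF 1(1)])+
    show "(\<lambda>g. F (R * S * random_mat m n g)) \<in> borel_measurable (gaussian_entries m n)"
      unfolding assoc by (rule 2(1))
    show "(\<integral>\<^sup>+g. F (R * S * random_mat m n g) \<partial>gaussian_entries m n) = (\<integral>\<^sup>+g. F (random_mat m n g) \<partial>gaussian_entries m n)"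
      unfolding assoc 2(2) by (rule 1(2))
  qed (use carr in \<open>auto intro: orthonormal_cols_mult\<close>)
qed

section \<open>Givens rotations and triangularization\<close>

definition givens :: "nat \<Rightarrow> nat \<Rightarrow> nat \<Rightarrow> real \<Rightarrow> real \<Rightarrow> real mat" where
  "givens m a b c s = Matrix.mat m m (\<lambda>(i, j).
     if i = a then (if j = a then c else if j = b then s else 0)
     else if i = b then (if j = a then - s else if j = b then c else 0)
     else if i = j then 1 else 0)"

lemma givens_carrier [simp]: "givens m a b c s \<in> carrier_mat m m"
  by (simp add: givens_def)

lemma givens_dim [simp]: "dim_row (givens m a b c s) = m" "dim_col (givens m a b c s) = m"
  by (simp_all add: givens_def)

lemma givens_mult_entry:
  assumes "M \<in> carrier_mat m n" "a < m" "b < m" "a \<noteq> b" "i < m" "j < n"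
  shows "(givens m a b c s * M) $$ (i, j) =
    (if i = a then c * M $$ (a, j) + s * M $$ (b, j)
     else if i = b then c * M $$ (b, j) - s * M $$ (a, j) else M $$ (i, j))"
proof -
  have "(givens m a b c s * M) $$ (i, j) = (\<Sum>l<m. givens m a b c s $$ (i, l) * M $$ (l, j))"
    using assms by (intro mult_mat_entry) auto
  also have "\<dots> = (\<Sum>l<m. (if l = a then (if i = a then c * M $$ (a, j) else if i = b then - s * M $$ (a, j) else 0) else 0)
      + (if l = b then (if i = a then s * M $$ (b, j) else if i = b then c * M $$ (b, j) else 0) else 0)
      + (if l = i then (if i = a \<or> i = b then 0 else M $$ (i, j)) else 0))"
    using assms by (intro sum.cong) (auto simp: givens_def)
  finally show ?thesis using assms by (simp add: sum.distrib)
qed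

lemma mult_givens_entry:
  assumes "W \<in> carrier_mat q m" "a < m" "b < m" "a \<noteq> b" "i < q" "j < m"
  shows "(W * givens m a b c s) $$ (i, j) =
    (if j = a then c * W $$ (i, a) - s * W $$ (i, b)
     else if j = b then s * W $$ (i, a) + c * W $$ (i, b) else W $$ (i, j))"
proof -
  have "(W * givens m a b c s) $$ (i, j) = (\<Sum>l<m. W $$ (i, l) * givens m a b c s $$ (l, j))"
    using assms by (intro mult_mat_entry) auto
  also have "\<dots> = (\<Sum>l<m. (if l = a then (if j = a then c * W $$ (i, a) else if j = b then s * W $$ (i, a) else 0) else 0)
      + (if l = b then (if j = a then - s * W $$ (i, b) else if j = b then c * W $$ (i, b) else 0) else 0)
      + (if l = j then (if j = a \<or> j = b then 0 else W $$ (i, j)) else 0))"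
    using assms by (intro sum.cong) (auto simp: givens_def)
  finally show ?thesis using assms by (simp add: sum.distrib)
qed

lemma orthonormal_cols_givens:
  assumes "a < m" "b < m" "a \<noteq> b" "c\<^sup>2 + s\<^sup>2 = 1"
  shows "orthonormal_cols (givens m a b c s)"
proof -
  have t: "transpose_mat (givens m a b c s) = givens m a b c (- s)"
    by (rule eq_matI) (use assms in \<open>auto simp: givens_def\<close>)
  have "givens m a b c (- s) * givens m a b c s = 1\<^sub>m m"
  proof (rule eq_matI)
    fix i j assume "i < dim_row (1\<^sub>m m :: real mat)" "j < dim_col (1\<^sub>m m :: real mat)"
    then have ij: "i < m" "j < m" by auto
    show "(givens m a b c (- s) * givens m a b c s) $$ (i, j) = 1\<^sub>m m $$ (i, j)"
      unfolding givens_mult_entry[OF givens_carrier assms(1-3) ij]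
      using assms ij by (auto simp: givens_def power2_eq_square)
  qed auto
  moreover have "dim_col (givens m a b c s) = m" by (simp add: givens_def)
  ultimately show ?thesis by (simp add: orthonormal_cols_def t)
qed

lemma gauss_invariant_givens:
  assumes ab: "a < m" "b < m" "a \<noteq> b" and cs: "c\<^sup>2 + s\<^sup>2 = 1" "s \<noteq> 0"
  shows "gauss_invariant m n (givens m a b c s)"
proof -
  define I where "I = {..<m} \<times> {..<n}"
  define \<rho> where "\<rho> = (\<lambda>j (g :: nat \<times> nat \<Rightarrow> real). g((a, j) := c * g (a, j) + s * g (b, j), (b, j) := c * g (b, j) - s * g (a, j)))"
  \<comment> \<open>\<open>R J\<close> rotates rows \<open>a\<close> and \<open>b\<close> in the
    columns with index below \<open>J\<close> only. So \<open>R 0\<close> is the identity,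
    \<open>R n\<close> is left multiplication by the Givens matrix, and each induction step is one
    plane rotation of two coordinates.\<close>
  define R where "R = (\<lambda>J (g :: nat \<times> nat \<Rightarrow> real). \<lambda>(i, j). if j < J \<and> i = a then c * g (a, j) + s * g (b, j)
      else if j < J \<and> i = b then c * g (b, j) - s * g (a, j) else g (i, j))"
  have R_Suc: "R (Suc J) g = R J (\<rho> J g)" for J g
    using ab by (auto simp: R_def \<rho>_def fun_eq_iff less_Suc_eq)
  have "(\<lambda>g. F (R J g)) \<in> borel_measurable (gauss_PiM I) \<and>
      (\<integral>\<^sup>+g. F (R J g) \<partial>gauss_PiM I) = (\<integral>\<^sup>+g. F g \<partial>gauss_PiM I)"
    if "J \<le> n" "F \<in> borel_measurable (gauss_PiM I)" for J and F :: "(nat \<times> nat \<Rightarrow> real) \<Rightarrow> ennreal"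
    using that
  proof (induction J arbitrary: F)
    case 0
    then show ?case by (simp add: R_def case_prod_beta')
  next
    case (Suc J)
    then have in_I: "(a, J) \<in> I" "(b, J) \<in> I" using ab by (auto simp: I_def)
    have IH: "(\<lambda>g. F (R J g)) \<in> borel_measurable (gauss_PiM I)"
      "(\<integral>\<^sup>+g. F (R J g) \<partial>gauss_PiM I) = (\<integral>\<^sup>+g. F g \<partial>gauss_PiM I)"
      using Suc.IH[of F] Suc.prems by auto
    have [measurable]: "\<rho> J \<in> measurable (gauss_PiM I) (gauss_PiM I)"
      unfolding \<rho>_def using in_I
      by (intro measurable_fun_upd[where J=I]) (auto simp: insert_absorb)
    have "(\<lambda>g. F (R J (\<rho> J g))) \<in> borel_measurable (gauss_PiM I)"
      using IH(1) by measurable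
    moreover have "(\<integral>\<^sup>+g. F (R J (\<rho> J g)) \<partial>gauss_PiM I) = (\<integral>\<^sup>+g. F (R J g) \<partial>gauss_PiM I)"
      unfolding \<rho>_def using in_I ab IH(1)
      by (intro nn_integral_gauss_PiM_rotation[OF _ _ _ _ cs]) (auto simp: I_def)
    ultimately show ?case by (simp add: R_Suc IH(2))
  qed
  note main = this
  have act: "givens m a b c s * random_mat m n g = random_mat m n (R n g)" for g
  proof (rule eq_matI)
    fix i j assume "i < dim_row (random_mat m n (R n g))" "j < dim_col (random_mat m n (R n g))"
    then have ij: "i < m" "j < n" by (auto simp: random_mat_def)
    show "(givens m a b c s * random_mat m n g) $$ (i, j) = random_mat m n (R n g) $$ (i, j)"
      unfolding givens_mult_entry[OF random_mat_carrier ab ij] using ab ij by (simp add: R_def)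
  qed (auto simp: random_mat_def givens_def)
  show ?thesis
    unfolding gauss_invariant_def
  proof (intro conjI allI impI)
    fix F :: "real mat \<Rightarrow> ennreal"
    assume F: "(\<lambda>g. F (random_mat m n g)) \<in> borel_measurable (gaussian_entries m n)"
    show "(\<lambda>g. F (givens m a b c s * random_mat m n g)) \<in> borel_measurable (gaussian_entries m n)"
      "(\<integral>\<^sup>+g. F (givens m a b c s * random_mat m n g) \<partial>gaussian_entries m n) = (\<integral>\<^sup>+g. F (random_mat m n g) \<partial>gaussian_entries m n)"
      using main[of n "\<lambda>g. F (random_mat m n g)"] F unfolding act gaussian_entries_eq I_def by auto
  qed (use orthonormal_cols_givens[OF ab cs(1)] in auto)
qed

declare index_mult_mat(1) [simp del] assoc_mult_mat [simp del]

text \<open>The rotation mixes only the columns \<open>a\<close> and \<open>b\<close>. The last two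
  properties let an elimination proceed without destroying zeros: other columns stay unchanged, and
  so does every row with zeros in both mixed columns.\<close>

lemma givens_eliminate:
  assumes W: "W \<in> carrier_mat q m" and ab: "a < m" "b < m" "a \<noteq> b" and i: "i < q"
  obtains R where "gauss_invariant m n R" "(W * R) $$ (i, b) = 0"
    "\<And>k j. k < q \<Longrightarrow> j < m \<Longrightarrow> j \<noteq> a \<Longrightarrow> j \<noteq> b \<Longrightarrow> (W * R) $$ (k, j) = W $$ (k, j)"
    "\<And>k j. k < q \<Longrightarrow> j < m \<Longrightarrow> W $$ (k, a) = 0 \<Longrightarrow> W $$ (k, b) = 0 \<Longrightarrow> (W * R) $$ (k, j) = W $$ (k, j)"
proof (cases "W $$ (i, b) = 0")
  case True
  then show ?thesis using W i ab gauss_invariant_one by (intro that[of "1\<^sub>m m"]) auto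
next
  case False
  define \<rho> where "\<rho> = sqrt ((W $$ (i, a))\<^sup>2 + (W $$ (i, b))\<^sup>2)"
  have pos: "0 < (W $$ (i, a))\<^sup>2 + (W $$ (i, b))\<^sup>2" using False by (simp add: sum_power2_gt_zero_iff)
  then have \<rho>: "0 < \<rho>" "\<rho>\<^sup>2 = (W $$ (i, a))\<^sup>2 + (W $$ (i, b))\<^sup>2" by (auto simp: \<rho>_def)
  \<comment> \<open>The pair \<open>c\<close>, \<open>s\<close> is the normalized vector of
    \<open>W $$ (i, a)\<close> and \<open>- W $$ (i, b)\<close>, chosen to annihilate the new entry
    at \<open>(i, b)\<close>. Here \<open>s\<close> is nonzero because the old entry is; otherwise
    the identity matrix already served.\<close>
  define c where "c = W $$ (i, a) / \<rho>"
  define s where "s = - (W $$ (i, b) / \<rho>)"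
  have cs: "c\<^sup>2 + s\<^sup>2 = 1" "s \<noteq> 0"
    using \<rho> pos False by (auto simp: c_def s_def power_divide add_divide_distrib[symmetric])
  have z: "s * W $$ (i, a) + c * W $$ (i, b) = 0" by (simp add: c_def s_def)
  show ?thesis
    using mult_givens_entry[OF W ab] z ab i
    by (intro that[of "givens m a b c s"] gauss_invariant_givens[OF ab cs]) auto
qed

text \<open>An LQ decomposition by plane rotations, row by row. In row \<open>i\<close> the entries
  in columns \<open>t > i\<close> are rotated into column \<open>i\<close>; a row
  \<open>k < i\<close> already vanishes in the columns \<open>i\<close> and \<open>t\<close>, so its
  zeros survive.\<close>

lemma gauss_invariant_lower_triangular:
  assumes W: "W \<in> carrier_mat q m"
  shows "\<exists>R. gauss_invariant m n R \<and> (\<forall>i<q. \<forall>j<m. i < j \<longrightarrow> (W * R) $$ (i, j) = 0)"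
proof -
  have carr: "R \<in> carrier_mat m m" if "gauss_invariant m n R" for R
    using that by (simp add: gauss_invariant_def)
  have row: "\<exists>R. gauss_invariant m n R \<and> (\<forall>k<i. \<forall>j<m. k < j \<longrightarrow> (W' * R) $$ (k, j) = 0)
      \<and> (\<forall>j<t. i < j \<longrightarrow> (W' * R) $$ (i, j) = 0)"
    if W': "W' \<in> carrier_mat q m" and i: "i < q" and low: "\<forall>k<i. \<forall>j<m. k < j \<longrightarrow> W' $$ (k, j) = 0" and t: "t \<le> m"
    for W' i t
    using t
  proof (induction t)
    case 0
    then show ?case using W' i low gauss_invariant_one[of m n] by (intro exI[of _ "1\<^sub>m m"]) auto
  next
    case (Suc t)
    then obtain R where R: "gauss_invariant m n R" "\<forall>k<i. \<forall>j<m. k < j \<longrightarrow> (W' * R) $$ (k, j) = 0"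
      "\<forall>j<t. i < j \<longrightarrow> (W' * R) $$ (i, j) = 0" by auto
    have WR: "W' * R \<in> carrier_mat q m" using W' carr[OF R(1)] by simp
    show ?case
    proof (cases "i < t")
      case False
      then show ?thesis using R by (intro exI[of _ R]) (auto simp: less_Suc_eq simp del: index_mult_mat(1))
    next
      case True
      then have it: "i < m" "t < m" "i \<noteq> t" using Suc.prems by auto
      obtain G where G: "gauss_invariant m n G" "(W' * R * G) $$ (i, t) = 0"
        "\<And>k j. k < q \<Longrightarrow> j < m \<Longrightarrow> j \<noteq> i \<Longrightarrow> j \<noteq> t \<Longrightarrow> (W' * R * G) $$ (k, j) = (W' * R) $$ (k, j)"
        "\<And>k j. k < q \<Longrightarrow> j < m \<Longrightarrow> (W' * R) $$ (k, i) = 0 \<Longrightarrow> (W' * R) $$ (k, t) = 0 \<Longrightarrow> (W' * R * G) $$ (k, j) = (W' * R) $$ (k, j)"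
        by (rule givens_eliminate[OF WR it i, of n]) (rule that)
      have assoc: "W' * (R * G) = W' * R * G"
        using W' carr[OF R(1)] carr[OF G(1)] by (intro assoc_mult_mat[symmetric, of _ q m _ m _ m]) auto
      show ?thesis
      proof (intro exI[of _ "R * G"] conjI allI impI gauss_invariant_mult[OF R(1) G(1)])
        fix k j assume kj: "k < i" "j < m" "k < j"
        have "(W' * R) $$ (k, i) = 0" "(W' * R) $$ (k, t) = 0" using R(2) kj it True order.strict_trans by blast+
        then have "(W' * R * G) $$ (k, j) = (W' * R) $$ (k, j)" using kj(1,2) i by (intro G(4)) linarith+
        also have "\<dots> = 0" using R(2) kj by blast
        finally show "(W' * (R * G)) $$ (k, j) = 0" unfolding assoc .
      next
        fix j assume j: "j < Suc t" "i < j"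
        show "(W' * (R * G)) $$ (i, j) = 0"
        proof (cases "j = t")
          case True
          show ?thesis unfolding assoc True by (rule G(2))
        next
          case False
          then have "(W' * R * G) $$ (i, j) = (W' * R) $$ (i, j)" using j i it by (intro G(3)) auto
          also have "\<dots> = 0" using R(3) j False by (simp add: less_Suc_eq del: index_mult_mat(1))
          finally show ?thesis unfolding assoc .
        qed
      qed
    qed
  qed
  have "\<exists>R. gauss_invariant m n R \<and> (\<forall>k<i. \<forall>j<m. k < j \<longrightarrow> (W * R) $$ (k, j) = 0)" if "i \<le> q" for i
    using that
  proof (induction i)
    case 0
    then show ?case using gauss_invariant_one[of m n] by (intro exI[of _ "1\<^sub>m m"]) auto
  next
    case (Suc i)
    then obtain R where R: "gauss_invariant m n R" "\<forall>k<i. \<forall>j<m. k < j \<longrightarrow> (W * R) $$ (k, j) = 0" by auto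
    have WR: "W * R \<in> carrier_mat q m" using W carr[OF R(1)] by simp
    obtain G where G: "gauss_invariant m n G" "\<forall>k<i. \<forall>j<m. k < j \<longrightarrow> (W * R * G) $$ (k, j) = 0"
      "\<forall>j<m. i < j \<longrightarrow> (W * R * G) $$ (i, j) = 0"
      using row[OF WR _ R(2), of m] Suc.prems by auto
    have assoc: "W * (R * G) = W * R * G"
      using W carr[OF R(1)] carr[OF G(1)] by (intro assoc_mult_mat[symmetric, of _ q m _ m _ m]) auto
    show ?case
      by (intro exI[of _ "R * G"] conjI gauss_invariant_mult[OF R(1) G(1)], unfold assoc less_Suc_eq)
        (use G(2,3) in blast)
  qed
  from this[of q] show ?thesis by simp
qed

text \<open>After right multiplication by rotations \<open>Q\<^sup>T\<close> becomes \<open>[L 0]\<close> with a square orthogonal \<open>L\<close>, which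
  does not affect the Gram matrix and hence the singular values.\<close>

lemma nn_integral_ky_fan2_compression:
  fixes f :: "real \<Rightarrow> ennreal"
  assumes Q: "Q \<in> carrier_mat m q" "orthonormal_cols Q" and [measurable]: "f \<in> borel_measurable borel"
  shows "(\<integral>\<^sup>+g. f (ky_fan2 r (transpose_mat Q * random_mat m n g)) \<partial>gaussian_entries m n)
    = (\<integral>\<^sup>+g. f (ky_fan2 r (random_mat q n g)) \<partial>gaussian_entries q n)"
proof -
  have "real q \<le> (\<Sum>i<m. 1)"
    unfolding orthonormal_cols_row_sums(2)[OF Q, symmetric] by (intro sum_mono orthonormal_cols_row_sums(1)[OF Q]) auto
  then have qm: "q \<le> m" by simp
  define W where "W = transpose_mat Q"
  have W: "W \<in> carrier_mat q m" using Q by (simp add: W_def)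
  obtain R where R: "gauss_invariant m n R" and low: "\<forall>i<q. \<forall>j<m. i < j \<longrightarrow> (W * R) $$ (i, j) = 0"
    using gauss_invariant_lower_triangular[OF W] by blast
  have Rc: "R \<in> carrier_mat m m" "orthonormal_cols R" using R by (auto simp: gauss_invariant_def)
  define L where "L = Matrix.mat q q (\<lambda>(i, j). (W * R) $$ (i, j))"
  have L: "L \<in> carrier_mat q q" by (simp add: L_def)
  have WR: "W * R \<in> carrier_mat q m" using W Rc by simp
  have split: "(\<Sum>l<m. (W * R) $$ (i, l) * h l) = (\<Sum>l<q. L $$ (i, l) * h l)" if i: "i < q" for i and h :: "nat \<Rightarrow> real"
  proof -
    have "(\<Sum>l<m. (W * R) $$ (i, l) * h l) = (\<Sum>l<q. (W * R) $$ (i, l) * h l)"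
      using low i qm by (intro sum.mono_neutral_right) auto
    then show ?thesis using i by (simp add: L_def del: index_mult_mat(1))
  qed
  have "L * transpose_mat L = (W * R) * transpose_mat (W * R)"
  proof (rule eq_matI)
    fix i j assume "i < dim_row ((W * R) * transpose_mat (W * R))" "j < dim_col ((W * R) * transpose_mat (W * R))"
    then have ij: "i < q" "j < q" using W by auto
    have "((W * R) * transpose_mat (W * R)) $$ (i, j) = (\<Sum>l<m. (W * R) $$ (i, l) * (W * R) $$ (j, l))"
      using mult_mat_entry[of "W * R" q m "transpose_mat (W * R)" q i j] WR W Rc ij by (simp del: index_mult_mat(1))
    also have "\<dots> = (\<Sum>l<q. L $$ (i, l) * (W * R) $$ (j, l))" by (rule split[OF ij(1)])
    also have "\<dots> = (L * transpose_mat L) $$ (i, j)"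
      using mult_mat_entry[of L q q "transpose_mat L" q i j] L ij by (simp add: L_def del: index_mult_mat(1))
    finally show "(L * transpose_mat L) $$ (i, j) = ((W * R) * transpose_mat (W * R)) $$ (i, j)" ..
  qed (use L W in auto)
  also have "\<dots> = W * R * (transpose_mat R * transpose_mat W)" using transpose_mult[OF W Rc(1)] by simp
  also have "\<dots> = W * (R * (transpose_mat R * transpose_mat W))"
    using W Rc by (intro assoc_mult_mat[of _ q m _ m _ q]) auto
  also have "R * (transpose_mat R * transpose_mat W) = R * transpose_mat R * transpose_mat W"
    using W Rc by (intro assoc_mult_mat[symmetric, of _ m m _ m _ q]) auto
  also have "\<dots> = transpose_mat W" using orthonormal_cols_square[OF Rc] W by simp
  also have "W * transpose_mat W = 1\<^sub>m q" using Q by (simp add: W_def orthonormal_cols_def)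
  \<comment> \<open>\<open>L\<close> is square, so its rows being orthonormal makes its columns
    orthonormal as well.\<close>
  finally have "transpose_mat L * L = 1\<^sub>m q"
    using L by (intro mat_mult_left_right_inverse[of L q "transpose_mat L"]) auto
  then have oL: "orthonormal_cols L" using L by (simp add: orthonormal_cols_def)
  have eq: "ky_fan2 r (W * (R * random_mat m n g)) = ky_fan2 r (random_mat q n g)" for g
  proof -
    define G where "G = random_mat q n g"
    have G: "G \<in> carrier_mat q n" by (simp add: G_def)
    have "W * (R * random_mat m n g) = (W * R) * random_mat m n g"
      using W Rc by (intro assoc_mult_mat[symmetric, of _ q m _ m _ n]) auto
    also have "\<dots> = L * G"
    proof (rule eq_matI)
      fix i j assume "i < dim_row (L * G)" "j < dim_col (L * G)"
      then have ij: "i < q" "j < n" using L G by auto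
      have "((W * R) * random_mat m n g) $$ (i, j) = (\<Sum>l<m. (W * R) $$ (i, l) * random_mat m n g $$ (l, j))"
        by (rule mult_mat_entry[OF WR random_mat_carrier ij])
      also have "\<dots> = (\<Sum>l<q. L $$ (i, l) * random_mat m n g $$ (l, j))" by (rule split[OF ij(1)])
      also have "\<dots> = (L * G) $$ (i, j)"
        using mult_mat_entry[OF L G ij] ij qm by (simp add: G_def del: index_mult_mat(1))
      finally show "((W * R) * random_mat m n g) $$ (i, j) = (L * G) $$ (i, j)" .
    qed (use L W G in \<open>auto simp: random_mat_def\<close>)
    finally have "W * (R * random_mat m n g) = L * G" .
    moreover have "transpose_mat (L * G) * (L * G) = transpose_mat G * G"
    proof -
      have "transpose_mat (L * G) * (L * G) = transpose_mat G * transpose_mat L * (L * G)"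
        using transpose_mult[OF L G] by simp
      also have "\<dots> = transpose_mat G * (transpose_mat L * (L * G))"
        using L G by (intro assoc_mult_mat[of _ n q _ q _ n]) auto
      also have "transpose_mat L * (L * G) = transpose_mat L * L * G"
        using L G by (intro assoc_mult_mat[symmetric, of _ q q _ q _ n]) auto
      also have "\<dots> = G" using oL L G by (simp add: orthonormal_cols_def)
      finally show ?thesis .
    qed
    ultimately show ?thesis using ky_fan2_gram_cong[of "L * G" G r] by (simp add: G_def)
  qed
  have m1[measurable]: "(\<lambda>g. f (ky_fan2 r (W * random_mat m n g))) \<in> borel_measurable (gaussian_entries m n)"
    unfolding W_def using borel_measurable_ky_fan2_compression[OF Q] by measurable
  have m2: "(\<lambda>g. f (ky_fan2 r (random_mat q n g))) \<in> borel_measurable (gaussian_entries q n)"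
    using borel_measurable_ky_fan2 by measurable
  have "(\<integral>\<^sup>+g. f (ky_fan2 r (W * random_mat m n g)) \<partial>gaussian_entries m n)
      = (\<integral>\<^sup>+g. f (ky_fan2 r (W * (R * random_mat m n g))) \<partial>gaussian_entries m n)"
    by (rule gauss_invariantD(2)[OF R, of "\<lambda>M. f (ky_fan2 r (W * M))", OF m1, symmetric])
  also have "\<dots> = (\<integral>\<^sup>+g. f (ky_fan2 r (random_mat q n g)) \<partial>gaussian_entries m n)" unfolding eq ..
  \<comment> \<open>Only the top \<open>q\<close> rows enter, and the marginal of the product
    measure on their entries is the law of a \<open>q\<close> by \<open>n\<close> Gaussian
    matrix.\<close>
  also have "\<dots> = (\<integral>\<^sup>+g. f (ky_fan2 r (random_mat q n (restrict g ({..<q} \<times> {..<n})))) \<partial>gaussian_entries m n)"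
  proof -
    have "random_mat q n (restrict g ({..<q} \<times> {..<n})) = random_mat q n g" for g
      by (rule eq_matI) (auto simp: random_mat_def)
    then show ?thesis by simp
  qed
  also have "\<dots> = (\<integral>\<^sup>+g. f (ky_fan2 r (random_mat q n g)) \<partial>distr (gaussian_entries m n) (gaussian_entries q n) (\<lambda>g. restrict g ({..<q} \<times> {..<n})))"
  proof (rule nn_integral_distr[symmetric])
    show "(\<lambda>g. restrict g ({..<q} \<times> {..<n})) \<in> measurable (gaussian_entries m n) (gaussian_entries q n)"
      unfolding gaussian_entries_eq using qm by (intro measurable_restrict_subset) auto
  qed (use m2 in simp)
  also have "distr (gaussian_entries m n) (gaussian_entries q n) (\<lambda>g. restrict g ({..<q} \<times> {..<n})) = gaussian_entries q n"
    unfolding gaussian_entries_eq using qm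
    by (intro product_prob_space.distr_PiM_restrict_finite std_gauss_product.product_prob_space_axioms) auto
  finally show ?thesis unfolding W_def .
qed

section \<open>The oracle inequality\<close>

lemma gaussian_lipschitz_ky_fan2:
  "gaussian_lipschitz ({..<q} \<times> {..<n}) (\<lambda>g. ky_fan2 r (random_mat q n g))"
  by unfold_locales (use borel_measurable_ky_fan2 ky_fan2_random_mat_lipschitz in \<open>auto simp: gaussian_entries_eq\<close>)

lemma mean_ky_fan2:
  "gaussian_lipschitz.mean ({..<q} \<times> {..<n}) (\<lambda>g. ky_fan2 r (random_mat q n g)) = gaussian_ky_fan2 q n r"
  by (simp add: gaussian_lipschitz.mean_def[OF gaussian_lipschitz_ky_fan2] gaussian_ky_fan2_def gaussian_entries_eq)

text \<open>By Cauchy-Schwarz the sum of the absolute diagonal entries is at most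
  \<open>sqrt r\<close> times the Ky Fan norm. Taking expectations with the first absolute moment
  \<open>sqrt (2 / pi)\<close> bounds the mean of the norm itself, not merely the mean of its
  square.\<close>

lemma gaussian_ky_fan2_lower_bound:
  assumes r: "r \<le> q" "r \<le> n"
  shows "2 / pi * real r \<le> (gaussian_ky_fan2 q n r)\<^sup>2"
proof -
  define I where "I = {..<q} \<times> {..<n}"
  have iI: "(i, i) \<in> I" if "i < r" for i using that r by (auto simp: I_def)
  note comp = integrable_gauss_PiM_component[OF iI integrable_abs_std_gauss]
  have "(\<Sum>i<r. \<bar>g (i, i)\<bar>) \<le> sqrt (real r) * ky_fan2 r (random_mat q n g)" for g
  proof -
    have "(\<Sum>i<r. \<bar>g (i, i)\<bar>)\<^sup>2 \<le> real r * (\<Sum>i<r. (g (i, i))\<^sup>2)"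
      using sum_squared_le_sum_of_squares[of "\<lambda>i. \<bar>g (i, i)\<bar>" "{..<r}"] by (simp add: mult.commute)
    then have "(\<Sum>i<r. \<bar>g (i, i)\<bar>) \<le> sqrt (real r * (\<Sum>i<r. (g (i, i))\<^sup>2))" by (rule real_le_rsqrt)
    also have "\<dots> = sqrt (real r) * sqrt (\<Sum>i<r. (random_mat q n g $$ (i, i))\<^sup>2)"
      using r by (simp add: real_sqrt_mult)
    also have "\<dots> \<le> sqrt (real r) * ky_fan2 r (random_mat q n g)"
      using r by (intro mult_left_mono sum_diagonal_le_ky_fan2[of _ q n]) auto
    finally show ?thesis .
  qed
  then have "(\<integral>g. (\<Sum>i<r. \<bar>g (i, i)\<bar>) \<partial>gauss_PiM I) \<le> (\<integral>g. sqrt (real r) * ky_fan2 r (random_mat q n g) \<partial>gauss_PiM I)"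
    using gaussian_lipschitz.integrable_N[OF gaussian_lipschitz_ky_fan2, of q n r] comp(1)
    by (intro integral_mono) (auto simp: I_def)
  also have "\<dots> = sqrt (real r) * gaussian_ky_fan2 q n r"
    by (simp add: gaussian_ky_fan2_def gaussian_entries_eq I_def)
  also have "(\<integral>g. (\<Sum>i<r. \<bar>g (i, i)\<bar>) \<partial>gauss_PiM I) = real r * sqrt (2 / pi)"
    using comp by (subst Bochner_Integration.integral_sum) (auto simp: integral_abs_std_gauss)
  finally have le: "real r * sqrt (2 / pi) \<le> sqrt (real r) * gaussian_ky_fan2 q n r" .
  show ?thesis
  proof (cases "r = 0")
    case False
    have "sqrt (real r) * (sqrt (real r) * sqrt (2 / pi)) \<le> sqrt (real r) * gaussian_ky_fan2 q n r"
      using le by (simp add: mult.assoc[symmetric])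
    then have "sqrt (real r) * sqrt (2 / pi) \<le> gaussian_ky_fan2 q n r" using False by simp
    then have "(sqrt (real r) * sqrt (2 / pi))\<^sup>2 \<le> (gaussian_ky_fan2 q n r)\<^sup>2" by (intro power_mono) auto
    then show ?thesis by (simp add: power_mult_distrib mult.commute)
  qed simp
qed

text \<open>The concentration bound decays like
  \<open>exp (- \<theta>\<^sup>2 * S\<^sup>2 / 8)\<close> in the mean \<open>S\<close>, and
  \<open>S\<^sup>2\<close> is at least \<open>2 * r / pi\<close>. The terms are therefore dominated
  by a geometric sequence with ratio \<open>exp (- \<theta>\<^sup>2 / (4 * pi))\<close>, in which
  the dimensions no longer occur.\<close>

lemma nn_integral_ky_fan2_excess_sum:
  assumes "0 < a" "0 < \<theta>" and K: "a * (1 + \<theta>)\<^sup>2 \<le> K"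
  shows "(\<Sum>r\<le>min n q. \<integral>\<^sup>+g. ennreal (a * (ky_fan2 r (random_mat q n g))\<^sup>2 - K * (gaussian_ky_fan2 q n r)\<^sup>2) \<partial>gaussian_entries q n)
    \<le> ennreal (2 * a * (1 + 1 / \<theta>)\<^sup>2 * exp 2 / (1 - exp (- \<theta>\<^sup>2 / (4 * pi))))"
proof -
  define C where "C = 2 * a * (1 + 1 / \<theta>)\<^sup>2 * exp 2"
  define \<rho> where "\<rho> = exp (- \<theta>\<^sup>2 / (4 * pi))"
  have C: "0 \<le> C" using assms by (simp add: C_def)
  have \<rho>: "0 \<le> \<rho>" "\<rho> < 1" using assms by (auto simp: \<rho>_def)
  have each: "(\<integral>\<^sup>+g. ennreal (a * (ky_fan2 r (random_mat q n g))\<^sup>2 - K * (gaussian_ky_fan2 q n r)\<^sup>2) \<partial>gaussian_entries q n)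
      \<le> ennreal (C * \<rho> ^ r)" if r: "r \<le> min n q" for r
  proof -
    have "(\<integral>\<^sup>+g. ennreal (a * (ky_fan2 r (random_mat q n g))\<^sup>2 - K * (gaussian_ky_fan2 q n r)\<^sup>2) \<partial>gaussian_entries q n)
        \<le> ennreal (C * exp (- \<theta>\<^sup>2 * (gaussian_ky_fan2 q n r)\<^sup>2 / 8))"
      using gaussian_lipschitz.nn_integral_excess[OF gaussian_lipschitz_ky_fan2 _ assms, of r q n]
      by (simp add: mean_ky_fan2 gaussian_entries_eq C_def)
    also have "\<dots> \<le> ennreal (C * \<rho> ^ r)"
    proof (intro ennreal_leI mult_left_mono C)
      have "\<theta>\<^sup>2 * (2 / pi * real r) \<le> \<theta>\<^sup>2 * (gaussian_ky_fan2 q n r)\<^sup>2"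
        using gaussian_ky_fan2_lower_bound[of r q n] r by (intro mult_left_mono) auto
      then have "- \<theta>\<^sup>2 * (gaussian_ky_fan2 q n r)\<^sup>2 / 8 \<le> real r * (- \<theta>\<^sup>2 / (4 * pi))"
        by (simp add: field_simps)
      then show "exp (- \<theta>\<^sup>2 * (gaussian_ky_fan2 q n r)\<^sup>2 / 8) \<le> \<rho> ^ r"
        by (simp add: \<rho>_def exp_of_nat_mult[symmetric])
    qed
    finally show ?thesis .
  qed
  have "(\<Sum>r\<le>min n q. \<integral>\<^sup>+g. ennreal (a * (ky_fan2 r (random_mat q n g))\<^sup>2 - K * (gaussian_ky_fan2 q n r)\<^sup>2) \<partial>gaussian_entries q n)
    \<le> (\<Sum>r\<le>min n q. ennreal (C * \<rho> ^ r))"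
    using each by (intro sum_mono) auto
  also have "\<dots> = ennreal (C * (\<Sum>r\<le>min n q. \<rho> ^ r))"
    using C \<rho> by (simp add: sum_distrib_left sum_ennreal)
  also have "\<dots> \<le> ennreal (C * (1 / (1 - \<rho>)))"
  proof (intro ennreal_leI mult_left_mono C)
    have "(\<Sum>r\<le>min n q. \<rho> ^ r) \<le> (\<Sum>r. \<rho> ^ r)" using \<rho> by (intro sum_le_suminf summable_geometric) auto
    then show "(\<Sum>r\<le>min n q. \<rho> ^ r) \<le> 1 / (1 - \<rho>)" using \<rho> by (simp add: suminf_geometric)
  qed
  finally show ?thesis by (simp add: C_def \<rho>_def)
qed

text \<open>This is subadditivity of the rank in the form required by
  \<open>hs_inner_le_ky_fan2\<close>. Orthonormal bases of the two column spaces are put side by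
  side, and the coordinates of \<open>A\<close> are stacked on the negated coordinates of
  \<open>B\<close>.\<close>

lemma diff_factorization:
  assumes A: "A \<in> carrier_mat p n" and B: "B \<in> carrier_mat p n"
  obtains U V where "U \<in> carrier_mat p (mat_rank A + mat_rank B)" "V \<in> carrier_mat (mat_rank A + mat_rank B) n" "A - B = U * V"
proof -
  define k where "k = mat_rank A"
  define l where "l = mat_rank B"
  obtain P where P: "P \<in> carrier_mat p k" "P * (transpose_mat P * A) = A"
    using orthonormal_basis_of_column_space[OF A] k_def by blast
  obtain Q where Q: "Q \<in> carrier_mat p l" "Q * (transpose_mat Q * B) = B"
    using orthonormal_basis_of_column_space[OF B] l_def by blast
  define U where "U = Matrix.mat p (k + l) (\<lambda>(i, j). if j < k then P $$ (i, j) else Q $$ (i, j - k))"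
  define V where "V = Matrix.mat (k + l) n (\<lambda>(i, j). if i < k then (transpose_mat P * A) $$ (i, j) else - (transpose_mat Q * B) $$ (i - k, j))"
  have UV: "U \<in> carrier_mat p (k + l)" "V \<in> carrier_mat (k + l) n" by (auto simp: U_def V_def)
  have PA: "transpose_mat P * A \<in> carrier_mat k n" and QB: "transpose_mat Q * B \<in> carrier_mat l n" using P Q A B by auto
  have split: "(\<Sum>i<k + l. e i) = (\<Sum>i<k. e i) + (\<Sum>i<l. e (k + i))" for e :: "nat \<Rightarrow> real"
    by (induction l) (auto simp: add.assoc)
  have "A - B = U * V"
  proof (rule eq_matI)
    fix i j assume "i < dim_row (U * V)" "j < dim_col (U * V)"
    then have ij: "i < p" "j < n" using UV by auto
    have "(U * V) $$ (i, j) = (\<Sum>t<k. P $$ (i, t) * (transpose_mat P * A) $$ (t, j)) - (\<Sum>t<l. Q $$ (i, t) * (transpose_mat Q * B) $$ (t, j))"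
      unfolding mult_mat_entry[OF UV ij] split using ij by (simp add: U_def V_def sum_negf)
    also have "\<dots> = A $$ (i, j) - B $$ (i, j)"
      unfolding mult_mat_entry[OF P(1) PA ij, symmetric] mult_mat_entry[OF Q(1) QB ij, symmetric] P(2) Q(2) ..
    finally show "(A - B) $$ (i, j) = (U * V) $$ (i, j)" using A B ij by simp
  qed (use A B UV in auto)
  then show thesis using that UV by (simp add: k_def l_def)
qed

text \<open>The difference \<open>D\<close> has its columns in the range of \<open>X\<close>, hence
  \<open>D = Q * (Q\<^sup>T * D)\<close>, and \<open>E\<close> may be replaced by its compression
  with \<open>q\<close> rows. Thus the rank of \<open>X\<close>, not the number of observations,
  enters the penalty.\<close>

lemma hs_inner_noise_le:
  assumes X: "X \<in> carrier_mat m p" and Q: "Q \<in> carrier_mat m q" "orthonormal_cols Q" "Q * (transpose_mat Q * X) = X"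
    and A: "A \<in> carrier_mat p n" "mat_rank A \<le> r" and B: "B \<in> carrier_mat p n" "mat_rank B \<le> s"
    and E: "E \<in> carrier_mat m n"
  shows "hs_inner E (X * A - X * B) \<le> ky_fan2 (r + s) (transpose_mat Q * E) * hs_norm (X * A - X * B)"
proof -
  define k where "k = mat_rank A + mat_rank B"
  obtain U V where UV: "U \<in> carrier_mat p k" "V \<in> carrier_mat k n" "A - B = U * V"
    using diff_factorization[OF A(1) B(1)] unfolding k_def .
  define D where "D = X * A - X * B"
  have D: "D \<in> carrier_mat m n" using X A B by (simp add: D_def minus_carrier_mat)
  have DX: "D = X * (A - B)" unfolding D_def using X A B by (intro mult_minus_distrib_mat[symmetric, of _ m p _ n]) auto
  have AB: "A - B \<in> carrier_mat p n" using B by (simp add: minus_carrier_mat)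
  have QX: "transpose_mat Q * X \<in> carrier_mat q p" using Q X by simp
  have QD: "transpose_mat Q * D = (transpose_mat Q * X * U) * V"
  proof -
    have "transpose_mat Q * D = transpose_mat Q * X * (A - B)"
      unfolding DX using Q X AB by (intro assoc_mult_mat[symmetric, of _ q m _ p _ n]) auto
    also have "\<dots> = transpose_mat Q * X * U * V"
      unfolding UV(3) using QX UV by (intro assoc_mult_mat[symmetric, of _ q p _ k _ n]) auto
    finally show ?thesis .
  qed
  have "Q * (transpose_mat Q * D) = D"
  proof -
    have "transpose_mat Q * D = transpose_mat Q * X * (A - B)"
      unfolding DX using Q X AB by (intro assoc_mult_mat[symmetric, of _ q m _ p _ n]) auto
    then have "Q * (transpose_mat Q * D) = Q * (transpose_mat Q * X * (A - B))" by simp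
    also have "\<dots> = Q * (transpose_mat Q * X) * (A - B)"
      using Q(1) QX AB by (intro assoc_mult_mat[symmetric, of _ m q _ p _ n]) auto
    finally show ?thesis by (simp add: Q(3) DX)
  qed
  then have "hs_inner E D = hs_inner (Q * (transpose_mat Q * D)) E"
    using hs_inner_commute[OF E D] by simp
  also have "\<dots> = hs_inner (transpose_mat Q * D) (transpose_mat Q * E)"
    using Q D E by (intro hs_inner_mult_left) auto
  also have "\<dots> = hs_inner (transpose_mat Q * E) (transpose_mat Q * D)"
    using Q D E by (intro hs_inner_commute[of _ q n]) auto
  also have "\<dots> \<le> ky_fan2 k (transpose_mat Q * E) * hs_norm (transpose_mat Q * D)"
    unfolding QD using Q E QX UV by (intro hs_inner_le_ky_fan2[of _ q n]) auto
  also have "\<dots> \<le> ky_fan2 (r + s) (transpose_mat Q * E) * hs_norm D"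
    using A(2) B(2) Q D by (intro mult_mono ky_fan2_mono hs_norm_transpose_mult_le) (auto simp: k_def)
  finally show ?thesis by (simp add: D_def)
qed

text \<open>In the application \<open>x\<close> and \<open>y\<close> are the errors of the estimator
  and of the comparison matrix, \<open>d\<close> is the distance of the two fits, \<open>R\<close>
  and \<open>P\<close> are the penalties at the selected and the comparison rank, and
  \<open>z\<close> is the total excess. Young's inequality with weight \<open>a = 1 + t\<close>
  splits the noise term; as \<open>N1\<close> and \<open>N2\<close> are controlled with the same
  factor, the penalty \<open>R\<close> cancels.\<close>

lemma oracle_arithmetic:
  fixes x y d N N1 N2 P R \<sigma> t z :: real
  assumes t: "0 < t" and "0 \<le> x" "0 \<le> y" "0 \<le> d" "d \<le> x + y"
    and main: "x\<^sup>2 \<le> y\<^sup>2 + 2 * \<sigma> * (N * d) + P * \<sigma>\<^sup>2 - R * \<sigma>\<^sup>2"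
    and N: "N\<^sup>2 \<le> N1\<^sup>2 + N2\<^sup>2" and N1: "(1 + t) * N1\<^sup>2 \<le> R + z" and N2: "(1 + t) * N2\<^sup>2 \<le> P + z"
  shows "x\<^sup>2 \<le> 2 * (1 + t) / t * ((1 + (1 + 2 / t) / (1 + t)) * y\<^sup>2 + 2 * (P * \<sigma>\<^sup>2) + 2 * \<sigma>\<^sup>2 * z)"
proof -
  define a where "a = 1 + t"
  have a: "0 < a" using t by (simp add: a_def)
  have "0 \<le> (d - a * (\<sigma> * N))\<^sup>2" by simp
  then have "2 * a * (\<sigma> * (N * d)) \<le> d\<^sup>2 + a\<^sup>2 * (\<sigma>\<^sup>2 * N\<^sup>2)"
    by (simp add: power2_diff power_mult_distrib mult_ac)
  then have "a * (2 * \<sigma> * (N * d)) \<le> a * (d\<^sup>2 / a + \<sigma>\<^sup>2 * (a * N\<^sup>2))"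
    using a by (simp add: distrib_left power2_eq_square mult_ac)
  then have young: "2 * \<sigma> * (N * d) \<le> d\<^sup>2 / a + \<sigma>\<^sup>2 * (a * N\<^sup>2)" using a by simp
  have "a * N\<^sup>2 \<le> a * N1\<^sup>2 + a * N2\<^sup>2" using N a by (simp add: distrib_left[symmetric])
  also have "\<dots> \<le> R + P + 2 * z" using N1 N2 by (simp add: a_def)
  finally have "\<sigma>\<^sup>2 * (a * N\<^sup>2) \<le> \<sigma>\<^sup>2 * (R + P + 2 * z)" by (intro mult_left_mono) auto
  then have 1: "x\<^sup>2 \<le> y\<^sup>2 + d\<^sup>2 / a + 2 * (P * \<sigma>\<^sup>2) + 2 * \<sigma>\<^sup>2 * z"
    using main young by (simp add: algebra_simps)
  have "d\<^sup>2 \<le> (x + y)\<^sup>2" using assms by (intro power_mono) auto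
  \<comment> \<open>The weight \<open>t / 2\<close>, half of what is available, makes the
    coefficient of \<open>x\<^sup>2\<close> after division by \<open>a\<close> smaller than 1, so
    that this term can be absorbed into the left side.\<close>
  also have "\<dots> \<le> (1 + t / 2) * x\<^sup>2 + (1 + 2 / t) * y\<^sup>2"
  proof -
    have "0 \<le> (sqrt (t / 2) * x - sqrt (2 / t) * y)\<^sup>2" by simp
    also have "\<dots> = t / 2 * x\<^sup>2 + 2 / t * y\<^sup>2 - 2 * (sqrt (t / 2) * sqrt (2 / t)) * (x * y)"
      using t by (simp add: power2_diff power_mult_distrib mult_ac)
    also have "sqrt (t / 2) * sqrt (2 / t) = 1" using t by (simp add: real_sqrt_mult[symmetric])
    finally show ?thesis by (simp add: power2_sum algebra_simps)
  qed
  finally have "d\<^sup>2 / a \<le> ((1 + t / 2) * x\<^sup>2 + (1 + 2 / t) * y\<^sup>2) / a" using a by (intro divide_right_mono) auto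
  with 1 have "x\<^sup>2 - (1 + t / 2) * x\<^sup>2 / a \<le> (1 + (1 + 2 / t) / a) * y\<^sup>2 + 2 * (P * \<sigma>\<^sup>2) + 2 * \<sigma>\<^sup>2 * z"
    by (simp add: add_divide_distrib algebra_simps)
  moreover have "x\<^sup>2 - (1 + t / 2) * x\<^sup>2 / a = x\<^sup>2 * (t / (2 * a))"
    using t by (simp add: a_def field_simps)
  ultimately have "2 * a / t * (x\<^sup>2 * (t / (2 * a))) \<le> 2 * a / t * ((1 + (1 + 2 / t) / a) * y\<^sup>2 + 2 * (P * \<sigma>\<^sup>2) + 2 * \<sigma>\<^sup>2 * z)"
    using a t by (intro mult_left_mono) auto
  moreover have "2 * a / t * (x\<^sup>2 * (t / (2 * a))) = x\<^sup>2" using a t by simp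
  ultimately show ?thesis by (simp add: a_def)
qed

text \<open>The squared norm of the noise is common to all candidates \<open>G\<close> and cancels
  when two residuals are compared.\<close>

lemma hs_norm_noisy_diff:
  assumes "f \<in> carrier_mat m n" "E \<in> carrier_mat m n" "G \<in> carrier_mat m n"
  shows "(hs_norm (f + \<sigma> \<cdot>\<^sub>m E - G))\<^sup>2 = (hs_norm (\<sigma> \<cdot>\<^sub>m E))\<^sup>2 - 2 * \<sigma> * hs_inner E (G - f) + (hs_norm (G - f))\<^sup>2"
proof -
  have sE: "\<sigma> \<cdot>\<^sub>m E \<in> carrier_mat m n" and Gf: "G - f \<in> carrier_mat m n"
    using assms by (auto intro: minus_carrier_mat)
  have "f + \<sigma> \<cdot>\<^sub>m E - G = \<sigma> \<cdot>\<^sub>m E - (G - f)" using assms by (intro eq_matI) auto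
  then have "(hs_norm (f + \<sigma> \<cdot>\<^sub>m E - G))\<^sup>2 = hs_inner (\<sigma> \<cdot>\<^sub>m E - (G - f)) (\<sigma> \<cdot>\<^sub>m E - (G - f))"
    by (simp add: hs_norm_square)
  also have "\<dots> = hs_inner (\<sigma> \<cdot>\<^sub>m E) (\<sigma> \<cdot>\<^sub>m E) - 2 * hs_inner (\<sigma> \<cdot>\<^sub>m E) (G - f) + hs_inner (G - f) (G - f)"
    using hs_inner_diff(1)[OF sE Gf minus_carrier_mat[OF Gf, of "\<sigma> \<cdot>\<^sub>m E"]] hs_inner_diff(2)[OF sE Gf sE]
      hs_inner_diff(2)[OF sE Gf Gf] hs_inner_commute[OF sE Gf] by simp
  finally show ?thesis using hs_inner_smult(1)[OF assms(2) Gf, of \<sigma>] by (simp add: hs_norm_square)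
qed

text \<open>A deterministic statement for each fixed \<open>E\<close>. The bound \<open>z\<close>
  must control the excess at all ranks simultaneously, since the selected rank \<open>s\<close>
  depends on \<open>E\<close>.\<close>

lemma oracle_inequality_pointwise:
  fixes X A E B :: "real mat"
  assumes X: "X \<in> carrier_mat m p" and A: "A \<in> carrier_mat p n" and E: "E \<in> carrier_mat m n" and "0 < t" "0 < \<sigma>"
    and Q: "Q \<in> carrier_mat m q" "orthonormal_cols Q" "Q * (transpose_mat Q * X) = X"
    and est: "\<And>r. r \<le> M \<Longrightarrow> is_rank_restricted_estimator X r (X * A + \<sigma> \<cdot>\<^sub>m E) (Ahat r (X * A + \<sigma> \<cdot>\<^sub>m E))"
    and sel: "is_arg_min (crit X \<sigma> pen Ahat (X * A + \<sigma> \<cdot>\<^sub>m E)) (\<lambda>r. r \<le> M) s"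
    and B: "B \<in> carrier_mat p n" "mat_rank B \<le> r" and r: "r \<le> M"
    and z: "\<And>r. r \<le> M \<Longrightarrow> (1 + t) * (ky_fan2 r (transpose_mat Q * E))\<^sup>2 \<le> pen r + z"
  shows "(hs_norm (X * Ahat s (X * A + \<sigma> \<cdot>\<^sub>m E) - X * A))\<^sup>2
    \<le> 2 * (1 + t) / t * ((1 + (1 + 2 / t) / (1 + t)) * (hs_norm (X * B - X * A))\<^sup>2 + 2 * (pen r * \<sigma>\<^sup>2) + 2 * \<sigma>\<^sup>2 * z)"
proof -
  define f where "f = X * A"
  define Y where "Y = f + \<sigma> \<cdot>\<^sub>m E"
  define F where "F = X * Ahat s Y"
  define G where "G = X * B"
  have f: "f \<in> carrier_mat m n" using X A by (simp add: f_def)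
  have Y: "Y \<in> carrier_mat m n" using f E by (simp add: Y_def)
  have s: "s \<le> M" using sel by (simp add: is_arg_min_def)
  have estY: "Ahat k Y \<in> carrier_mat p n" "mat_rank (Ahat k Y) \<le> k"
    "\<And>C. C \<in> carrier_mat p n \<Longrightarrow> mat_rank C \<le> k \<Longrightarrow> hs_norm (Y - X * Ahat k Y) \<le> hs_norm (Y - X * C)" if "k \<le> M" for k
    using est[OF that] X Y unfolding is_rank_restricted_estimator_def is_arg_min_def Y_def[unfolded f_def, symmetric]
    by (auto simp: not_less)
  have F: "F \<in> carrier_mat m n" using X estY(1)[OF s] by (simp add: F_def)
  have G: "G \<in> carrier_mat m n" using X B by (simp add: G_def)
  have Ff: "F - f \<in> carrier_mat m n" and Gf: "G - f \<in> carrier_mat m n" using f by (auto intro: minus_carrier_mat)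
  have "crit X \<sigma> pen Ahat Y s \<le> crit X \<sigma> pen Ahat Y r"
    using sel r unfolding is_arg_min_def Y_def f_def by (auto simp: not_less)
  \<comment> \<open>The criterion at \<open>r\<close> involves the noise-dependent fit, but the
    minimality of its residual allows passing to the given matrix \<open>B\<close>.\<close>
  moreover have "(hs_norm (Y - X * Ahat r Y))\<^sup>2 \<le> (hs_norm (Y - G))\<^sup>2"
    unfolding G_def by (intro power_mono estY(3)[OF r] B) auto
  ultimately have "(hs_norm (Y - F))\<^sup>2 + pen s * \<sigma>\<^sup>2 \<le> (hs_norm (Y - G))\<^sup>2 + pen r * \<sigma>\<^sup>2"
    unfolding crit_def F_def by linarith
  then have "(hs_norm (F - f))\<^sup>2 \<le> (hs_norm (G - f))\<^sup>2 + 2 * \<sigma> * (hs_inner E (F - f) - hs_inner E (G - f)) + pen r * \<sigma>\<^sup>2 - pen s * \<sigma>\<^sup>2"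
    unfolding Y_def hs_norm_noisy_diff[OF f E F] hs_norm_noisy_diff[OF f E G] by (simp add: algebra_simps)
  also have "hs_inner E (F - f) - hs_inner E (G - f) = hs_inner E (F - G)"
    by (simp add: hs_inner_diff(2)[OF F f E] hs_inner_diff(2)[OF G f E] hs_inner_diff(2)[OF F G E])
  finally have "(hs_norm (F - f))\<^sup>2 \<le> (hs_norm (G - f))\<^sup>2 + 2 * \<sigma> * hs_inner E (F - G) + pen r * \<sigma>\<^sup>2 - pen s * \<sigma>\<^sup>2" .
  moreover have "hs_inner E (F - G) \<le> ky_fan2 (s + r) (transpose_mat Q * E) * hs_norm (F - G)"
    unfolding F_def G_def by (rule hs_inner_noise_le[OF X Q estY(1,2)[OF s] B E])
  then have "2 * \<sigma> * hs_inner E (F - G) \<le> 2 * \<sigma> * (ky_fan2 (s + r) (transpose_mat Q * E) * hs_norm (F - G))"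
    using \<open>0 < \<sigma>\<close> by (intro mult_left_mono) auto
  ultimately have main: "(hs_norm (F - f))\<^sup>2 \<le> (hs_norm (G - f))\<^sup>2
      + 2 * \<sigma> * (ky_fan2 (s + r) (transpose_mat Q * E) * hs_norm (F - G)) + pen r * \<sigma>\<^sup>2 - pen s * \<sigma>\<^sup>2" by simp
  have fG: "f - G \<in> carrier_mat m n" using G by (rule minus_carrier_mat)
  have "F - G = (F - f) + (f - G)" using F f G by (intro eq_matI) auto
  then have d: "hs_norm (F - G) \<le> hs_norm (F - f) + hs_norm (G - f)"
    using hs_norm_triangle[OF Ff fG] hs_norm_uminus_diff[OF f G] by simp
  have QE: "transpose_mat Q * E \<in> carrier_mat q n" using Q E by simp
  show ?thesis
    using oracle_arithmetic[OF \<open>0 < t\<close> hs_norm_nonneg hs_norm_nonneg hs_norm_nonneg d main ky_fan2_add_square_le[OF QE] z[OF s] z[OF r]]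
    by (simp add: F_def G_def f_def Y_def)
qed

lemma prob_space_gaussian_entries: "prob_space (gaussian_entries m n)"
  unfolding gaussian_entries_eq by (rule prob_space_gauss_PiM)

theorem theorem1:
  fixes K :: real
  assumes "K > 1"
  shows "\<exists>c::real. c > 0 \<and>
    (\<forall>(m::nat) (n::nat) (p::nat) (q::nat) (X::real mat) (A::real mat) (\<sigma>::real)
       (pen::nat \<Rightarrow> real) (Ahat::nat \<Rightarrow> real mat \<Rightarrow> real mat) (rhat::real mat \<Rightarrow> nat).
       m > 0 \<longrightarrow> n > 0 \<longrightarrow> p > 0 \<longrightarrow>
       X \<in> carrier_mat m p \<longrightarrow> X \<noteq> 0\<^sub>m m p \<longrightarrow> q = mat_rank X \<longrightarrow>
       A \<in> carrier_mat p n \<longrightarrow> \<sigma> > 0 \<longrightarrow>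
       (\<forall>r \<le> min n q. pen r \<ge> K * (gaussian_ky_fan2 q n r)\<^sup>2) \<longrightarrow>
       (\<forall>Y \<in> carrier_mat m n. \<forall>r \<le> min n q. is_rank_restricted_estimator X r Y (Ahat r Y)) \<longrightarrow>
       (\<forall>Y \<in> carrier_mat m n. is_arg_min (crit X \<sigma> pen Ahat Y) (\<lambda>r. r \<le> min n q) (rhat Y)) \<longrightarrow>
       expect_noise m n
           (\<lambda>E. let Y = X * A + \<sigma> \<cdot>\<^sub>m E in (hs_norm (X * Ahat (rhat Y) Y - X * A))\<^sup>2)
         \<le> ennreal c *
           (MIN r \<in> {0..min n q}.
              expect_noise m n
                (\<lambda>E. let Y = X * A + \<sigma> \<cdot>\<^sub>m E in (hs_norm (X * A - X * Ahat r Y))\<^sup>2)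
              + ennreal (pen r * \<sigma>\<^sup>2) + ennreal (\<sigma>\<^sup>2)))"
proof -
  \<comment> \<open>The choice puts \<open>1 + t\<close> halfway between 1 and \<open>K\<close>. The
    remaining factor is \<open>(1 + \<theta>)\<^sup>2\<close>, with equality in
    \<open>(1 + t) * (1 + \<theta>)\<^sup>2 = K\<close>.\<close>
  define t where "t = (K - 1) / 2"
  have t: "0 < t" "1 + t < K" using assms by (auto simp: t_def field_simps)
  define \<theta> where "\<theta> = sqrt (K / (1 + t)) - 1"
  have \<theta>: "0 < \<theta>" "(1 + t) * (1 + \<theta>)\<^sup>2 \<le> K" using t by (auto simp: \<theta>_def)
  define C where "C = 2 * (1 + t) * (1 + 1 / \<theta>)\<^sup>2 * exp 2 / (1 - exp (- \<theta>\<^sup>2 / (4 * pi)))"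
  define c2 where "c2 = 2 * (1 + t) / t"
  define c0 where "c0 = 1 + (1 + 2 / t) / (1 + t)"
  define c1 where "c1 = c2 * c0"
  \<comment> \<open>The summands are the coefficients of the approximation error, of the penalty and
    of \<open>\<sigma>\<^sup>2\<close>; their sum dominates each of them.\<close>
  define c where "c = c1 + 2 * c2 + 2 * c2 * C"
  have c2: "0 < c2" using t by (simp add: c2_def)
  have c1: "0 < c1" unfolding c1_def c0_def using c2 t by (intro mult_pos_pos add_pos_pos divide_pos_pos) auto
  have C: "0 \<le> C" using t \<theta> by (simp add: C_def)
  have c: "0 < c" "c1 \<le> c" "2 * c2 \<le> c" "2 * c2 * C \<le> c" using c1 c2 C by (auto simp: c_def intro: add_pos_nonneg)
  show ?thesis
  proof (intro exI[of _ c] conjI allI impI c(1))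
    fix m n p q :: nat and X A :: "real mat" and \<sigma> :: real and pen :: "nat \<Rightarrow> real"
      and Ahat :: "nat \<Rightarrow> real mat \<Rightarrow> real mat" and rhat :: "real mat \<Rightarrow> nat"
    assume X: "X \<in> carrier_mat m p" and q: "q = mat_rank X" and A: "A \<in> carrier_mat p n" and \<sigma>: "0 < \<sigma>"
      and pen: "\<forall>r \<le> min n q. pen r \<ge> K * (gaussian_ky_fan2 q n r)\<^sup>2"
      and est: "\<forall>Y \<in> carrier_mat m n. \<forall>r \<le> min n q. is_rank_restricted_estimator X r Y (Ahat r Y)"
      and sel: "\<forall>Y \<in> carrier_mat m n. is_arg_min (crit X \<sigma> pen Ahat Y) (\<lambda>r. r \<le> min n q) (rhat Y)"
    obtain Q where Q: "Q \<in> carrier_mat m q" "orthonormal_cols Q" "Q * (transpose_mat Q * X) = X"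
      using orthonormal_basis_of_column_space[OF X] q by blast
    interpret prob_space "gaussian_entries m n" by (rule prob_space_gaussian_entries)
    define M where "M = min n q"
    define S where "S = (\<lambda>r. gaussian_ky_fan2 q n r)"
    \<comment> \<open>The excess is measured against \<open>K * (S r)\<^sup>2\<close> instead of the
      penalty, so its expectation does not depend on the penalty. As positive parts, the excesses
      can be summed into one \<open>Z\<close> that bounds each of them.\<close>
    define zf where "zf = (\<lambda>r g. max 0 ((1 + t) * (ky_fan2 r (transpose_mat Q * random_mat m n g))\<^sup>2 - K * (S r)\<^sup>2))"
    define Z where "Z = (\<lambda>g. \<Sum>r\<le>M. zf r g)"
    have [measurable]: "(\<lambda>g. ky_fan2 r (transpose_mat Q * random_mat m n g)) \<in> borel_measurable (gaussian_entries m n)" for r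
      by (rule borel_measurable_ky_fan2_compression[OF Q(1,2)])
    have mz[measurable]: "zf r \<in> borel_measurable (gaussian_entries m n)" for r unfolding zf_def by measurable
    have mZ[measurable]: "Z \<in> borel_measurable (gaussian_entries m n)" unfolding Z_def by measurable
    have zf0: "0 \<le> zf r g" for r g by (simp add: zf_def)
    have Z0: "0 \<le> Z g" for g unfolding Z_def by (intro sum_nonneg zf0)
    have EZ: "(\<integral>\<^sup>+g. ennreal (Z g) \<partial>gaussian_entries m n) \<le> ennreal C"
    proof -
      have "(\<integral>\<^sup>+g. ennreal (Z g) \<partial>gaussian_entries m n) = (\<Sum>r\<le>M. \<integral>\<^sup>+g. ennreal (zf r g) \<partial>gaussian_entries m n)"
        unfolding Z_def using zf0 by (subst nn_integral_sum[symmetric]) (auto simp: sum_ennreal)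
      also have "\<dots> = (\<Sum>r\<le>M. \<integral>\<^sup>+g. ennreal ((1 + t) * (ky_fan2 r (random_mat q n g))\<^sup>2 - K * (S r)\<^sup>2) \<partial>gaussian_entries q n)"
      proof (rule sum.cong[OF refl])
        fix r
        have "(\<integral>\<^sup>+g. ennreal (zf r g) \<partial>gaussian_entries m n)
            = (\<integral>\<^sup>+g. ennreal ((1 + t) * (ky_fan2 r (transpose_mat Q * random_mat m n g))\<^sup>2 - K * (S r)\<^sup>2) \<partial>gaussian_entries m n)"
          unfolding zf_def by (intro nn_integral_cong) (auto simp: max_def ennreal_neg)
        also have "\<dots> = (\<integral>\<^sup>+g. ennreal ((1 + t) * (ky_fan2 r (random_mat q n g))\<^sup>2 - K * (S r)\<^sup>2) \<partial>gaussian_entries q n)"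
          by (rule nn_integral_ky_fan2_compression[OF Q(1,2), of "\<lambda>x. ennreal ((1 + t) * x\<^sup>2 - K * (S r)\<^sup>2)"]) measurable
        finally show "(\<integral>\<^sup>+g. ennreal (zf r g) \<partial>gaussian_entries m n)
            = (\<integral>\<^sup>+g. ennreal ((1 + t) * (ky_fan2 r (random_mat q n g))\<^sup>2 - K * (S r)\<^sup>2) \<partial>gaussian_entries q n)" .
      qed
      also have "\<dots> \<le> ennreal C"
        unfolding S_def M_def C_def using t \<theta> by (intro nn_integral_ky_fan2_excess_sum) auto
      finally show ?thesis .
    qed
    let ?L = "expect_noise m n (\<lambda>E. let Y = X * A + \<sigma> \<cdot>\<^sub>m E in (hs_norm (X * Ahat (rhat Y) Y - X * A))\<^sup>2)"
    let ?R = "\<lambda>r. expect_noise m n (\<lambda>E. let Y = X * A + \<sigma> \<cdot>\<^sub>m E in (hs_norm (X * A - X * Ahat r Y))\<^sup>2)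
              + ennreal (pen r * \<sigma>\<^sup>2) + ennreal (\<sigma>\<^sup>2)"
    have f: "X * A \<in> carrier_mat m n" using X A by simp
    have Y: "X * A + \<sigma> \<cdot>\<^sub>m random_mat m n g \<in> carrier_mat m n" for g using f by simp
    have bound: "?L \<le> ennreal c * ?R r" if r: "r \<le> M" for r
    proof -
      \<comment> \<open>a deterministic comparison matrix: the rank-\<open>r\<close> fit to the noiseless signal\<close>
      define B where "B = Ahat r (X * A)"
      have estf: "is_rank_restricted_estimator X r (X * A) B" using est f r by (simp add: B_def M_def)
      have B: "B \<in> carrier_mat p n" "mat_rank B \<le> r"
        using estf X A unfolding is_rank_restricted_estimator_def is_arg_min_def by auto
      have Bmin: "hs_norm (X * A - X * B) \<le> hs_norm (X * A - X * D)" if "D \<in> carrier_mat p n" "mat_rank D \<le> r" for D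
        using estf that X A unfolding is_rank_restricted_estimator_def is_arg_min_def by (auto simp: not_less)
      define y where "y = hs_norm (X * B - X * A)"
      have y: "y = hs_norm (X * A - X * B)" unfolding y_def using X A B by (intro hs_norm_uminus_diff[of _ m n]) auto
      \<comment> \<open>Nonnegativity ensures that \<open>ennreal (pen r * \<sigma>\<^sup>2)\<close>
        is not truncated.\<close>
      have pr: "0 \<le> pen r"
      proof -
        have "0 \<le> K * (gaussian_ky_fan2 q n r)\<^sup>2" using assms by simp
        then show ?thesis using pen r unfolding M_def by (meson order_trans)
      qed
      have pt: "(hs_norm (X * Ahat (rhat (X * A + \<sigma> \<cdot>\<^sub>m random_mat m n g)) (X * A + \<sigma> \<cdot>\<^sub>m random_mat m n g) - X * A))\<^sup>2
          \<le> c1 * y\<^sup>2 + 2 * c2 * (pen r * \<sigma>\<^sup>2) + 2 * c2 * \<sigma>\<^sup>2 * Z g" for g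
      proof -
        have "(1 + t) * (ky_fan2 s (transpose_mat Q * random_mat m n g))\<^sup>2 \<le> pen s + Z g" if s: "s \<le> M" for s
        proof -
          have "zf s g \<le> Z g" unfolding Z_def using s zf0 by (intro member_le_sum) auto
          moreover have "(1 + t) * (ky_fan2 s (transpose_mat Q * random_mat m n g))\<^sup>2 - K * (S s)\<^sup>2 \<le> zf s g"
            by (simp add: zf_def)
          moreover have "K * (S s)\<^sup>2 \<le> pen s" using pen s by (simp add: S_def M_def)
          ultimately show ?thesis by simp
        qed
        then have "(hs_norm (X * Ahat (rhat (X * A + \<sigma> \<cdot>\<^sub>m random_mat m n g)) (X * A + \<sigma> \<cdot>\<^sub>m random_mat m n g) - X * A))\<^sup>2
            \<le> 2 * (1 + t) / t * ((1 + (1 + 2 / t) / (1 + t)) * (hs_norm (X * B - X * A))\<^sup>2 + 2 * (pen r * \<sigma>\<^sup>2) + 2 * \<sigma>\<^sup>2 * Z g)"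
          using est sel Y[of g]
          by (intro oracle_inequality_pointwise[OF X A random_mat_carrier t(1) \<sigma> Q _ _ B r]) (auto simp: M_def)
        then show ?thesis unfolding c2_def[symmetric] c0_def[symmetric] c1_def y_def by (simp add: distrib_left mult_ac)
      qed
      \<comment> \<open>The integrand on the left may be non-measurable, but monotonicity holds
        regardless, and the majorant, a constant plus a multiple of \<open>Z\<close>, is measurable
        and can be split.\<close>
      have "?L \<le> (\<integral>\<^sup>+g. ennreal (c1 * y\<^sup>2 + 2 * c2 * (pen r * \<sigma>\<^sup>2)) + ennreal (2 * c2 * \<sigma>\<^sup>2) * ennreal (Z g) \<partial>gaussian_entries m n)"
        unfolding expect_noise_def Let_def
      proof (rule nn_integral_mono)
        fix g
        show "ennreal ((hs_norm (X * Ahat (rhat (X * A + \<sigma> \<cdot>\<^sub>m random_mat m n g)) (X * A + \<sigma> \<cdot>\<^sub>m random_mat m n g) - X * A))\<^sup>2)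
            \<le> ennreal (c1 * y\<^sup>2 + 2 * c2 * (pen r * \<sigma>\<^sup>2)) + ennreal (2 * c2 * \<sigma>\<^sup>2) * ennreal (Z g)"
          using pt[of g] c1 c2 pr Z0[of g]
          by (simp add: ennreal_mult[symmetric] ennreal_plus[symmetric] ennreal_leI del: ennreal_plus)
      qed
      also have "\<dots> = ennreal (c1 * y\<^sup>2 + 2 * c2 * (pen r * \<sigma>\<^sup>2)) + ennreal (2 * c2 * \<sigma>\<^sup>2) * (\<integral>\<^sup>+g. ennreal (Z g) \<partial>gaussian_entries m n)"
        by (simp add: nn_integral_add nn_integral_cmult emeasure_space_1)
      also have "\<dots> \<le> ennreal (c1 * y\<^sup>2 + 2 * c2 * (pen r * \<sigma>\<^sup>2)) + ennreal (2 * c2 * \<sigma>\<^sup>2) * ennreal C"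
        by (intro add_left_mono mult_left_mono EZ) simp
      also have "\<dots> = ennreal (c1 * y\<^sup>2 + 2 * c2 * (pen r * \<sigma>\<^sup>2) + 2 * c2 * C * \<sigma>\<^sup>2)"
        using c1 c2 C pr by (simp add: ennreal_mult[symmetric] ennreal_plus[symmetric] mult_ac del: ennreal_plus)
      also have "\<dots> \<le> ennreal (c * (y\<^sup>2 + pen r * \<sigma>\<^sup>2 + \<sigma>\<^sup>2))"
        unfolding distrib_left using c pr by (intro ennreal_leI add_mono mult_right_mono) auto
      also have "\<dots> = ennreal c * (ennreal (y\<^sup>2) + ennreal (pen r * \<sigma>\<^sup>2) + ennreal (\<sigma>\<^sup>2))"
        using c pr by (simp add: ennreal_mult ennreal_plus)
      also have "\<dots> \<le> ennreal c * ?R r"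
      proof (intro mult_left_mono add_mono order_refl)
        \<comment> \<open>For every realization \<open>Ahat r Y\<close> is a competitor in the
          minimum that defines \<open>B\<close>, so the constant \<open>y\<^sup>2\<close> lies below
          the oracle loss pointwise, and a constant equals its own expectation.\<close>
        have "ennreal (y\<^sup>2) = (\<integral>\<^sup>+g. ennreal (y\<^sup>2) \<partial>gaussian_entries m n)" by (simp add: emeasure_space_1)
        also have "\<dots> \<le> expect_noise m n (\<lambda>E. let Y = X * A + \<sigma> \<cdot>\<^sub>m E in (hs_norm (X * A - X * Ahat r Y))\<^sup>2)"
          unfolding expect_noise_def Let_def
        proof (intro nn_integral_mono ennreal_leI power_mono)
          fix g
          define Y where "Y = X * A + \<sigma> \<cdot>\<^sub>m random_mat m n g"
          have "is_rank_restricted_estimator X r Y (Ahat r Y)" using est Y[of g] r by (simp add: M_def Y_def)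
          then have "Ahat r Y \<in> carrier_mat p n" "mat_rank (Ahat r Y) \<le> r"
            using X Y[of g] unfolding is_rank_restricted_estimator_def is_arg_min_def Y_def by auto
          then show "y \<le> hs_norm (X * A - X * Ahat r (X * A + \<sigma> \<cdot>\<^sub>m random_mat m n g))"
            unfolding y Y_def[symmetric] by (rule Bmin)
        qed (simp add: y_def)
        finally show "ennreal (y\<^sup>2) \<le> expect_noise m n (\<lambda>E. let Y = X * A + \<sigma> \<cdot>\<^sub>m E in (hs_norm (X * A - X * Ahat r Y))\<^sup>2)" .
      qed simp
      finally show ?thesis .
    qed
    have "(MIN r \<in> {0..min n q}. ?R r) \<in> ?R ` {0..min n q}" by (intro Min_in) auto
    then obtain r where "(MIN r \<in> {0..min n q}. ?R r) = ?R r" "r \<in> {0..min n q}" by (rule imageE)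
    moreover from this have "r \<le> M" by (simp add: M_def)
    ultimately show "?L \<le> ennreal c * (MIN r \<in> {0..min n q}. ?R r)" using bound[of r] by (simp only:)
  qed
qed

end
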